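(* Fix an integer $n\ge 2$. Then there exists a constant $\mathcal{K}=\mathcal{K}(n)>0$, depending only on $n$, such that for every bounded domain $U\subset\mathbb{R}^n$, $$[\nabla \mathbf{u}]_{\mathrm{BMO}(U)}\le \mathcal{K}\,[\nabla_{\mathrm s}\mathbf{u}]_{\mathrm{BMO}(U)}$$ for every $\mathbf{u}\in W^{1,1}_{\mathrm{loc}}(U;\mathbb{R}^n)$ with $\nabla\mathbf{u}\in \mathrm{BMO}(U)$, where $\nabla_{\mathrm s}\mathbf{u}:=\tfrac12\big[\nabla\mathbf{u}+(\nabla\mathbf{u})^{\mathrm T}\big]$.
   Context: A domain is a nonempty, connected, open set. $\nabla\mathbf{u}$ is the $n\times n$ matrix of weak partial derivatives of $\mathbf{u}$. Matrices carry the norm $|\mathbf{H}|=\sqrt{\mathrm{trace}(\mathbf{H}\mathbf{H}^{\mathrm T})}$. For $\psi\in L^1_{\mathrm{loc}}(U)$ (real- or matrix-valued) the BMO-seminorm is $$[\psi]_{\mathrm{BMO}(U)}:=\sup_{Q\subset\subset U}\frac1{|Q|}\int_Q|\psi(\mathbf{x})-\langle\psi\rangle_Q|\,d\mathbf{x},\qquad \langle\psi\rangle_Q:=\frac1{|Q|}\int_Q\psi(\mathbf{x})\,d\mathbf{x},$$ where the supremum is over all nonempty, bounded, open $n$-dimensional cubes $Q$ with faces parallel to the coordinate hyperplanes, and $Q\subset\subset U$ means that $Q$ is contained in some compact subset of $U$. $\mathrm{BMO}(U)$ is the set of $\psi\in L^1_{\mathrm{loc}}(U)$ with $[\psi]_{\mathrm{BMO}(U)}<\infty$.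 $W^{1,1}_{\mathrm{loc}}(U;\mathbb{R}^n)$ is the set of mappings that lie in $W^{1,1}(V;\mathbb{R}^n)$ for every domain $V\subset\subset U$. *)

theory Defs
  imports "HOL-Analysis.Analysis"
begin

definition is_domain :: "'a::topological_space set \<Rightarrow> bool" where
  "is_domain U \<longleftrightarrow> U \<noteq> {} \<and> open U \<and> connected U"

definition compactly_inside :: "'a::topological_space set \<Rightarrow> 'a set \<Rightarrow> bool" where
  "compactly_inside V U \<longleftrightarrow> (\<exists>C. compact C \<and> V \<subseteq> C \<and> C \<subseteq> U)"

definition partial_deriv :: "'n::finite \<Rightarrow> (real^'n \<Rightarrow> real) \<Rightarrow> real^'n \<Rightarrow> real" where
  "partial_deriv j f x = frechet_derivative f (at x) (axis j 1)"

primrec Ck :: "nat \<Rightarrow> (real^'n::finite \<Rightarrow> real) \<Rightarrow> bool" where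
  "Ck 0 f \<longleftrightarrow> continuous_on UNIV f"
| "Ck (Suc k) f \<longleftrightarrow> (\<forall>x. f differentiable (at x)) \<and> (\<forall>j. Ck k (partial_deriv j f))"

text \<open>Elements of \<open>C\<^sub>c\<^sup>\<infinity>(U)\<close>, extended by zero to the whole space.\<close>

definition test_function :: "(real^'n::finite) set \<Rightarrow> (real^'n \<Rightarrow> real) \<Rightarrow> bool" where
  "test_function U \<phi> \<longleftrightarrow>
     (\<forall>k. Ck k \<phi>) \<and> compact (closure {x. \<phi> x \<noteq> 0}) \<and> closure {x. \<phi> x \<noteq> 0} \<subseteq> U"

definition L1_loc :: "(real^'n::finite) set \<Rightarrow> (real^'n \<Rightarrow> 'b::euclidean_space) \<Rightarrow> bool" where
  "L1_loc U f \<longleftrightarrow> (\<forall>C. compact C \<and> C \<subseteq> U \<longrightarrow> set_integrable lebesgue C f)"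

text \<open>
  The weak gradient is only determined almost everywhere, so it is a relation: \<open>G\<close> represents
  the gradient of \<open>u\<close> on \<open>U\<close>. The entry \<open>G x $ i $ j\<close> is the weak derivative of the \<open>i\<close>-th
  component of \<open>u\<close> in the \<open>j\<close>-th coordinate direction.
\<close>

definition weak_gradient ::
    "(real^'n::finite) set \<Rightarrow> (real^'n \<Rightarrow> real^'m::finite) \<Rightarrow> (real^'n \<Rightarrow> real^'n^'m) \<Rightarrow> bool" where
  "weak_gradient U u G \<longleftrightarrow> L1_loc U u \<and> L1_loc U G \<and>
     (\<forall>\<phi> i j. test_function U \<phi> \<longrightarrow>
        set_lebesgue_integral lebesgue U (\<lambda>x. u x $ i * partial_deriv j \<phi> x) =
        - set_lebesgue_integral lebesgue U (\<lambda>x. G x $ i $ j * \<phi> x))"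

definition W11 :: "(real^'n::finite) set \<Rightarrow> (real^'n \<Rightarrow> real^'m::finite) set" where
  "W11 V = {u. set_integrable lebesgue V u \<and>
               (\<exists>G. weak_gradient V u G \<and> set_integrable lebesgue V G)}"

definition W11_loc :: "(real^'n::finite) set \<Rightarrow> (real^'n \<Rightarrow> real^'m::finite) set" where
  "W11_loc U = {u. \<forall>V. is_domain V \<and> compactly_inside V U \<longrightarrow> u \<in> W11 V}"

definition is_cube :: "(real^'n::finite) set \<Rightarrow> bool" where
  "is_cube Q \<longleftrightarrow> (\<exists>a h. h > 0 \<and> Q = box a (\<chi> i. a $ i + h))"

definition average :: "(real^'n::finite) set \<Rightarrow> (real^'n \<Rightarrow> 'b::euclidean_space) \<Rightarrow> 'b" where
  "average Q f = (1 / measure lebesgue Q) *\<^sub>R set_lebesgue_integral lebesgue Q f"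

definition BMO_seminorm :: "(real^'n::finite) set \<Rightarrow> (real^'n \<Rightarrow> 'b::euclidean_space) \<Rightarrow> ennreal" where
  "BMO_seminorm U f =
     (SUP Q \<in> {Q. is_cube Q \<and> compactly_inside Q U}.
        ennreal (average Q (\<lambda>x. norm (f x - average Q f))))"

definition BMO :: "(real^'n::finite) set \<Rightarrow> (real^'n \<Rightarrow> 'b::euclidean_space) set" where
  "BMO U = {f. L1_loc U f \<and> BMO_seminorm U f < \<infinity>}"

text \<open>The library norm on matrices is the one used for matrix-valued BMO.\<close>

lemma norm_matrix_eq_trace:
  fixes H :: "real^'n::finite^'m::finite"
  shows "norm H = sqrt (trace (H ** transpose H))"
  by (simp add: norm_eq_sqrt_inner inner_vec_def trace_def matrix_matrix_mult_def transpose_def)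

definition sym_part :: "real^'n::finite^'n \<Rightarrow> real^'n^'n" where
  "sym_part H = (1/2) *\<^sub>R (H + transpose H)"

end

theory Submission
  imports Defs
begin

text \<open>
  Mollification reduces the claim to smooth maps \<open>u\<close> on a cube, for which the largest mean oscillation
  \<open>B\<close> of \<open>\<nabla>u\<close> over subcubes is finite and can be absorbed. Let \<open>A\<close> be the largest mean oscillation
  of the symmetric part \<open>E\<close>. On a subcube, subtract from \<open>u\<close> a linear map so that \<open>\<nabla>u\<close> has mean zero, and
  let \<open>\<kappa>\<close> be a cutoff function equal to 1 except near the boundary.

  For compactly supported \<open>v\<close>, integration by parts gives \<open>\<integral>|\<nabla>v|\<^sup>2 \<le> 2\<integral>|E(v)|\<^sup>2\<close>. Apply this to
  \<open>v = \<kappa>(u - u\<^sub>\<epsilon>)\<close>, where \<open>u\<^sub>\<epsilon>\<close> is a mollification: the terms with \<open>\<nabla>\<kappa>\<close> contribute at most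
  \<open>C\<epsilon>\<^sup>2\<close> times the mean square of \<open>\<nabla>u\<close>, while \<open>\<nabla>u\<^sub>\<epsilon>\<close> is nearly constant because second derivatives of
  \<open>u\<close> are combinations of first derivatives of \<open>E\<close>. Near the boundary, where \<open>\<kappa> \<noteq> 1\<close>, the
  Cauchy-Schwarz inequality suffices since the volume is small. Mean square oscillations are bounded by
  mean oscillations (a weak form of the John-Nirenberg inequality). Altogether \<open>B \<le> C A + B/2\<close>.
\<close>

subsection \<open>Smooth functions and test functions\<close>

text \<open>On a cube, integration by parts leaves boundary terms. The cutoff removes them, but its
  gradient multiplies the map itself, on which there is no bound; after subtracting the
  mollification this error is again controlled by a small multiple of the gradient.

  The order of the choices matters. The cutoff comes first, with a layer so thin that it contributes
  at most \<open>B/4\<close>; it determines the factor of \<open>\<epsilon>\<^sup>2\<close>. Only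
  then is \<open>\<epsilon>\<close> made small. Constants that grow with the mollifier multiply the
  symmetric part alone, so they end up in the factor of \<open>A\<close>.

  Korn's inequality is quadratic whereas BMO measures mean oscillation. Hence the mean square bound
  is applied twice: to the symmetric part with \<open>A\<close>, and to the whole gradient with the
  still unknown \<open>B\<close>.

  Everything happens on subcubes of a single cube, so no constant can depend on the domain. A cube
  compactly inside the domain has a slightly larger closed cube inside it, which leaves the room
  needed for mollification.\<close>

definition smooth :: "(real^'n::finite \<Rightarrow> real) \<Rightarrow> bool" where
  "smooth f \<longleftrightarrow> (\<forall>k. Ck k f)"

lemma partial_deriv_eq:
  assumes "(f has_derivative D) (at x)"
  shows "partial_deriv j f x = D (axis j 1)"
  unfolding partial_deriv_def using frechet_derivative_at[OF assms] by simp

lemma linear_axis_expansion: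
  fixes D :: "real^'n::finite \<Rightarrow> real"
  assumes "linear D"
  shows "D h = (\<Sum>j\<in>UNIV. h $ j * D (axis j 1))"
proof -
  have "D h = D (\<Sum>j\<in>UNIV. h $ j *\<^sub>R axis j 1)"
    using basis_expansion[of h] by (simp add: scalar_mult_eq_scaleR)
  also have "\<dots> = (\<Sum>j\<in>UNIV. h $ j * D (axis j 1))"
    using assms by (simp add: linear_sum linear_scale)
  finally show ?thesis .
qed

lemma has_derivative_partial_deriv:
  assumes "f differentiable (at x)"
  shows "(f has_derivative (\<lambda>h. \<Sum>j\<in>UNIV. h $ j * partial_deriv j f x)) (at x)"
proof -
  have D: "(f has_derivative frechet_derivative f (at x)) (at x)"
    using assms frechet_derivative_works by blast
  have "frechet_derivative f (at x) = (\<lambda>h. \<Sum>j\<in>UNIV. h $ j * partial_deriv j f x)"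
    unfolding partial_deriv_def
    by (rule ext, rule linear_axis_expansion[OF has_derivative_linear[OF D]])
  with D show ?thesis by simp
qed

text \<open>The recursion for \<open>Ck\<close> says nothing about \<open>f\<close> beyond
  differentiability, so lowering the order is an induction whose base case is that differentiability
  implies continuity.\<close>

lemma Ck_Suc_imp_Ck: "Ck (Suc k) f \<Longrightarrow> Ck k f"
proof (induction k arbitrary: f)
  case 0
  then show ?case
    by (auto intro!: continuous_at_imp_continuous_on differentiable_imp_continuous_within)
qed auto

lemma partial_deriv_const [simp]: "partial_deriv j (\<lambda>x. c) = (\<lambda>x. 0)"
  by (rule ext, subst partial_deriv_eq[OF has_derivative_const]) simp

lemma partial_deriv_add:
  assumes "f differentiable (at x)" "g differentiable (at x)"
  shows "partial_deriv j (\<lambda>x. f x + g x) x = partial_deriv j f x + partial_deriv j g x"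
  using assms unfolding frechet_derivative_works
  by (subst partial_deriv_eq[OF has_derivative_add]) (auto simp: partial_deriv_def)

lemma partial_deriv_mult:
  assumes "f differentiable (at x)" "g differentiable (at x)"
  shows "partial_deriv j (\<lambda>x. f x * g x) x = f x * partial_deriv j g x + partial_deriv j f x * g x"
  using assms unfolding frechet_derivative_works
  by (subst partial_deriv_eq[OF has_derivative_mult]) (auto simp: partial_deriv_def)

lemma has_derivative_coord: "((\<lambda>x::real^'n::finite. x $ i) has_derivative (\<lambda>h. h $ i)) (at x)"
  by (rule bounded_linear.has_derivative[OF bounded_linear_vec_nth has_derivative_ident])

lemma partial_deriv_coord:
  "partial_deriv j (\<lambda>x::real^'n::finite. x $ i) = (\<lambda>x. if i = j then 1 else 0)"
  by (rule ext, subst partial_deriv_eq[OF has_derivative_coord]) (simp add: axis_def)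

lemma partial_deriv_affine:
  fixes f :: "real^'n::finite \<Rightarrow> real"
  assumes "f differentiable (at (a + c *\<^sub>R x))"
  shows "(\<lambda>x. f (a + c *\<^sub>R x)) differentiable (at x)"
    and "partial_deriv j (\<lambda>x. f (a + c *\<^sub>R x)) x = c * partial_deriv j f (a + c *\<^sub>R x)"
proof -
  have D: "(f has_derivative frechet_derivative f (at (a + c *\<^sub>R x))) (at (a + c *\<^sub>R x))"
    using assms frechet_derivative_works by blast
  have "((\<lambda>x. a + c *\<^sub>R x) has_derivative (\<lambda>h. c *\<^sub>R h)) (at x)"
    by (auto intro!: derivative_eq_intros)
  then have *: "((\<lambda>x. f (a + c *\<^sub>R x)) has_derivative (\<lambda>h. frechet_derivative f (at (a + c *\<^sub>R x)) (c *\<^sub>R h))) (at x)"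
    using D by (rule has_derivative_compose)
  then show "(\<lambda>x. f (a + c *\<^sub>R x)) differentiable (at x)"
    by (auto simp: differentiable_def)
  show "partial_deriv j (\<lambda>x. f (a + c *\<^sub>R x)) x = c * partial_deriv j f (a + c *\<^sub>R x)"
    using partial_deriv_eq[OF *] linear_scale[OF has_derivative_linear[OF D]]
    by (simp add: partial_deriv_def)
qed

lemma Ck_const [simp]: "Ck k (\<lambda>x. c)"
  by (induction k arbitrary: c) auto

lemma Ck_add: "Ck k f \<Longrightarrow> Ck k g \<Longrightarrow> Ck k (\<lambda>x. f x + g x)"
proof (induction k arbitrary: f g)
  case (Suc k)
  have "partial_deriv j (\<lambda>x. f x + g x) = (\<lambda>x. partial_deriv j f x + partial_deriv j g x)" for j
    using Suc.prems by (auto simp: partial_deriv_add)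
  then show ?case using Suc by (auto intro: differentiable_add)
qed (auto intro: continuous_intros)

lemma Ck_mult: "Ck k f \<Longrightarrow> Ck k g \<Longrightarrow> Ck k (\<lambda>x. f x * g x)"
proof (induction k arbitrary: f g)
  case (Suc k)
  have "partial_deriv j (\<lambda>x. f x * g x) = (\<lambda>x. f x * partial_deriv j g x + partial_deriv j f x * g x)" for j
    using Suc.prems by (auto simp: partial_deriv_mult)
  \<comment> \<open>Each term of the Leibniz rule keeps an undifferentiated factor, so the induction
    hypothesis also needs \<open>f\<close> and \<open>g\<close> themselves at the lower
    order.\<close>
  moreover have "Ck k f" "Ck k g"
    using Suc.prems by (blast intro: Ck_Suc_imp_Ck[of k])+
  ultimately show ?case using Suc by (auto intro!: Ck_add differentiable_mult)
qed (auto intro: continuous_intros)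

lemma Ck_coord: "Ck k (\<lambda>x::real^'n::finite. x $ i)"
proof (cases k)
  case (Suc m)
  have "(\<lambda>x::real^'n. x $ i) differentiable at x" for x
    using has_derivative_coord differentiable_def by blast
  then show ?thesis by (simp add: Suc partial_deriv_coord)
qed (auto intro: continuous_intros)

text \<open>Maps of the form \<open>a + c *\<^sub>R x\<close> cover every change of variables below:
  translations, the reflection of a convolution kernel, and the rescaling of a cube to the unit
  cube.\<close>

lemma Ck_affine: "Ck k f \<Longrightarrow> Ck k (\<lambda>x. f (a + c *\<^sub>R x))"
proof (induction k arbitrary: f)
  case 0
  then show ?case
    by (auto intro!: continuous_on_compose2[of UNIV f] continuous_intros)
next
  case (Suc k)
  have "partial_deriv j (\<lambda>x. f (a + c *\<^sub>R x)) = (\<lambda>x. c * partial_deriv j f (a + c *\<^sub>R x))" for j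
    using Suc.prems by (auto intro!: partial_deriv_affine)
  then show ?case using Suc by (auto intro!: partial_deriv_affine(1) Ck_mult)
qed

lemma smooth_const [simp]: "smooth (\<lambda>x. c)"
  and smooth_add: "smooth f \<Longrightarrow> smooth g \<Longrightarrow> smooth (\<lambda>x. f x + g x)"
  and smooth_mult: "smooth f \<Longrightarrow> smooth g \<Longrightarrow> smooth (\<lambda>x. f x * g x)"
  and smooth_coord [simp]: "smooth (\<lambda>x. x $ i)"
  and smooth_affine: "smooth f \<Longrightarrow> smooth (\<lambda>x. f (a + c *\<^sub>R x))"
  by (auto simp: smooth_def intro: Ck_add Ck_mult Ck_coord Ck_affine)

lemma smooth_partial: "smooth f \<Longrightarrow> smooth (partial_deriv j f)"
  unfolding smooth_def by (metis Ck.simps(2))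

lemma smooth_differentiable: "smooth f \<Longrightarrow> f differentiable (at x)"
  unfolding smooth_def by (metis Ck.simps(2))

lemma smooth_continuous: "smooth f \<Longrightarrow> continuous_on S f"
  unfolding smooth_def by (metis Ck.simps(1) continuous_on_subset subset_UNIV)

lemma smooth_has_derivative:
  "smooth f \<Longrightarrow> (f has_derivative (\<lambda>h. \<Sum>j\<in>UNIV. h $ j * partial_deriv j f x)) (at x)"
  by (intro has_derivative_partial_deriv smooth_differentiable)

lemma smooth_cmult: "smooth f \<Longrightarrow> smooth (\<lambda>x. c * f x)"
  by (intro smooth_mult smooth_const)

lemma smooth_minus: "smooth f \<Longrightarrow> smooth (\<lambda>x. - f x)"
  using smooth_cmult[of f "-1"] by simp

lemma smooth_diff: "smooth f \<Longrightarrow> smooth g \<Longrightarrow> smooth (\<lambda>x. f x - g x)"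
  using smooth_add[OF _ smooth_minus] by fastforce

lemma smooth_sum: "(\<And>i. i \<in> S \<Longrightarrow> smooth (f i)) \<Longrightarrow> smooth (\<lambda>x. \<Sum>i\<in>S. f i x)"
  by (induction S rule: infinite_finite_induct) (auto intro: smooth_add)

lemma partial_smooth_add:
  "smooth f \<Longrightarrow> smooth g \<Longrightarrow>
   partial_deriv j (\<lambda>x. f x + g x) x = partial_deriv j f x + partial_deriv j g x"
  by (intro partial_deriv_add smooth_differentiable)

lemma partial_smooth_mult:
  "smooth f \<Longrightarrow> smooth g \<Longrightarrow>
   partial_deriv j (\<lambda>x. f x * g x) x = f x * partial_deriv j g x + partial_deriv j f x * g x"
  by (intro partial_deriv_mult smooth_differentiable)

lemma partial_smooth_cmult:
  "smooth f \<Longrightarrow> partial_deriv j (\<lambda>x. c * f x) x = c * partial_deriv j f x"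
  by (simp add: partial_smooth_mult)

lemma partial_smooth_diff:
  "smooth f \<Longrightarrow> smooth g \<Longrightarrow>
   partial_deriv j (\<lambda>x. f x - g x) x = partial_deriv j f x - partial_deriv j g x"
  using partial_smooth_add[of f "\<lambda>x. (-1) * g x" j x] partial_smooth_cmult[of g j "-1" x]
    smooth_cmult[of g "-1"] by simp

lemma partial_smooth_affine:
  "smooth f \<Longrightarrow> partial_deriv j (\<lambda>x. f (a + c *\<^sub>R x)) x = c * partial_deriv j f (a + c *\<^sub>R x)"
  by (intro partial_deriv_affine smooth_differentiable)

lemma smooth_reflect: "smooth f \<Longrightarrow> smooth (\<lambda>z. f (x - z))"
  and partial_smooth_reflect:
    "smooth f \<Longrightarrow> partial_deriv j (\<lambda>z. f (x - z)) z = - partial_deriv j f (x - z)"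
  using smooth_affine[of f x "-1"] partial_smooth_affine[of f j x "-1" z] by simp_all

lemma partial_smooth_sum:
  "(\<And>i. i \<in> S \<Longrightarrow> smooth (f i)) \<Longrightarrow>
   partial_deriv j (\<lambda>x. \<Sum>i\<in>S. f i x) x = (\<Sum>i\<in>S. partial_deriv j (f i) x)"
proof (induction S rule: infinite_finite_induct)
  case (insert i S)
  have "partial_deriv j (\<lambda>x. f i x + (\<Sum>i\<in>S. f i x)) x = partial_deriv j (f i) x + partial_deriv j (\<lambda>x. \<Sum>i\<in>S. f i x) x"
    using insert by (intro partial_smooth_add smooth_sum) auto
  then show ?case using insert by simp
qed auto

lemma smooth_has_line_derivative:
  assumes "smooth f"
  shows "((\<lambda>t. f (x + t *\<^sub>R d)) has_field_derivative (\<Sum>j\<in>UNIV. d $ j * partial_deriv j f (x + t *\<^sub>R d))) (at t within S)"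
proof -
  have "((\<lambda>t. x + t *\<^sub>R d) has_derivative (\<lambda>h. h *\<^sub>R d)) (at t within S)"
    by (auto intro!: derivative_eq_intros)
  from has_derivative_compose[OF this smooth_has_derivative[OF assms]]
  have "((\<lambda>t. f (x + t *\<^sub>R d)) has_derivative (\<lambda>h. \<Sum>j\<in>UNIV. (h *\<^sub>R d) $ j * partial_deriv j f (x + t *\<^sub>R d))) (at t within S)" .
  then show ?thesis
    unfolding has_field_derivative_def
    by (elim has_derivative_eq_rhs) (simp add: fun_eq_iff sum_distrib_left ac_simps)
qed

lemma smooth_has_axis_derivative:
  assumes "smooth f"
  shows "((\<lambda>t. f (x + t *\<^sub>R axis j 1)) has_field_derivative partial_deriv j f (x + t *\<^sub>R axis j 1)) (at t within S)"
proof -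
  have "(\<Sum>i\<in>UNIV. axis j 1 $ i * partial_deriv i f y) = partial_deriv j f y" for y
    by (simp add: axis_def if_distrib[of "\<lambda>c. c * _"] cong: if_cong)
  then show ?thesis using smooth_has_line_derivative[OF assms, of x "axis j 1" t S] by simp
qed

section \<open>Symmetry of second derivatives\<close>

lemma smooth_second_difference:
  assumes "smooth f" "h > 0"
  shows "\<exists>s t. 0 < s \<and> s < h \<and> 0 < t \<and> t < h \<and>
    f (x + h *\<^sub>R axis i 1 + h *\<^sub>R axis j 1) - f (x + h *\<^sub>R axis i 1) - f (x + h *\<^sub>R axis j 1) + f x
    = h * h * partial_deriv j (partial_deriv i f) (x + s *\<^sub>R axis i 1 + t *\<^sub>R axis j 1)"
proof -
  \<comment> \<open>The difference of \<open>f\<close> along \<open>j\<close>, as a function of the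
    displacement along \<open>i\<close>. One mean value theorem in \<open>s\<close> and one in
    \<open>t\<close> produce the mixed derivative.\<close>
  define g where "g s = f ((x + h *\<^sub>R axis j 1) + s *\<^sub>R axis i 1) - f (x + s *\<^sub>R axis i 1)" for s
  have "\<exists>s>0. s < h \<and> g h - g 0 = (h - 0) * (partial_deriv i f ((x + h *\<^sub>R axis j 1) + s *\<^sub>R axis i 1) - partial_deriv i f (x + s *\<^sub>R axis i 1))"
    unfolding g_def
    by (rule MVT2) (use assms in \<open>auto intro!: DERIV_diff smooth_has_axis_derivative\<close>)
  then obtain s where s: "0 < s" "s < h" and gs: "g h - g 0 = h * (partial_deriv i f ((x + h *\<^sub>R axis j 1) + s *\<^sub>R axis i 1) - partial_deriv i f (x + s *\<^sub>R axis i 1))"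
    by auto
  have "\<exists>t>0. t < h \<and> partial_deriv i f ((x + s *\<^sub>R axis i 1) + h *\<^sub>R axis j 1) - partial_deriv i f ((x + s *\<^sub>R axis i 1) + 0 *\<^sub>R axis j 1) = (h - 0) * partial_deriv j (partial_deriv i f) ((x + s *\<^sub>R axis i 1) + t *\<^sub>R axis j 1)"
    by (rule MVT2) (use assms in \<open>auto intro!: smooth_has_axis_derivative smooth_partial\<close>)
  then obtain t where t: "0 < t" "t < h" and gt: "partial_deriv i f ((x + s *\<^sub>R axis i 1) + h *\<^sub>R axis j 1) - partial_deriv i f (x + s *\<^sub>R axis i 1) = h * partial_deriv j (partial_deriv i f) ((x + s *\<^sub>R axis i 1) + t *\<^sub>R axis j 1)"
    by auto
  have "g h - g 0 = h * h * partial_deriv j (partial_deriv i f) (x + s *\<^sub>R axis i 1 + t *\<^sub>R axis j 1)"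
    using gs gt by (simp add: add_ac)
  then show ?thesis using s t unfolding g_def by (intro exI[of _ s] exI[of _ t]) (simp add: algebra_simps)
qed

text \<open>The second difference is symmetric in \<open>i\<close> and \<open>j\<close>, so both
  mixed derivatives take a common value at suitable points near \<open>x\<close>; continuity then
  excludes a gap of \<open>2 * e\<close> at \<open>x\<close>.\<close>

theorem smooth_partial_commute:
  assumes "smooth f"
  shows "partial_deriv i (partial_deriv j f) x = partial_deriv j (partial_deriv i f) x"
proof (rule ccontr)
  assume ne: "\<not> ?thesis"
  define F where "F = partial_deriv i (partial_deriv j f)"
  define H where "H = partial_deriv j (partial_deriv i f)"
  define e where "e = \<bar>F x - H x\<bar> / 2"
  have e: "e > 0" using ne by (auto simp: e_def F_def H_def)
  have "isCont F x" "isCont H x"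
    using smooth_continuous[of _ UNIV] assms smooth_partial unfolding F_def H_def
    by (metis continuous_on_eq_continuous_at open_UNIV UNIV_I)+
  then obtain d1 d2 where d: "d1 > 0" "d2 > 0" and F: "\<And>y. dist y x < d1 \<Longrightarrow> dist (F y) (F x) < e"
     and H: "\<And>y. dist y x < d2 \<Longrightarrow> dist (H y) (H x) < e"
    using e unfolding continuous_at_eps_delta by metis
  \<comment> \<open>The intermediate points are at distance less than \<open>2 * h\<close> from
    \<open>x\<close>, hence within both continuity radii.\<close>
  define h where "h = min d1 d2 / 4"
  have h: "h > 0" using d by (simp add: h_def)
  obtain s t where st: "0 < s" "s < h" "0 < t" "t < h" and 1: "f (x + h *\<^sub>R axis i 1 + h *\<^sub>R axis j 1) - f (x + h *\<^sub>R axis i 1) - f (x + h *\<^sub>R axis j 1) + f x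
    = h * h * H (x + s *\<^sub>R axis i 1 + t *\<^sub>R axis j 1)"
    using smooth_second_difference[OF assms h, of x i j] unfolding H_def by blast
  obtain s' t' where st': "0 < s'" "s' < h" "0 < t'" "t' < h" and 2: "f (x + h *\<^sub>R axis j 1 + h *\<^sub>R axis i 1) - f (x + h *\<^sub>R axis j 1) - f (x + h *\<^sub>R axis i 1) + f x
    = h * h * F (x + s' *\<^sub>R axis j 1 + t' *\<^sub>R axis i 1)"
    using smooth_second_difference[OF assms h, of x j i] unfolding F_def by blast
  have close: "dist (x + a *\<^sub>R axis k 1 + b *\<^sub>R axis l 1) x < min d1 d2" if "0 < a" "a < h" "0 < b" "b < h" for a b k l
  proof -
    have "dist (x + a *\<^sub>R axis k 1 + b *\<^sub>R axis l 1) x = norm (a *\<^sub>R axis k 1 + b *\<^sub>R axis l (1::real))"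
      by (simp add: dist_norm add.assoc)
    also have "\<dots> \<le> a + b"
      using that by (intro order.trans[OF norm_triangle_ineq]) simp
    also have "\<dots> < min d1 d2" using that d by (simp add: h_def)
    finally show ?thesis .
  qed
  have c: "x + h *\<^sub>R axis i 1 + h *\<^sub>R axis j 1 = x + h *\<^sub>R axis j 1 + h *\<^sub>R axis i 1"
    by (simp add: add_ac)
  have "h * h * H (x + s *\<^sub>R axis i 1 + t *\<^sub>R axis j 1) = h * h * F (x + s' *\<^sub>R axis j 1 + t' *\<^sub>R axis i 1)"
    using 1 2 unfolding c by linarith
  then have "H (x + s *\<^sub>R axis i 1 + t *\<^sub>R axis j 1) = F (x + s' *\<^sub>R axis j 1 + t' *\<^sub>R axis i 1)"
    using h by simp
  moreover have "dist (H (x + s *\<^sub>R axis i 1 + t *\<^sub>R axis j 1)) (H x) < e"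
    using close[OF st] by (intro H) auto
  moreover have "dist (F (x + s' *\<^sub>R axis j 1 + t' *\<^sub>R axis i 1)) (F x) < e"
    using close[OF st'] by (intro F) auto
  ultimately show False unfolding e_def dist_real_def by (simp add: abs_if split: if_splits)
qed

text \<open>Mean value inequality; the factor \<open>CARD('n)\<close> comes from bounding the
  operator norm of the derivative by the sum of its components.\<close>

lemma smooth_bound_on_convex:
  fixes f :: "real^'n::finite \<Rightarrow> real"
  assumes "smooth f" "convex S" "\<And>x j. x \<in> S \<Longrightarrow> \<bar>partial_deriv j f x\<bar> \<le> B" "x \<in> S" "y \<in> S"
  shows "\<bar>f x - f y\<bar> \<le> real CARD('n) * B * norm (x - y)"
proof -
  have "\<bar>\<Sum>j\<in>UNIV. h $ j * partial_deriv j f z\<bar> \<le> real CARD('n) * B * norm h" if "z \<in> S" for z h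
  proof -
    have "\<bar>\<Sum>j\<in>UNIV. h $ j * partial_deriv j f z\<bar> \<le> (\<Sum>j\<in>(UNIV::'n set). norm h * B)"
      using that assms(3) by (intro order.trans[OF sum_abs] sum_mono)
        (auto simp: abs_mult component_le_norm_cart intro!: mult_mono)
    then show ?thesis by (simp add: ac_simps)
  qed
  then have "norm (f x - f y) \<le> real CARD('n) * B * norm (x - y)"
    using assms by (intro differentiable_bound[of S f "\<lambda>x h. \<Sum>j\<in>UNIV. h $ j * partial_deriv j f x"])
     (auto intro!: onorm_le has_derivative_at_withinI[OF smooth_has_derivative])
  then show ?thesis by simp
qed

section \<open>Bounds for test functions, uniform in the point\<close>

lemma test_function_UNIV_iff:
  "test_function UNIV \<phi> \<longleftrightarrow> smooth \<phi> \<and> bounded {x. \<phi> x \<noteq> 0}"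
  unfolding test_function_def smooth_def by (auto simp: compact_closure)

lemma test_function_smooth: "test_function U \<phi> \<Longrightarrow> smooth \<phi>"
  by (simp add: test_function_def smooth_def)

lemma test_functionI:
  assumes "smooth \<phi>" "compact C" "C \<subseteq> U" "\<And>x. x \<notin> C \<Longrightarrow> \<phi> x = 0"
  shows "test_function U \<phi>"
proof -
  have "closure {x. \<phi> x \<noteq> 0} \<subseteq> C"
    using assms by (intro closure_minimal) (auto intro: compact_imp_closed)
  then show ?thesis
    using assms bounded_subset[of C] unfolding test_function_def smooth_def compact_eq_bounded_closed
    by auto
qed

lemma partial_deriv_eq_0:
  assumes "open S" "x \<in> S" "\<And>y. y \<in> S \<Longrightarrow> \<phi> y = c"
  shows "partial_deriv j \<phi> x = 0"
proof -
  have "(\<phi> has_derivative (\<lambda>h. 0)) (at x)"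
    by (rule has_derivative_transform_within_open[OF _ assms(1,2)])
       (use assms in auto)
  then show ?thesis by (simp add: partial_deriv_eq)
qed

lemma test_function_partial:
  assumes "test_function U \<phi>"
  shows "test_function U (partial_deriv j \<phi>)"
proof (rule test_functionI[of _ "closure {x. \<phi> x \<noteq> 0}"])
  show "smooth (partial_deriv j \<phi>)"
    using assms by (simp add: test_function_smooth smooth_partial)
  show "partial_deriv j \<phi> x = 0" if "x \<notin> closure {x. \<phi> x \<noteq> 0}" for x
    by (rule partial_deriv_eq_0[of "- closure {x. \<phi> x \<noteq> 0}" _ _ 0])
       (use that closure_subset[of "{x. \<phi> x \<noteq> 0}"] in auto)
qed (use assms in \<open>auto simp: test_function_def\<close>)

lemma test_function_add:
  "test_function UNIV \<phi> \<Longrightarrow> test_function UNIV \<psi> \<Longrightarrow> test_function UNIV (\<lambda>x. \<phi> x + \<psi> x)"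
  unfolding test_function_UNIV_iff
  by (auto intro!: smooth_add intro: bounded_subset[of "{x. \<phi> x \<noteq> 0} \<union> {x. \<psi> x \<noteq> 0}"])

lemma test_function_mult:
  "test_function U \<phi> \<Longrightarrow> smooth \<psi> \<Longrightarrow> test_function U (\<lambda>x. \<phi> x * \<psi> x)"
  by (rule test_functionI[of _ "closure {x. \<phi> x \<noteq> 0}"])
     (use closure_subset[of "{x. \<phi> x \<noteq> 0}"] in \<open>auto simp: test_function_def smooth_def intro: Ck_mult\<close>)

lemma test_function_bounded:
  assumes "test_function U \<phi>"
  shows "\<exists>M>0. \<forall>x. \<bar>\<phi> x\<bar> \<le> M"
proof -
  have "bounded (\<phi> ` closure {x. \<phi> x \<noteq> 0})"
    using assms test_function_smooth[OF assms]
    by (intro compact_imp_bounded compact_continuous_image smooth_continuous) (auto simp: test_function_def)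
  then obtain M where M: "M > 0" "\<And>x. x \<in> closure {x. \<phi> x \<noteq> 0} \<Longrightarrow> \<bar>\<phi> x\<bar> \<le> M"
    unfolding bounded_pos by auto
  have "\<bar>\<phi> x\<bar> \<le> M" for x
    using M closure_subset[of "{x. \<phi> x \<noteq> 0}"] by (cases "\<phi> x = 0") auto
  with M show ?thesis by blast
qed

lemma test_functions_uniformly_bounded:
  fixes \<phi> :: "'i::finite \<Rightarrow> real^'n::finite \<Rightarrow> real"
  assumes "\<And>j. test_function U (\<phi> j)"
  shows "\<exists>M>0. \<forall>j x. \<bar>\<phi> j x\<bar> \<le> M"
proof -
  obtain M where M: "\<And>j. M j > 0" "\<And>j x. \<bar>\<phi> j x\<bar> \<le> M j"
    using test_function_bounded[OF assms] by metis
  have "\<bar>\<phi> j x\<bar> \<le> (\<Sum>j\<in>UNIV. M j)" for j x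
    using M(2)[of j x] by (rule order.trans) (intro member_le_sum less_imp_le[OF M(1)], auto)
  moreover have "(\<Sum>j\<in>UNIV. M j) > 0" using M(1) by (intro sum_pos) auto
  ultimately show ?thesis by blast
qed

lemma test_function_lipschitz:
  fixes \<phi> :: "real^'n::finite \<Rightarrow> real"
  assumes "test_function U \<phi>"
  shows "\<exists>L>0. \<forall>x y. \<bar>\<phi> x - \<phi> y\<bar> \<le> L * norm (x - y)"
proof -
  obtain M where "M > 0" "\<forall>j x. \<bar>partial_deriv j \<phi> x\<bar> \<le> M"
    using test_functions_uniformly_bounded[of U "\<lambda>j. partial_deriv j \<phi>"] test_function_partial[OF assms]
    by blast
  then show ?thesis
    using smooth_bound_on_convex[OF test_function_smooth[OF assms] convex_UNIV]
    by (intro exI[of _ "real CARD('n) * M"]) auto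
qed

text \<open>Subtracting the linear part at \<open>x\<close> leaves a function whose partial
  derivatives are at most \<open>M * norm h\<close> on the ball of radius \<open>norm h\<close>.
  Uniformity in \<open>x\<close> later replaces dominated convergence when integrals are
  differentiated.\<close>

lemma test_function_second_order:
  fixes \<phi> :: "real^'n::finite \<Rightarrow> real"
  assumes "test_function U \<phi>"
  shows "\<exists>L>0. \<forall>x h. \<bar>\<phi> (x + h) - \<phi> x - (\<Sum>j\<in>UNIV. h $ j * partial_deriv j \<phi> x)\<bar> \<le> L * (norm h)\<^sup>2"
proof -
  have "\<exists>L>0. \<forall>x y. \<bar>partial_deriv j \<phi> x - partial_deriv j \<phi> y\<bar> \<le> L * norm (x - y)" for j
    by (rule test_function_lipschitz[OF test_function_partial[OF assms]])
  then obtain L where L: "\<And>j. L j > 0" "\<And>j x y. \<bar>partial_deriv j \<phi> x - partial_deriv j \<phi> y\<bar> \<le> L j * norm (x - y)"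
    by metis
  define M where "M = (\<Sum>j\<in>UNIV. L j)"
  have M: "M > 0" "L j \<le> M" for j
    using L(1) member_le_sum[of j UNIV L] less_imp_le unfolding M_def by (auto intro!: sum_pos)
  have "\<bar>\<phi> (x + h) - \<phi> x - (\<Sum>j\<in>UNIV. h $ j * partial_deriv j \<phi> x)\<bar> \<le> real CARD('n) * M * (norm h)\<^sup>2" for x h
  proof -
    define \<psi> where "\<psi> y = \<phi> y - (\<Sum>j\<in>UNIV. partial_deriv j \<phi> x * y $ j)" for y
    note s = test_function_smooth[OF assms]
    have "smooth \<psi>" unfolding \<psi>_def using s
      by (intro smooth_diff smooth_sum smooth_cmult smooth_coord) auto
    have d: "partial_deriv j \<psi> y = partial_deriv j \<phi> y - partial_deriv j \<phi> x" for j y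
    proof -
      have "partial_deriv j (\<lambda>y. \<Sum>i\<in>UNIV. partial_deriv i \<phi> x * y $ i) y = (\<Sum>i\<in>UNIV. partial_deriv i \<phi> x * (if i = j then 1 else 0))"
        by (subst partial_smooth_sum) (auto intro!: smooth_cmult sum.cong simp: partial_smooth_cmult partial_deriv_coord)
      then show ?thesis unfolding \<psi>_def using s
        by (subst partial_smooth_diff)
           (auto intro!: smooth_sum smooth_cmult simp: if_distrib[of "\<lambda>c. _ * c"] cong: if_cong)
    qed
    have "\<bar>\<psi> (x + h) - \<psi> x\<bar> \<le> real CARD('n) * (M * norm h) * norm (x + h - x)"
    proof (rule smooth_bound_on_convex[OF \<open>smooth \<psi>\<close>, of "cball x (norm h)"])
      fix y j assume "y \<in> cball x (norm h)"
      then have "norm (y - x) \<le> norm h" by (simp add: dist_norm norm_minus_commute)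
      then have "L j * norm (y - x) \<le> M * norm h"
        using M L(1)[of j] by (intro mult_mono) auto
      then show "\<bar>partial_deriv j \<psi> y\<bar> \<le> M * norm h"
        using L(2)[of j y x] unfolding d by linarith
    qed (auto simp: dist_norm)
    moreover have "\<psi> (x + h) - \<psi> x = \<phi> (x + h) - \<phi> x - (\<Sum>j\<in>UNIV. h $ j * partial_deriv j \<phi> x)"
      unfolding \<psi>_def by (simp add: algebra_simps sum.distrib)
    ultimately show ?thesis by (simp add: power2_eq_square mult.assoc)
  qed
  then show ?thesis using M by (intro exI[of _ "real CARD('n) * M"]) auto
qed

section \<open>A smooth bump function supported in a ball\<close>

definition flat_exp :: "nat \<Rightarrow> real \<Rightarrow> real" where
  "flat_exp k t = (if t > 0 then (1 / t) ^ k * exp (- (1 / t)) else 0)"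

lemma flat_exp_tendsto_0: "(flat_exp k \<longlongrightarrow> 0) (at 0)"
proof -
  have "((\<lambda>s::real. s ^ k / exp s) \<longlongrightarrow> 0) at_top"
    by (rule tendsto_power_div_exp_0)
  then have "((\<lambda>t::real. (inverse t) ^ k / exp (inverse t)) \<longlongrightarrow> 0) (at_right 0)"
    by (rule filterlim_compose[OF _ filterlim_inverse_at_top_right])
  then have "(flat_exp k \<longlongrightarrow> 0) (at_right 0)"
  proof (rule Lim_transform_eventually)
    show "\<forall>\<^sub>F t in at_right 0. inverse t ^ k / exp (inverse t) = flat_exp k t"
      unfolding eventually_at_right_field
      by (intro exI[of _ 1]) (auto simp: flat_exp_def exp_minus field_simps)
  qed
  moreover have "(flat_exp k \<longlongrightarrow> 0) (at_left 0)"
    by (rule tendsto_eventually, unfold eventually_at_left_field, intro exI[of _ "-1"]) (auto simp: flat_exp_def)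
  ultimately show ?thesis by (simp add: filterlim_split_at_real)
qed

text \<open>The powers of \<open>1 / t\<close> are carried along because they make the family closed
  under differentiation. At 0 the difference quotient of \<open>flat_exp k\<close> is
  \<open>flat_exp (Suc k)\<close>, which tends to 0 because the exponential beats every
  power.\<close>

lemma flat_exp_DERIV:
  "(flat_exp k has_real_derivative (flat_exp (k + 2) t - real k * flat_exp (k + 1) t)) (at t)"
proof -
  consider "t > 0" | "t < 0" | "t = 0" by linarith
  then show ?thesis
  proof cases
    case 1
    have "((\<lambda>t. (1 / t) ^ k * exp (- (1 / t))) has_real_derivative (flat_exp (k + 2) t - real k * flat_exp (k + 1) t)) (at t)"
    proof (cases k)
      case (Suc m)
      \<comment> \<open>The power rule leaves an exponent with truncated subtraction; this identity
        removes it.\<close>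
      have "m = 0 \<or> t ^ m = t * t ^ (m - Suc 0)"
        by (cases m) auto
      with 1 Suc show ?thesis
        by (auto intro!: derivative_eq_intros simp: flat_exp_def field_simps power2_eq_square)
    qed (use 1 in \<open>auto intro!: derivative_eq_intros simp: flat_exp_def field_simps power2_eq_square\<close>)
    then show ?thesis
      by (rule has_field_derivative_transform_within_open[of _ _ _ "{0<..}"])
         (use 1 in \<open>auto simp: flat_exp_def\<close>)
  next
    case 2
    have "((\<lambda>t. 0) has_real_derivative 0) (at t)" by simp
    then have "(flat_exp k has_real_derivative 0) (at t)"
      by (rule has_field_derivative_transform_within_open[of _ _ _ "{..<0}"])
         (use 2 in \<open>auto simp: flat_exp_def\<close>)
    then show ?thesis using 2 by (simp add: flat_exp_def)
  next
    case 3
    have "(flat_exp (Suc k) \<longlongrightarrow> 0) (at 0)" by (rule flat_exp_tendsto_0)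
    then have "((\<lambda>h. (flat_exp k (0 + h) - flat_exp k 0) / h) \<longlongrightarrow> 0) (at 0)"
      by (rule Lim_transform_eventually)
         (auto simp: flat_exp_def eventually_at_filter)
    then show ?thesis unfolding 3 has_field_derivative_def[symmetric] DERIV_def by (simp add: flat_exp_def)
  qed
qed

text \<open>A partial derivative is a coordinate times a combination of members of the same family,
  so the induction runs over all \<open>k\<close> simultaneously.\<close>

lemma Ck_flat_exp: "Ck m (\<lambda>x::real^'n::finite. flat_exp k (1 - x \<bullet> x))"
proof (induction m arbitrary: k)
  have D: "((\<lambda>x::real^'n. flat_exp k (1 - x \<bullet> x)) has_derivative
    (\<lambda>h. - 2 * (x \<bullet> h) * (flat_exp (k + 2) (1 - x \<bullet> x) - real k * flat_exp (k + 1) (1 - x \<bullet> x)))) (at x)" for k x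
  proof -
    have "((\<lambda>x::real^'n. 1 - x \<bullet> x) has_derivative (\<lambda>h. - 2 * (x \<bullet> h))) (at x)"
      by (auto intro!: derivative_eq_intros simp: inner_commute)
    from has_derivative_compose[OF this flat_exp_DERIV[unfolded has_field_derivative_def]]
    show ?thesis by (simp add: mult_ac)
  qed
  note diff = D[THEN differentiableI]
  {
    case 0
    show ?case using diff
      by (auto intro!: continuous_at_imp_continuous_on differentiable_imp_continuous_within)
  next
    case (Suc m)
    have "partial_deriv j (\<lambda>x::real^'n. flat_exp k (1 - x \<bullet> x)) =
      (\<lambda>x. (- 2 * x $ j) * (flat_exp (k + 2) (1 - x \<bullet> x) + (- real k) * flat_exp (k + 1) (1 - x \<bullet> x)))" for j
      by (rule ext, subst partial_deriv_eq[OF D]) (simp add: inner_axis)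
    moreover have "Ck m (\<lambda>x. (- 2 * x $ j) * (flat_exp (k + 2) (1 - x \<bullet> x) + (- real k) * flat_exp (k + 1) (1 - x \<bullet> x)))" for j :: 'n
      by (intro Ck_mult Ck_add Ck_coord Ck_const Suc.IH)
    ultimately show ?case using diff by (simp only: Ck.simps) blast
  }
qed

lemma test_function_bump:
  assumes "r > 0"
  shows "\<exists>b::real^'n::finite \<Rightarrow> real. test_function UNIV b \<and> (\<forall>x. b x \<ge> 0) \<and> (\<forall>x. norm x < r \<longleftrightarrow> b x > 0)"
proof -
  define b where "b x = flat_exp 0 (1 - ((1 / r) *\<^sub>R x) \<bullet> ((1 / r) *\<^sub>R x))" for x :: "real^'n"
  have "smooth b"
    using smooth_affine[of "\<lambda>x::real^'n. flat_exp 0 (1 - x \<bullet> x)" 0 "1 / r"]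
    unfolding b_def by (simp add: smooth_def Ck_flat_exp del: inner_scaleR_left inner_scaleR_right)
  have pos: "b x > 0 \<longleftrightarrow> norm x < r" for x
  proof -
    have "b x > 0 \<longleftrightarrow> (x \<bullet> x) / r\<^sup>2 < 1"
      by (simp add: b_def flat_exp_def power2_eq_square)
    also have "\<dots> \<longleftrightarrow> (norm x)\<^sup>2 < r\<^sup>2"
      using assms by (simp add: power2_norm_eq_inner)
    also have "\<dots> \<longleftrightarrow> norm x < r"
      using assms by (meson norm_ge_zero power2_less_imp_less power_strict_mono less_imp_le pos2)
    finally show ?thesis .
  qed
  have nn: "b x \<ge> 0" for x by (simp add: b_def flat_exp_def)
  have "{x. b x \<noteq> 0} \<subseteq> ball 0 r" using pos nn by (force simp: less_le)
  then have "test_function UNIV b"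
    using \<open>smooth b\<close> bounded_ball bounded_subset unfolding test_function_UNIV_iff by blast
  then show ?thesis using pos nn by blast
qed

subsection \<open>Integration of test functions and convolution\<close>

lemma lborel_integral_affine:
  fixes f :: "'a::euclidean_space \<Rightarrow> real"
  assumes [measurable]: "f \<in> borel_measurable borel" and c: "c \<noteq> 0"
  shows "integral\<^sup>L lborel f = \<bar>c\<bar> ^ DIM('a) * (LINT x|lborel. f (t + c *\<^sub>R x))"
  by (subst lborel_affine[OF c, of t]) (simp add: integral_density integral_distr)

lemma lborel_integrable_affine:
  fixes f :: "'a::euclidean_space \<Rightarrow> real"
  assumes f: "integrable lborel f" and c: "c \<noteq> 0"
  shows "integrable lborel (\<lambda>x. f (t + c *\<^sub>R x))"
proof -
  have [measurable]: "f \<in> borel_measurable borel" using f by auto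
  have "integrable (density (distr lborel borel (\<lambda>x. t + c *\<^sub>R x)) (\<lambda>_. ennreal (\<bar>c\<bar> ^ DIM('a)))) f"
    using f lborel_affine[OF c, of t] by simp
  then show ?thesis
    using c by (simp add: integrable_density integrable_distr_eq)
qed

lemma integrable_compact_support:
  fixes f :: "'a::euclidean_space \<Rightarrow> real"
  assumes "continuous_on UNIV f" "compact C" "\<And>x. x \<notin> C \<Longrightarrow> f x = 0"
  shows "integrable lborel f"
proof -
  have "integrable lborel (\<lambda>x. indicator C x *\<^sub>R f x)"
    using assms by (intro borel_integrable_compact) (auto intro: continuous_on_subset)
  also have "(\<lambda>x. indicator C x *\<^sub>R f x) = f"
    using assms(3) by (force simp: indicator_def)
  finally show ?thesis .
qed

lemma integrable_test_function: "test_function U \<phi> \<Longrightarrow> integrable lborel \<phi>"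
  using closure_subset[of "{x. \<phi> x \<noteq> 0}"]
  by (intro integrable_compact_support[of _ "closure {x. \<phi> x \<noteq> 0}"])
     (auto simp: test_function_smooth smooth_continuous, auto simp: test_function_def)

lemma integrable_mult_test_function:
  assumes w: "integrable lborel w" and \<phi>: "test_function U \<phi>"
  shows "integrable lborel (\<lambda>z. w z * \<phi> z)"
proof -
  obtain M where M: "\<And>x. \<bar>\<phi> x\<bar> \<le> M" using test_function_bounded[OF \<phi>] by blast
  have [measurable]: "w \<in> borel_measurable lborel" "\<phi> \<in> borel_measurable borel"
    using w smooth_continuous[OF test_function_smooth[OF \<phi>]]
    by (auto intro: borel_measurable_continuous_onI)
  have "integrable lborel (\<lambda>z. M * w z)" using w by simp
  then show ?thesis
  proof (rule Bochner_Integration.integrable_bound)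
    show "AE x in lborel. norm (w x * \<phi> x) \<le> norm (M * w x)"
      using M[THEN order.trans[OF _ abs_ge_self]]
      by (intro AE_I2) (simp add: abs_mult mult.commute[of "\<bar>w _\<bar>"] mult_right_mono)
  qed measurable
qed

text \<open>Translation invariance makes the integral of \<open>\<phi> (x + t e) - \<phi> x\<close>
  vanish. Hence \<open>t * I\<close> is minus the integral of the Taylor remainder, which is of
  order \<open>t\<^sup>2\<close> on a fixed ball; dividing by \<open>t\<close> and taking
  \<open>t\<close> small forces \<open>I = 0\<close>.\<close>

lemma integral_partial_deriv_eq_0:
  assumes \<phi>: "test_function UNIV \<phi>"
  shows "(LINT x|lborel. partial_deriv j \<phi> x) = 0"
proof -
  define I where "I = (LINT x|lborel. partial_deriv j \<phi> x)"
  obtain L where L: "L > 0" "\<And>x h. \<bar>\<phi> (x + h) - \<phi> x - (\<Sum>j\<in>UNIV. h $ j * partial_deriv j \<phi> x)\<bar> \<le> L * (norm h)\<^sup>2"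
    using test_function_second_order[OF \<phi>] by blast
  obtain R where R: "R > 0" "\<And>x. \<phi> x \<noteq> 0 \<Longrightarrow> norm x \<le> R"
    using \<phi> unfolding test_function_UNIV_iff bounded_pos by auto
  \<comment> \<open>Radius \<open>R + 1\<close> because the support is translated by
    \<open>t \<le> 1\<close>.\<close>
  define C where "C = cball (0::real^'a) (R + 1)"
  have [measurable]: "\<phi> \<in> borel_measurable borel"
    by (intro borel_measurable_continuous_onI smooth_continuous test_function_smooth[OF \<phi>])
  have intC: "integrable lborel (indicator C :: real^'a \<Rightarrow> real)"
    unfolding C_def by (rule integrable_real_indicator) (use emeasure_lborel_cball_finite in auto)
  have bound: "\<bar>I\<bar> \<le> t * (L * measure lborel C)" if t: "0 < t" "t \<le> 1" for t
  proof -
    let ?e = "axis j 1 :: real^'a"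
    define r where "r x = \<phi> (t *\<^sub>R ?e + 1 *\<^sub>R x) - \<phi> x - t * partial_deriv j \<phi> x" for x
    have shift: "integrable lborel (\<lambda>x. \<phi> (t *\<^sub>R ?e + 1 *\<^sub>R x))"
      by (rule lborel_integrable_affine[OF integrable_test_function[OF \<phi>]]) simp
    have int: "integrable lborel \<phi>" "integrable lborel (partial_deriv j \<phi>)"
      using \<phi> by (auto intro: integrable_test_function test_function_partial)
    have "(LINT x|lborel. r x) = - t * I"
      using lborel_integral_affine[of \<phi> 1 "t *\<^sub>R ?e"] shift int unfolding r_def I_def by simp
    moreover have "\<bar>LINT x|lborel. r x\<bar> \<le> (LINT x|lborel. L * t\<^sup>2 * indicator C x)"
    proof (rule integral_abs_bound_integral)
      show "integrable lborel r" unfolding r_def using shift int by simp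
      show "integrable lborel (\<lambda>x. L * t\<^sup>2 * indicator C x)" using intC by simp
      fix x
      have s: "(\<Sum>i\<in>UNIV. (t *\<^sub>R ?e) $ i * partial_deriv i \<phi> x) = t * partial_deriv j \<phi> x"
        by (simp add: axis_def if_distrib[of "\<lambda>c. c * _"] if_distrib[of "\<lambda>c. _ * c"] cong: if_cong)
      show "\<bar>r x\<bar> \<le> L * t\<^sup>2 * indicator C x"
      proof (cases "x \<in> C")
        case True
        then show ?thesis
          using L(2)[of x "t *\<^sub>R ?e"] t unfolding s r_def by (simp add: add.commute)
      next
        case False
        then have x: "norm x > R + 1" by (simp add: C_def)
        have "norm x \<le> norm (t *\<^sub>R ?e + x) + norm (t *\<^sub>R ?e)"
          by (metis add_diff_cancel_left' norm_triangle_ineq4)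
        then have "norm (t *\<^sub>R ?e + x) > R" using x t by simp
        then have "\<phi> (t *\<^sub>R ?e + x) = 0" "\<phi> x = 0" using R(2) x by force+
        moreover have "partial_deriv j \<phi> x = 0"
          by (rule partial_deriv_eq_0[of "- cball 0 R" _ _ 0]) (use x R(2) in auto)
        ultimately show ?thesis using L(1) by (simp add: r_def)
      qed
    qed
    moreover have "(LINT x|lborel. L * t\<^sup>2 * indicator C x) = L * t\<^sup>2 * measure lborel C"
      using intC by simp
    ultimately have "t * \<bar>I\<bar> \<le> t * (t * (L * measure lborel C))"
      using t by (simp add: abs_mult power2_eq_square mult_ac)
    then show ?thesis using t by simp
  qed
  have "I = 0"
  proof (rule ccontr)
    assume "I \<noteq> 0"
    \<comment> \<open>Small enough that the bound \<open>t * (L * measure lborel C)\<close> is at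
      most half of \<open>\<bar>I\<bar>\<close>; the \<open>+ 1\<close> keeps the denominator
      positive.\<close>
    define t where "t = min 1 (\<bar>I\<bar> / (2 * (L * measure lborel C + 1)))"
    have m: "0 \<le> L * measure lborel C" using L by simp
    have t: "0 < t" "t \<le> 1" unfolding t_def using \<open>I \<noteq> 0\<close> m by (auto intro!: divide_pos_pos)
    have "t * (2 * (L * measure lborel C + 1)) \<le> \<bar>I\<bar>"
      using m by (subst pos_le_divide_eq[symmetric]) (auto simp: t_def)
    moreover have "0 \<le> t * (L * measure lborel C)" using t m by simp
    ultimately show False using bound[OF t] t by (simp add: algebra_simps)
  qed
  then show ?thesis by (simp add: I_def)
qed

lemma integral_by_parts:
  assumes \<phi>: "test_function UNIV \<phi>" and f: "smooth f"
  shows "(LINT x|lborel. f x * partial_deriv j \<phi> x) = - (LINT x|lborel. partial_deriv j f x * \<phi> x)"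
proof -
  note s = test_function_smooth[OF \<phi>]
  have 1: "integrable lborel (\<lambda>x. f x * partial_deriv j \<phi> x)"
    using integrable_test_function[OF test_function_mult[OF test_function_partial[OF \<phi>] f]]
    by (simp add: mult.commute)
  have 2: "integrable lborel (\<lambda>x. partial_deriv j f x * \<phi> x)"
    using integrable_test_function[OF test_function_mult[OF \<phi> smooth_partial[OF f]]]
    by (simp add: mult.commute)
  have "0 = (LINT x|lborel. partial_deriv j (\<lambda>x. \<phi> x * f x) x)"
    using integral_partial_deriv_eq_0[OF test_function_mult[OF \<phi> f]] by simp
  also have "\<dots> = (LINT x|lborel. f x * partial_deriv j \<phi> x + partial_deriv j f x * \<phi> x)"
    using s f by (intro Bochner_Integration.integral_cong) (auto simp: partial_smooth_mult)
  finally show ?thesis using 1 2 by simp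
qed

abbreviation sym_grad :: "('n::finite \<Rightarrow> real^'n \<Rightarrow> real) \<Rightarrow> 'n \<Rightarrow> 'n \<Rightarrow> real^'n \<Rightarrow> real" where
  "sym_grad u i j x \<equiv> (partial_deriv j (u i) x + partial_deriv i (u j) x) / 2"

text \<open>Pointwise, twice the squared symmetric part is the squared gradient plus the sum of the
  products \<open>a i j * a j i\<close>. Two integrations by parts and the symmetry of second
  derivatives turn the integral of that sum into the integral of the squared divergence, which is
  nonnegative.\<close>

lemma korn_first_inequality:
  fixes v :: "'n::finite \<Rightarrow> real^'n \<Rightarrow> real"
  assumes v: "\<And>i. test_function UNIV (v i)"
  shows "(LINT x|lborel. (\<Sum>i\<in>UNIV. \<Sum>j\<in>UNIV. (partial_deriv j (v i) x)\<^sup>2)) \<le>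
    2 * (LINT x|lborel. (\<Sum>i\<in>UNIV. \<Sum>j\<in>UNIV. (sym_grad v i j x)\<^sup>2))"
proof -
  define a where "a i j x = partial_deriv j (v i) x" for i j x
  note s = test_function_smooth[OF v]
  have ta: "test_function UNIV (a i j)" for i j
    unfolding a_def by (intro test_function_partial v)
  have taa: "integrable lborel (\<lambda>x. a i j x * a k l x)" for i j k l
    by (rule integrable_test_function[OF test_function_mult[OF ta test_function_smooth[OF ta]]])
  have swap: "(LINT x|lborel. a i j x * a j i x) = (LINT x|lborel. a i i x * a j j x)" for i j
  proof -
    have "(LINT x|lborel. a i j x * a j i x) = - (LINT x|lborel. partial_deriv j (a j i) x * v i x)"
      using integral_by_parts[OF v test_function_smooth[OF ta], of j i j i]
      by (simp add: a_def[symmetric] mult.commute)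
    also have "\<dots> = - (LINT x|lborel. partial_deriv i (a j j) x * v i x)"
      using smooth_partial_commute[OF s, of j i j] unfolding a_def by simp
    also have "\<dots> = (LINT x|lborel. a i i x * a j j x)"
      using integral_by_parts[OF v test_function_smooth[OF ta], of j j i i]
      by (simp add: a_def[symmetric] mult.commute)
    finally show ?thesis .
  qed
  have pw: "2 * (\<Sum>i\<in>UNIV. \<Sum>j\<in>UNIV. ((a i j x + a j i x) / 2)\<^sup>2) =
    (\<Sum>i\<in>UNIV. \<Sum>j\<in>UNIV. (a i j x)\<^sup>2) + (\<Sum>i\<in>UNIV. \<Sum>j\<in>UNIV. a i j x * a j i x)" for x
  proof -
    have "2 * ((a i j x + a j i x) / 2)\<^sup>2 = (a i j x)\<^sup>2 / 2 + (a j i x)\<^sup>2 / 2 + a i j x * a j i x" for i j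
      by (simp add: power2_eq_square field_simps)
    then have "2 * (\<Sum>i\<in>UNIV. \<Sum>j\<in>UNIV. ((a i j x + a j i x) / 2)\<^sup>2) =
      (\<Sum>i\<in>UNIV. \<Sum>j\<in>UNIV. (a i j x)\<^sup>2 / 2) + (\<Sum>i\<in>UNIV. \<Sum>j\<in>UNIV. (a j i x)\<^sup>2 / 2) + (\<Sum>i\<in>UNIV. \<Sum>j\<in>UNIV. a i j x * a j i x)"
      by (simp only: sum_distrib_left sum.distrib)
    also have "(\<Sum>i\<in>UNIV. \<Sum>j\<in>UNIV. (a j i x)\<^sup>2 / 2) = (\<Sum>i\<in>UNIV. \<Sum>j\<in>UNIV. (a i j x)\<^sup>2 / 2)"
      by (rule sum.swap)
    finally show ?thesis by (simp add: sum_divide_distrib[symmetric])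
  qed
  have "(LINT x|lborel. (\<Sum>i\<in>UNIV. \<Sum>j\<in>UNIV. a i j x * a j i x)) = (LINT x|lborel. (\<Sum>i\<in>UNIV. \<Sum>j\<in>UNIV. a i i x * a j j x))"
    using taa by (simp add: Bochner_Integration.integral_sum swap)
  also have "\<dots> = (LINT x|lborel. (\<Sum>i\<in>UNIV. a i i x)\<^sup>2)"
    by (simp add: power2_eq_square sum_product)
  also have "\<dots> \<ge> 0" by simp
  finally have nn: "0 \<le> (LINT x|lborel. (\<Sum>i\<in>UNIV. \<Sum>j\<in>UNIV. a i j x * a j i x))" .
  have "2 * (LINT x|lborel. (\<Sum>i\<in>UNIV. \<Sum>j\<in>UNIV. ((a i j x + a j i x) / 2)\<^sup>2)) =
    (LINT x|lborel. (\<Sum>i\<in>UNIV. \<Sum>j\<in>UNIV. (a i j x)\<^sup>2) + (\<Sum>i\<in>UNIV. \<Sum>j\<in>UNIV. a i j x * a j i x))"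
    unfolding pw[symmetric] by simp
  also have "\<dots> = (LINT x|lborel. (\<Sum>i\<in>UNIV. \<Sum>j\<in>UNIV. (a i j x)\<^sup>2)) + (LINT x|lborel. (\<Sum>i\<in>UNIV. \<Sum>j\<in>UNIV. a i j x * a j i x))"
    using taa by (intro Bochner_Integration.integral_add Bochner_Integration.integrable_sum) (auto simp: power2_eq_square)
  finally show ?thesis using nn unfolding a_def by linarith
qed

section \<open>Convolution with a test function\<close>

definition convolve :: "(real^'n::finite \<Rightarrow> real) \<Rightarrow> (real^'n \<Rightarrow> real) \<Rightarrow> real^'n \<Rightarrow> real" where
  "convolve w \<phi> x = (LINT z|lborel. w z * \<phi> (x - z))"

lemma test_function_reflect:
  assumes "test_function UNIV \<phi>"
  shows "test_function UNIV (\<lambda>z. \<phi> (x - z))"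
proof -
  obtain R where R: "\<And>y. \<phi> y \<noteq> 0 \<Longrightarrow> norm y \<le> R"
    using assms unfolding test_function_UNIV_iff bounded_iff by auto
  have "bounded {z. \<phi> (x - z) \<noteq> 0}"
    unfolding bounded_def by (rule exI[of _ x], rule exI[of _ R]) (auto simp: dist_norm R)
  then show ?thesis
    using assms unfolding test_function_UNIV_iff by (auto intro: smooth_reflect)
qed

lemma integrable_convolve:
  "integrable lborel w \<Longrightarrow> test_function UNIV \<phi> \<Longrightarrow> integrable lborel (\<lambda>z. w z * \<phi> (x - z))"
  by (rule integrable_mult_test_function[OF _ test_function_reflect])

text \<open>The second order bound for \<open>\<phi>\<close> is uniform, so integrating it against
  \<open>w\<close> bounds the remainder by \<open>L * (norm (y - x))\<^sup>2\<close> times the L1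
  norm of \<open>w\<close>. All derivatives fall on \<open>\<phi>\<close>, so \<open>w\<close> only
  has to be integrable.\<close>

lemma convolve_has_derivative:
  assumes w: "integrable lborel w" and \<phi>: "test_function UNIV \<phi>"
  shows "(convolve w \<phi> has_derivative (\<lambda>h. \<Sum>j\<in>UNIV. h $ j * convolve w (partial_deriv j \<phi>) x)) (at x)"
proof -
  obtain L where L: "L > 0" "\<And>x h. \<bar>\<phi> (x + h) - \<phi> x - (\<Sum>j\<in>UNIV. h $ j * partial_deriv j \<phi> x)\<bar> \<le> L * (norm h)\<^sup>2"
    using test_function_second_order[OF \<phi>] by blast
  define N where "N = (LINT z|lborel. \<bar>w z\<bar>)"
  have rem: "\<bar>convolve w \<phi> y - convolve w \<phi> x - (\<Sum>j\<in>UNIV. (y - x) $ j * convolve w (partial_deriv j \<phi>) x)\<bar>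
      \<le> L * (norm (y - x))\<^sup>2 * N" for y
  proof -
    define r where "r z = \<phi> ((x - z) + (y - x)) - \<phi> (x - z) - (\<Sum>j\<in>UNIV. (y - x) $ j * partial_deriv j \<phi> (x - z))" for z
    have ir: "w z * r z = w z * \<phi> (y - z) - w z * \<phi> (x - z) - (\<Sum>j\<in>UNIV. (y - x) $ j * (w z * partial_deriv j \<phi> (x - z)))" for z
      unfolding r_def by (simp add: algebra_simps sum_distrib_left)
    note ints = integrable_convolve[OF w \<phi>] integrable_convolve[OF w test_function_partial[OF \<phi>]]
    have "convolve w \<phi> y - convolve w \<phi> x - (\<Sum>j\<in>UNIV. (y - x) $ j * convolve w (partial_deriv j \<phi>) x) = (LINT z|lborel. w z * r z)"
      unfolding convolve_def ir using ints by (simp del: vector_minus_component)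
    also have "\<bar>\<dots>\<bar> \<le> (LINT z|lborel. \<bar>w z\<bar> * (L * (norm (y - x))\<^sup>2))"
    proof (rule integral_abs_bound_integral)
      show "integrable lborel (\<lambda>z. w z * r z)" unfolding ir using ints by (simp del: vector_minus_component)
      show "integrable lborel (\<lambda>z. \<bar>w z\<bar> * (L * (norm (y - x))\<^sup>2))" using w by simp
      show "\<bar>w z * r z\<bar> \<le> \<bar>w z\<bar> * (L * (norm (y - x))\<^sup>2)" for z
        unfolding abs_mult r_def by (intro mult_left_mono L) auto
    qed
    also have "\<dots> = L * (norm (y - x))\<^sup>2 * N" using w by (simp add: N_def)
    finally show ?thesis .
  qed
  show ?thesis
  proof (rule has_derivativeI_sandwich[of 1])
    show "bounded_linear (\<lambda>h::real^'a. \<Sum>j\<in>UNIV. h $ j * convolve w (partial_deriv j \<phi>) x)"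
      by (intro bounded_linear_sum bounded_linear_mult_left bounded_linear_compose[OF bounded_linear_mult_left] bounded_linear_vec_nth)
    show "((\<lambda>y. L * norm (y - x) * N) \<longlongrightarrow> 0) (at x)"
      by (auto intro!: tendsto_eq_intros)
    fix y assume "y \<noteq> x"
    then have "norm (y - x) > 0" by simp
    then show "norm (convolve w \<phi> y - convolve w \<phi> x - (\<Sum>j\<in>UNIV. (y - x) $ j * convolve w (partial_deriv j \<phi>) x)) / norm (y - x) \<le> L * norm (y - x) * N"
      using rem[of y] by (simp add: field_simps power2_eq_square)
  qed simp
qed

lemma partial_deriv_convolve:
  assumes "integrable lborel w" "test_function UNIV \<phi>"
  shows "partial_deriv j (convolve w \<phi>) x = convolve w (partial_deriv j \<phi>) x"
  by (subst partial_deriv_eq[OF convolve_has_derivative[OF assms]])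
     (simp add: axis_def if_distrib[of "\<lambda>c. c * _"] cong: if_cong)

lemma smooth_convolve:
  assumes w: "integrable lborel w" and "test_function UNIV \<phi>"
  shows "smooth (convolve w \<phi>)"
proof -
  have "Ck k (convolve w \<phi>)" for k
    using assms(2)
  proof (induction k arbitrary: \<phi>)
    case 0
    then show ?case
      using convolve_has_derivative[OF w] by (auto intro!: continuous_at_imp_continuous_on has_derivative_continuous)
  next
    case (Suc k)
    have "partial_deriv j (convolve w \<phi>) = convolve w (partial_deriv j \<phi>)" for j
      using partial_deriv_convolve[OF w Suc.prems] by blast
    then show ?case
      using Suc.IH[OF test_function_partial[OF Suc.prems]] convolve_has_derivative[OF w Suc.prems]
      by (auto intro: differentiableI)
  qed
  then show ?thesis by (simp add: smooth_def)
qed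

lemma mollifier_exists:
  assumes "r > 0"
  shows "\<exists>\<eta>::real^'n::finite \<Rightarrow> real. test_function UNIV \<eta> \<and> (\<forall>x. \<eta> x \<ge> 0) \<and> (\<forall>x. norm x \<ge> r \<longrightarrow> \<eta> x = 0) \<and>
    (LINT x|lborel. \<eta> x) = 1"
proof -
  obtain b :: "real^'n \<Rightarrow> real" where b: "test_function UNIV b" "\<And>x. b x \<ge> 0" "\<And>x. norm x < r \<longleftrightarrow> b x > 0"
    using test_function_bump[OF assms] by blast
  define I where "I = (LINT x|lborel. b x)"
  note int = integrable_test_function[OF b(1)]
  \<comment> \<open>Otherwise the nonnegative function \<open>b\<close> would vanish almost
    everywhere, although it is positive on a ball of positive measure.\<close>
  have "I > 0"
  proof (rule ccontr)
    assume "\<not> I > 0"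
    moreover have "I \<ge> 0" unfolding I_def using b(2) by simp
    ultimately have "AE x in lborel. b x = 0"
      using integral_nonneg_eq_0_iff_AE[OF int] b(2) unfolding I_def by auto
    then have "AE x in lborel. x \<notin> (ball 0 r :: (real^'n) set)"
      by (rule AE_mp) (use b(3) in \<open>force intro!: AE_I2\<close>)
    then have "emeasure lborel (ball 0 r :: (real^'n) set) = 0"
      by (subst (asm) AE_iff_null_sets[symmetric]) (auto dest: null_setsD1)
    then show False using assms content_ball_pos[OF assms, of "0 :: real^'n"]
      by (simp add: measure_def)
  qed
  define \<eta> where "\<eta> x = b x * (1 / I)" for x
  have "test_function UNIV \<eta>" unfolding \<eta>_def by (intro test_function_mult b smooth_const)
  moreover have "\<eta> x \<ge> 0" for x using b(2) \<open>I > 0\<close> by (simp add: \<eta>_def)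
  moreover have "\<eta> x = 0" if "norm x \<ge> r" for x
    using b(2)[of x] b(3)[of x] that by (simp add: \<eta>_def)
  moreover have "(LINT x|lborel. \<eta> x) = 1" using \<open>I > 0\<close> by (simp add: \<eta>_def I_def)
  ultimately show ?thesis by blast
qed

subsection \<open>Averages over cubes and their mean square oscillation\<close>

definition unit_cube :: "(real^'n::finite) set" where
  "unit_cube = cbox 0 1"

text \<open>The unit cube has measure 1, so this integral is already an average. The cube is closed,
  hence compact, which makes every continuous function integrable on it.\<close>

definition uavg :: "(real^'n::finite \<Rightarrow> real) \<Rightarrow> real" where
  "uavg f = (LINT x|lborel. indicator unit_cube x * f x)"

lemma mem_unit_cube: "x \<in> unit_cube \<longleftrightarrow> (\<forall>i. 0 \<le> x $ i \<and> x $ i \<le> 1)"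
  by (simp add: unit_cube_def mem_box_cart)

lemma dist_unit_cube_le:
  assumes "x \<in> unit_cube" "y \<in> (unit_cube :: (real^'n::finite) set)"
  shows "norm (x - y) \<le> real CARD('n)"
proof -
  have "norm (x - y) \<le> (\<Sum>i\<in>UNIV. \<bar>(x - y) $ i\<bar>)" by (rule norm_le_l1_cart)
  also have "\<dots> \<le> (\<Sum>i\<in>(UNIV::'n set). 1)"
    using assms unfolding mem_unit_cube by (intro sum_mono) (simp add: abs_le_iff; smt (verit))
  finally show ?thesis by simp
qed

lemma compact_unit_cube [simp]: "compact unit_cube"
  and convex_unit_cube [simp]: "convex unit_cube"
  by (auto simp: unit_cube_def)

lemma measurable_unit_cube [measurable]: "unit_cube \<in> sets borel"
  by (simp add: unit_cube_def)

lemma emeasure_unit_cube [simp]: "emeasure lborel (unit_cube :: (real^'n::finite) set) = 1"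
proof -
  have "(0::real^'n) \<le> 1" by (simp add: less_eq_vec_def)
  then have "measure lborel (cbox (0::real^'n) 1) = 1"
    by (subst content_cbox_cart) (auto simp: interval_ne_empty_cart)
  then show ?thesis
    unfolding unit_cube_def
    by (subst emeasure_eq_ennreal_measure) (use emeasure_lborel_cbox_finite[of "0::real^'n" 1] in auto)
qed

lemma uavg_integrable:
  fixes f :: "real^'n::finite \<Rightarrow> real"
  assumes "continuous_on unit_cube f"
  shows "integrable lborel (\<lambda>x. indicator unit_cube x * f x)"
  using borel_integrable_compact[OF compact_unit_cube assms] by simp

lemma uavg_const [simp]: "uavg (\<lambda>x::real^'n::finite. c) = c"
  by (simp add: uavg_def measure_def)

lemma uavg_cong: "(\<And>x. x \<in> unit_cube \<Longrightarrow> f x = g x) \<Longrightarrow> uavg f = uavg g"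
  unfolding uavg_def by (intro Bochner_Integration.integral_cong) (auto simp: indicator_def)

lemma uavg_add:
  "continuous_on unit_cube f \<Longrightarrow> continuous_on unit_cube g \<Longrightarrow> uavg (\<lambda>x. f x + g x) = uavg f + uavg g"
  unfolding uavg_def using uavg_integrable[of f] uavg_integrable[of g] by (simp add: distrib_left)

lemma uavg_diff:
  "continuous_on unit_cube f \<Longrightarrow> continuous_on unit_cube g \<Longrightarrow> uavg (\<lambda>x. f x - g x) = uavg f - uavg g"
  unfolding uavg_def using uavg_integrable[of f] uavg_integrable[of g] by (simp add: right_diff_distrib)

lemma uavg_cmult: "uavg (\<lambda>x. c * f x) = c * uavg f"
  unfolding uavg_def by (simp add: mult.left_commute[of _ c])

lemma uavg_sum:
  "(\<And>i. i \<in> S \<Longrightarrow> continuous_on unit_cube (f i)) \<Longrightarrow> uavg (\<lambda>x. \<Sum>i\<in>S. f i x) = (\<Sum>i\<in>S. uavg (f i))"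
  unfolding uavg_def sum_distrib_left
  by (rule Bochner_Integration.integral_sum) (intro uavg_integrable)

lemma uavg_mono:
  "continuous_on unit_cube f \<Longrightarrow> continuous_on unit_cube g \<Longrightarrow> (\<And>x. x \<in> unit_cube \<Longrightarrow> f x \<le> g x) \<Longrightarrow> uavg f \<le> uavg g"
  unfolding uavg_def using uavg_integrable[of f] uavg_integrable[of g]
  by (intro integral_mono) (auto simp: indicator_def)

lemma uavg_nonneg: "(\<And>x. x \<in> unit_cube \<Longrightarrow> 0 \<le> f x) \<Longrightarrow> 0 \<le> uavg f"
  unfolding uavg_def by (intro Bochner_Integration.integral_nonneg) (auto simp: indicator_def)

lemma uavg_abs: "\<bar>uavg f\<bar> \<le> uavg (\<lambda>x. \<bar>f x\<bar>)"
proof -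
  have "norm (uavg f) \<le> (LINT x|lborel. norm (indicator unit_cube x * f x))"
    unfolding uavg_def by (rule integral_norm_bound)
  then show ?thesis unfolding uavg_def by (simp add: abs_mult)
qed

text \<open>Second moment about \<open>c\<close> = squared bias + variance. Jensen's inequality is
  the case \<open>c = 0\<close>, and the stopping argument for mean square oscillation needs general
  \<open>c\<close>.\<close>

lemma uavg_variance:
  assumes "continuous_on unit_cube f"
  shows "uavg (\<lambda>x. (f x - c)\<^sup>2) = (uavg f - c)\<^sup>2 + uavg (\<lambda>x. (f x - uavg f)\<^sup>2)"
proof -
  have sq: "uavg (\<lambda>x. (f x - c)\<^sup>2) = uavg (\<lambda>x. (f x)\<^sup>2) - 2 * c * uavg f + c\<^sup>2" for c
  proof -
    have "uavg (\<lambda>x. (f x - c)\<^sup>2) = uavg (\<lambda>x. ((f x)\<^sup>2 - (2 * c) * f x) + c\<^sup>2)"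
      by (rule uavg_cong) (simp add: power2_diff mult_ac)
    also have "\<dots> = uavg (\<lambda>x. (f x)\<^sup>2) - 2 * c * uavg f + c\<^sup>2"
    proof -
      have "continuous_on unit_cube (\<lambda>x. (f x)\<^sup>2)" "continuous_on unit_cube (\<lambda>x. (2 * c) * f x)"
        "continuous_on unit_cube (\<lambda>x. (f x)\<^sup>2 - (2 * c) * f x)"
        "continuous_on unit_cube (\<lambda>x::real^'a. c\<^sup>2)"
        by (intro continuous_intros assms)+
      then show ?thesis
        using uavg_add[of "\<lambda>x. (f x)\<^sup>2 - (2 * c) * f x" "\<lambda>x. c\<^sup>2"]
          uavg_diff[of "\<lambda>x. (f x)\<^sup>2" "\<lambda>x. (2 * c) * f x"] uavg_cmult[of "2 * c" f]
          uavg_const[of "c\<^sup>2", where 'n='a]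
        by linarith
    qed
    finally show ?thesis .
  qed
  show ?thesis unfolding sq by (simp add: power2_eq_square algebra_simps)
qed

lemma uavg_jensen:
  assumes "continuous_on unit_cube f"
  shows "(uavg f)\<^sup>2 \<le> uavg (\<lambda>x. (f x)\<^sup>2)"
proof -
  have "0 \<le> uavg (\<lambda>x. (f x - uavg f)\<^sup>2)" by (rule uavg_nonneg) simp
  then show ?thesis using uavg_variance[OF assms, where c = 0] by simp
qed

section \<open>Dyadic subdivision of cubes\<close>

definition corner :: "'n set \<Rightarrow> real^'n::finite" where
  "corner S = (\<chi> i. if i \<in> S then 1 else 0)"

text \<open>The halves are indexed by the set of coordinates in which the upper half is taken, hence
  by \<open>corner S\<close>. They overlap only on the hyperplanes \<open>x $ i = 1/2\<close>, which
  are null sets.\<close>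

lemma uavg_halving:
  fixes g :: "real^'n::finite \<Rightarrow> real"
  assumes g: "continuous_on UNIV g"
  shows "uavg g = (1 / 2 ^ CARD('n)) * (\<Sum>S\<in>UNIV. uavg (\<lambda>x. g ((1/2) *\<^sub>R corner S + (1/2) *\<^sub>R x)))"
proof -
  have [measurable]: "g \<in> borel_measurable borel" using g by (rule borel_measurable_continuous_onI)
  define Q where "Q S = {y :: real^'n. \<forall>i. if i \<in> S then 1/2 \<le> y $ i \<and> y $ i \<le> 1 else 0 \<le> y $ i \<and> y $ i \<le> 1/2}" for S
  have Qbox: "Q S = cbox ((1/2) *\<^sub>R corner S) ((1/2) *\<^sub>R corner S + (1/2) *\<^sub>R 1)" for S
    by (auto simp: Q_def mem_box_cart corner_def split: if_splits)
  have [measurable]: "Q S \<in> sets borel" for S unfolding Qbox by simp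
  have piece: "(1 / 2 ^ CARD('n)) * uavg (\<lambda>x. g ((1/2) *\<^sub>R corner S + (1/2) *\<^sub>R x)) = (LINT x|lborel. indicator (Q S) x * g x)" for S
  proof -
    have "(if i \<in> S then 1/2 \<le> ((1/2) *\<^sub>R corner S + (1/2) *\<^sub>R x) $ i \<and> ((1/2) *\<^sub>R corner S + (1/2) *\<^sub>R x) $ i \<le> 1
      else 0 \<le> ((1/2) *\<^sub>R corner S + (1/2) *\<^sub>R x) $ i \<and> ((1/2) *\<^sub>R corner S + (1/2) *\<^sub>R x) $ i \<le> 1/2)
      \<longleftrightarrow> 0 \<le> x $ i \<and> x $ i \<le> 1" for x i
      by (auto simp: corner_def)
    then have "(1/2) *\<^sub>R corner S + (1/2) *\<^sub>R x \<in> Q S \<longleftrightarrow> x \<in> unit_cube" for x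
      unfolding mem_unit_cube Q_def mem_Collect_eq by blast
    then have "indicator (Q S) ((1/2) *\<^sub>R corner S + (1/2) *\<^sub>R x) = (indicator unit_cube x :: real)" for x
      by (simp add: indicator_def)
    then show ?thesis
      using lborel_integral_affine[of "\<lambda>x. indicator (Q S) x * g x" "1/2" "(1/2) *\<^sub>R corner S"]
      by (simp add: uavg_def power_one_over)
  qed
  have intQ: "integrable lborel (\<lambda>x. indicator (Q S) x * g x)" for S
    using borel_integrable_compact[of "Q S" g] continuous_on_subset[OF g] unfolding Qbox by simp
  have ae: "AE x::real^'n in lborel. x $ i \<noteq> 1/2" for i :: 'n
  proof -
    have "{x :: real^'n. x $ i = 1/2} \<in> null_sets lebesgue"
      using negligible_hyperplane[of "axis i 1 :: real^'n" "1/2"]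
      by (simp add: negligible_iff_null_sets inner_axis' axis_eq_0_iff)
    from AE_not_in[OF this] have "AE x::real^'n in lebesgue. x $ i \<noteq> 1/2" by simp
    then show ?thesis unfolding AE_completion_iff .
  qed
  have "AE x::real^'n in lborel. \<forall>i. x $ i \<noteq> 1/2"
    using ae by (subst AE_all_countable) auto
  then have "AE x in lborel. indicator unit_cube x * g x = (\<Sum>S\<in>UNIV. indicator (Q S) x * g x)"
  proof (rule AE_mp, intro AE_I2 impI)
    fix x :: "real^'n" assume x: "\<forall>i. x $ i \<noteq> 1/2"
    \<comment> \<open>Off those hyperplanes, only the index set of the coordinates exceeding 1/2 can
      contribute.\<close>
    have "indicator (Q S) x * g x = (if S = {i. x $ i > 1/2} then indicator unit_cube x * g x else 0)" for S
    proof (cases "S = {i. x $ i > 1/2}")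
      case True
      have "(if x $ i > 1/2 then 1/2 \<le> x $ i \<and> x $ i \<le> 1 else 0 \<le> x $ i \<and> x $ i \<le> 1/2) \<longleftrightarrow> 0 \<le> x $ i \<and> x $ i \<le> 1" for i
        by auto
      then have "x \<in> Q S \<longleftrightarrow> x \<in> unit_cube"
        unfolding True Q_def mem_unit_cube mem_Collect_eq by blast
      then show ?thesis using True by (simp add: indicator_def)
    next
      case False
      then obtain i where "(i \<in> S) \<noteq> (x $ i > 1/2)" by auto
      moreover have "if i \<in> S then 1/2 \<le> x $ i \<and> x $ i \<le> 1 else 0 \<le> x $ i \<and> x $ i \<le> 1/2" if "x \<in> Q S"
        using that unfolding Q_def by blast
      ultimately have "x \<notin> Q S" using x[rule_format, of i] by (auto split: if_splits)
      then show ?thesis using False by simp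
    qed
    then show "indicator unit_cube x * g x = (\<Sum>S\<in>UNIV. indicator (Q S) x * g x)" by simp
  qed
  then have "uavg g = (LINT x|lborel. (\<Sum>S\<in>UNIV. indicator (Q S) x * g x))"
    unfolding uavg_def by (intro integral_cong_AE) measurable
  also have "\<dots> = (\<Sum>S\<in>UNIV. (1 / 2 ^ CARD('n)) * uavg (\<lambda>x. g ((1/2) *\<^sub>R corner S + (1/2) *\<^sub>R x)))"
    unfolding piece by (rule Bochner_Integration.integral_sum) (rule intQ)
  finally show ?thesis unfolding sum_distrib_left .
qed

text \<open>A cube is given by its lower corner \<open>a\<close> and side length \<open>h\<close>; averages over it are pulled
  back to the unit cube.\<close>

definition subcube :: "real^'n::finite \<Rightarrow> real \<Rightarrow> real^'n \<Rightarrow> real \<Rightarrow> bool" where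
  "subcube a h b k \<longleftrightarrow> 0 < h \<and> (\<forall>i. b $ i \<le> a $ i \<and> a $ i + h \<le> b $ i + k)"

definition cube_avg :: "(real^'n::finite \<Rightarrow> real) \<Rightarrow> real^'n \<Rightarrow> real \<Rightarrow> real" where
  "cube_avg f a h = uavg (\<lambda>x. f (a + h *\<^sub>R x))"

definition cube_osc :: "(real^'n::finite \<Rightarrow> real) \<Rightarrow> real^'n \<Rightarrow> real \<Rightarrow> real" where
  "cube_osc f a h = cube_avg (\<lambda>x. \<bar>f x - cube_avg f a h\<bar>) a h"

definition cube_var :: "(real^'n::finite \<Rightarrow> real) \<Rightarrow> real^'n \<Rightarrow> real \<Rightarrow> real" where
  "cube_var f a h = cube_avg (\<lambda>x. (f x - cube_avg f a h)\<^sup>2) a h"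

lemma continuous_on_affine_arg:
  "continuous_on UNIV f \<Longrightarrow> continuous_on S (\<lambda>x. f (a + h *\<^sub>R (x::real^'n::finite)))"
  by (rule continuous_on_compose2[of UNIV f]) (auto intro!: continuous_intros)

lemma subcube_trans: "subcube a h b k \<Longrightarrow> subcube b k c l \<Longrightarrow> subcube a h c l"
  unfolding subcube_def by (meson order.trans)

lemma subcube_half: "subcube a h b k \<Longrightarrow> subcube (a + (h/2) *\<^sub>R corner S) (h/2) b k"
  unfolding subcube_def corner_def by (auto) (smt (verit) field_sum_of_halves)+

lemma subcube_point:
  "subcube a h b k \<Longrightarrow> x \<in> unit_cube \<Longrightarrow> a + h *\<^sub>R x \<in> cbox b (\<chi> i. b $ i + k)"
  unfolding subcube_def mem_unit_cube mem_box_cart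
proof (intro allI)
  fix i
  assume *: "0 < h \<and> (\<forall>i. b $ i \<le> a $ i \<and> a $ i + h \<le> b $ i + k)" "\<forall>i. 0 \<le> x $ i \<and> x $ i \<le> 1"
  then have "0 \<le> h * x $ i" "h * x $ i \<le> h" by (auto simp: mult_left_le)
  with *(1)[THEN conjunct2, THEN spec, of i]
  show "b $ i \<le> (a + h *\<^sub>R x) $ i \<and> (a + h *\<^sub>R x) $ i \<le> (\<chi> i. b $ i + k) $ i"
    by simp
qed

lemma cube_avg_halving:
  fixes f :: "real^'n::finite \<Rightarrow> real"
  assumes "continuous_on UNIV f"
  shows "cube_avg f a h = (1 / 2 ^ CARD('n)) * (\<Sum>S\<in>UNIV. cube_avg f (a + (h/2) *\<^sub>R corner S) (h/2))"
  unfolding cube_avg_def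
  by (subst uavg_halving[OF continuous_on_affine_arg[OF assms]]) (simp add: algebra_simps)

text \<open>A half has \<open>1 / 2 ^ CARD('n)\<close> of the volume. Applied to the oscillation,
  this bounds the jump of the mean from a cube to one of its halves.\<close>

lemma cube_avg_child_le:
  fixes f :: "real^'n::finite \<Rightarrow> real"
  assumes "continuous_on UNIV f" "\<And>x. 0 \<le> f x"
  shows "cube_avg f (a + (h/2) *\<^sub>R corner S) (h/2) \<le> 2 ^ CARD('n) * cube_avg f a h"
proof -
  have "cube_avg f (a + (h/2) *\<^sub>R corner S) (h/2) \<le> (\<Sum>S\<in>UNIV. cube_avg f (a + (h/2) *\<^sub>R corner S) (h/2))"
    by (rule member_le_sum) (auto simp: cube_avg_def assms intro: uavg_nonneg)
  then show ?thesis by (subst cube_avg_halving[OF assms(1)]) simp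
qed

lemma cube_avg_dist:
  assumes "continuous_on UNIV f"
  shows "\<bar>cube_avg f a h - c\<bar> \<le> cube_avg (\<lambda>x. \<bar>f x - c\<bar>) a h"
proof -
  have "cube_avg f a h - c = uavg (\<lambda>x. f (a + h *\<^sub>R x) - c)"
    unfolding cube_avg_def
    by (subst uavg_diff) (auto intro: continuous_on_affine_arg assms)
  then show ?thesis using uavg_abs unfolding cube_avg_def by metis
qed

text \<open>Supplies the finiteness of suprema over subcubes, without which they could not be
  absorbed.\<close>

lemma bounded_on_cube:
  assumes "continuous_on UNIV (f :: real^'n::finite \<Rightarrow> real)"
  shows "\<exists>M>0. \<forall>a h x. subcube a h b k \<and> x \<in> unit_cube \<longrightarrow> \<bar>f (a + h *\<^sub>R x)\<bar> \<le> M"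
proof -
  have "bounded (f ` cbox b (\<chi> i. b $ i + k))"
    using assms by (intro compact_imp_bounded compact_continuous_image) (auto intro: continuous_on_subset)
  then obtain M where "M > 0" "\<And>x. x \<in> cbox b (\<chi> i. b $ i + k) \<Longrightarrow> \<bar>f x\<bar> \<le> M"
    unfolding bounded_pos by auto
  then show ?thesis using subcube_point by blast
qed

text \<open>A stopping argument in place of exponential integrability. Let \<open>V\<close> be the
  largest variance over the subcubes, finite by continuity, and let \<open>c\<close> be the mean of
  the given cube. Halve until the mean leaves the \<open>l\<close>-neighbourhood of \<open>c\<close>
  or \<open>f\<close> is nearly constant. A cube stopped for the first reason has variance at most
  \<open>V\<close> and a mean of \<open>\<bar>f - c\<bar>\<close> above \<open>l\<close>, so
  \<open>V / l\<close> times that mean pays for the variance. Summing over the halves gives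
  \<open>V \<le> (l + B + A)\<^sup>2 + V / 2\<close>.\<close>

theorem cube_var_le_osc:
  fixes f :: "real^'n::finite \<Rightarrow> real"
  assumes f: "continuous_on UNIV f" and A: "A > 0"
    and osc: "\<And>a h. subcube a h b k \<Longrightarrow> cube_osc f a h \<le> A"
    and ah: "subcube a h b k"
  shows "cube_var f a h \<le> 2 * (3 + 2 ^ CARD('n))\<^sup>2 * A\<^sup>2"
proof -
  \<comment> \<open>\<open>B\<close> bounds the jump of the mean in one halving. With
    \<open>l\<close> twice the oscillation bound, \<open>V / l * A\<close> becomes
    \<open>V / 2\<close>.\<close>
  define B where "B = 2 ^ CARD('n) * A"
  define l where "l = 2 * A"
  have l: "l > 0" using A by (simp add: l_def)
  have B: "B > 0" using A by (simp add: B_def)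
  define V where "V = (SUP (a, h)\<in>{(a, h). subcube a h b k}. cube_var f a h)"
  note ci = continuous_intros f
  obtain M where M: "M > 0" "\<And>a h x. subcube a h b k \<Longrightarrow> x \<in> unit_cube \<Longrightarrow> \<bar>f (a + h *\<^sub>R x)\<bar> \<le> M"
    using bounded_on_cube[OF f] by metis
  have "cube_var f a h \<le> (2 * M)\<^sup>2" if "subcube a h b k" for a h
  proof -
    have "\<bar>cube_avg f a h\<bar> \<le> cube_avg (\<lambda>x. \<bar>f x\<bar>) a h" using cube_avg_dist[OF f, of a h 0] by simp
    also have "\<dots> \<le> uavg (\<lambda>x::real^'n. M)"
      unfolding cube_avg_def using M(2)[OF that] by (intro uavg_mono continuous_on_affine_arg[of "\<lambda>x. \<bar>f x\<bar>"] ci) auto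
    finally have m: "\<bar>cube_avg f a h\<bar> \<le> M" by simp
    have "cube_var f a h \<le> uavg (\<lambda>x::real^'n. (2 * M)\<^sup>2)"
      unfolding cube_var_def cube_avg_def[of "\<lambda>x. (f x - cube_avg f a h)\<^sup>2"]
    proof (intro uavg_mono continuous_on_affine_arg[of "\<lambda>x. (f x - cube_avg f a h)\<^sup>2"] ci)
      fix x :: "real^'n" assume "x \<in> unit_cube"
      then have "\<bar>f (a + h *\<^sub>R x)\<bar> \<le> M" using M(2)[OF that] by simp
      then have "\<bar>f (a + h *\<^sub>R x) - cube_avg f a h\<bar> \<le> \<bar>2 * M\<bar>" using m by linarith
      then show "(f (a + h *\<^sub>R x) - cube_avg f a h)\<^sup>2 \<le> (2 * M)\<^sup>2" by (simp only: abs_le_square_iff)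
    qed
    then show ?thesis by simp
  qed
  then have bdd: "bdd_above ((\<lambda>(a, h). cube_var f a h) ` {(a, h). subcube a h b k})"
    by (intro bdd_aboveI[of _ "(2 * M)\<^sup>2"]) auto
  have V: "cube_var f a h \<le> V" if "subcube a h b k" for a h
    unfolding V_def using that by (intro cSUP_upper2[OF bdd, of "(a, h)"]) auto
  have V0: "0 \<le> V"
    using V[OF ah] uavg_nonneg[of "\<lambda>x. (f (a + h *\<^sub>R x) - cube_avg f a h)\<^sup>2"] unfolding cube_var_def cube_avg_def by simp
  have "uniformly_continuous_on (cbox b (\<chi> i. b $ i + k)) f"
    using f by (intro compact_uniformly_continuous) (auto intro: continuous_on_subset)
  then obtain d where d: "d > 0" "\<And>x y. x \<in> cbox b (\<chi> i. b $ i + k) \<Longrightarrow> y \<in> cbox b (\<chi> i. b $ i + k) \<Longrightarrow> norm (x - y) < d \<Longrightarrow> \<bar>f x - f y\<bar> < A"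
    using A unfolding uniformly_continuous_on_def dist_norm real_norm_def by metis
  \<comment> \<open>The unit cube has diameter at most \<open>CARD('n)\<close>, so on cubes of side
    at most \<open>r\<close> the function varies by less than \<open>A\<close>.\<close>
  define r where "r = d / (real CARD('n) + 1)"
  have r: "r > 0" using d by (simp add: r_def)
  \<comment> \<open>\<open>m\<close> counts the halvings that remain. The tolerance for the mean is
    \<open>l + B\<close>: a parent within \<open>l\<close> of \<open>c\<close>, followed by one
    jump.\<close>
  have main: "cube_avg (\<lambda>x. (f x - c)\<^sup>2) a h \<le> (l + B + A)\<^sup>2 + V / l * cube_avg (\<lambda>x. \<bar>f x - c\<bar>) a h"
    if "subcube a h b k" "h \<le> 2 ^ m * r" "\<bar>cube_avg f a h - c\<bar> \<le> l + B" for a h c m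
    using that
  proof (induction m arbitrary: a h)
    case 0
    have "cube_avg (\<lambda>x. (f x - c)\<^sup>2) a h \<le> uavg (\<lambda>x::real^'n. (l + B + A)\<^sup>2)"
      unfolding cube_avg_def[of "\<lambda>x. (f x - c)\<^sup>2"]
    proof (intro uavg_mono continuous_on_affine_arg[of "\<lambda>x. (f x - c)\<^sup>2"] ci)
      fix x :: "real^'n" assume x: "x \<in> unit_cube"
      have "\<bar>f (a + h *\<^sub>R y) - f (a + h *\<^sub>R x)\<bar> \<le> A" if y: "y \<in> unit_cube" for y
      proof -
        have "norm (y - x) \<le> real CARD('n)" by (rule dist_unit_cube_le[OF y x])
        then have "h * norm (y - x) \<le> r * real CARD('n)"
          using 0 r unfolding subcube_def by (intro mult_mono) auto
        also have "\<dots> < d" using d by (simp add: r_def field_simps)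
        finally have "norm ((a + h *\<^sub>R y) - (a + h *\<^sub>R x)) < d"
          using 0(1) unfolding subcube_def by (simp add: scaleR_diff_right[symmetric])
        then show ?thesis using d(2) subcube_point[OF 0(1)] x y by (meson less_imp_le)
      qed
      then have "cube_avg (\<lambda>y. \<bar>f y - f (a + h *\<^sub>R x)\<bar>) a h \<le> uavg (\<lambda>x::real^'n. A)"
        unfolding cube_avg_def by (intro uavg_mono continuous_on_affine_arg[of "\<lambda>y. \<bar>f y - f (a + h *\<^sub>R x)\<bar>"] ci)
      then have "\<bar>cube_avg f a h - f (a + h *\<^sub>R x)\<bar> \<le> A"
        using cube_avg_dist[OF f, of a h "f (a + h *\<^sub>R x)"] by simp
      then have "\<bar>f (a + h *\<^sub>R x) - c\<bar> \<le> \<bar>l + B + A\<bar>" using 0(3) by linarith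
      then show "(f (a + h *\<^sub>R x) - c)\<^sup>2 \<le> (l + B + A)\<^sup>2" by (simp only: abs_le_square_iff)
    qed
    moreover have "0 \<le> V / l * cube_avg (\<lambda>x. \<bar>f x - c\<bar>) a h"
      using V0 l by (intro mult_nonneg_nonneg) (auto simp: cube_avg_def intro!: uavg_nonneg)
    ultimately show ?case by simp
  next
    case (Suc m)
    let ?E = "cube_avg (\<lambda>x. \<bar>f x - c\<bar>) a h"
    show ?case
    proof (cases "\<bar>cube_avg f a h - c\<bar> \<le> l")
      case False
      \<comment> \<open>The cube is stopped here: no further halving, the variance is estimated by
        the global bound \<open>V\<close>.\<close>
      have "cube_avg (\<lambda>x. (f x - c)\<^sup>2) a h = (cube_avg f a h - c)\<^sup>2 + cube_var f a h"
        unfolding cube_var_def cube_avg_def by (rule uavg_variance[OF continuous_on_affine_arg[OF f]])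
      also have "\<dots> \<le> (l + B + A)\<^sup>2 + V"
      proof (intro add_mono V Suc.prems)
        have "\<bar>cube_avg f a h - c\<bar> \<le> \<bar>l + B + A\<bar>" using Suc.prems(3) A by linarith
        then show "(cube_avg f a h - c)\<^sup>2 \<le> (l + B + A)\<^sup>2" by (simp only: abs_le_square_iff)
      qed
      also have "V \<le> V / l * ?E"
      proof -
        have "l \<le> ?E" using False cube_avg_dist[OF f, of a h c] by linarith
          then have "V / l * l \<le> V / l * ?E" using V0 l by (intro mult_left_mono) auto
        then show ?thesis using l by simp
      qed
      finally show ?thesis by simp
    next
      case True
      define a' where "a' S = a + (h/2) *\<^sub>R corner S" for S
      have child: "cube_avg (\<lambda>x. (f x - c)\<^sup>2) (a' S) (h/2) \<le> (l + B + A)\<^sup>2 + V / l * cube_avg (\<lambda>x. \<bar>f x - c\<bar>) (a' S) (h/2)" for S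
      proof (rule Suc.IH)
        show "subcube (a' S) (h/2) b k" unfolding a'_def by (rule subcube_half[OF Suc.prems(1)])
        show "h / 2 \<le> 2 ^ m * r" using Suc.prems(2) by simp
        have "\<bar>cube_avg f (a' S) (h/2) - cube_avg f a h\<bar> \<le> cube_avg (\<lambda>x. \<bar>f x - cube_avg f a h\<bar>) (a' S) (h/2)"
          by (rule cube_avg_dist[OF f])
        also have "\<dots> \<le> 2 ^ CARD('n) * cube_osc f a h"
          unfolding a'_def cube_osc_def by (rule cube_avg_child_le) (auto intro!: ci)
        also have "\<dots> \<le> B" unfolding B_def using osc[OF Suc.prems(1)] by simp
        finally show "\<bar>cube_avg f (a' S) (h/2) - c\<bar> \<le> l + B" using True by linarith
      qed
      have "cube_avg (\<lambda>x. (f x - c)\<^sup>2) a h = (1 / 2 ^ CARD('n)) * (\<Sum>S\<in>UNIV. cube_avg (\<lambda>x. (f x - c)\<^sup>2) (a' S) (h/2))"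
        unfolding a'_def by (rule cube_avg_halving) (intro ci)
      also have "\<dots> \<le> (1 / 2 ^ CARD('n)) * (\<Sum>S\<in>(UNIV::'n set set). (l + B + A)\<^sup>2 + V / l * cube_avg (\<lambda>x. \<bar>f x - c\<bar>) (a' S) (h/2))"
        by (intro mult_left_mono sum_mono child) auto
      also have "\<dots> = (l + B + A)\<^sup>2 + V / l * ((1 / 2 ^ CARD('n)) * (\<Sum>S\<in>UNIV. cube_avg (\<lambda>x. \<bar>f x - c\<bar>) (a' S) (h/2)))"
        unfolding sum.distrib sum_distrib_left[symmetric] distrib_left
          by (simp add: card_UNIV_set)
      also have "\<dots> = (l + B + A)\<^sup>2 + V / l * ?E"
        unfolding a'_def by (subst cube_avg_halving[symmetric]) (auto intro!: ci)
      finally show ?thesis .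
    qed
  qed
  have "V \<le> (l + B + A)\<^sup>2 + V / l * A"
    unfolding V_def
  proof (rule cSUP_least)
    show "{(a, h). subcube a h b k} \<noteq> {}" using ah by auto
    fix p assume "p \<in> {(a, h). subcube a h b k}"
    then obtain a h where p: "p = (a, h)" "subcube a h b k" by auto
    obtain m where "h / r < 2 ^ m" using real_arch_pow[of 2 "h / r"] by auto
    then have "h \<le> 2 ^ m * r" using r by (simp add: field_simps)
    then have "cube_var f a h \<le> (l + B + A)\<^sup>2 + V / l * cube_osc f a h"
      unfolding cube_var_def cube_osc_def using l B by (intro main[OF p(2)]) auto
    also have "\<dots> \<le> (l + B + A)\<^sup>2 + V / l * A"
      using V0 l osc[OF p(2)] by (intro add_left_mono mult_left_mono) auto
    finally show "(case p of (a, h) \<Rightarrow> cube_var f a h) \<le> (l + B + A)\<^sup>2 + (SUP (a, h)\<in>{(a, h). subcube a h b k}. cube_var f a h) / l * A"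
      unfolding V_def p by simp
  qed
  then have "V \<le> 2 * (l + B + A)\<^sup>2" using A by (simp add: l_def)
  also have "l + B + A = (3 + 2 ^ CARD('n)) * A" by (simp add: l_def B_def algebra_simps)
  finally show ?thesis using V[OF ah] by (simp add: power_mult_distrib)
qed

subsection \<open>The mollification error\<close>

lemma weighted_jensen:
  fixes w f :: "'a \<Rightarrow> real"
  assumes "integrable M w" "(LINT x|M. w x) = 1" "\<And>x. 0 \<le> w x"
    and "integrable M (\<lambda>x. w x * f x)" "integrable M (\<lambda>x. w x * (f x)\<^sup>2)"
  shows "(LINT x|M. w x * f x)\<^sup>2 \<le> (LINT x|M. w x * (f x)\<^sup>2)"
proof -
  define m where "m = (LINT x|M. w x * f x)"
  have "0 \<le> (LINT x|M. w x * (f x - m)\<^sup>2)"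
    using assms(3) by simp
  also have "\<dots> = (LINT x|M. w x * (f x)\<^sup>2 - 2 * m * (w x * f x) + m\<^sup>2 * w x)"
    by (intro Bochner_Integration.integral_cong) (auto simp: power2_eq_square algebra_simps)
  also have "\<dots> = (LINT x|M. w x * (f x)\<^sup>2) - 2 * m * m + m\<^sup>2"
    using assms by (simp add: m_def)
  finally show ?thesis unfolding m_def[symmetric] by (simp add: power2_eq_square)
qed

lemma fubini_compact:
  fixes F :: "'a::euclidean_space \<Rightarrow> 'b::euclidean_space \<Rightarrow> real"
  assumes C: "compact C" and D: "compact D" and F: "continuous_on (C \<times> D) (\<lambda>p. F (fst p) (snd p))"
  defines "G \<equiv> \<lambda>x y. indicator C x * indicator D y * F x y"
  shows "integrable lborel (\<lambda>p. G (fst p) (snd p))"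
    and "(LINT x|lborel. LINT y|lborel. G x y) = (LINT p|lborel. G (fst p) (snd p))"
    and "(LINT x|lborel. LINT y|lborel. G x y) = (LINT y|lborel. LINT x|lborel. G x y)"
    and "integrable lborel (\<lambda>x. LINT y|lborel. G x y)"
    and "integrable lborel (\<lambda>y. LINT x|lborel. G x y)"
proof -
  have "integrable lborel (\<lambda>p. indicator (C \<times> D) p *\<^sub>R F (fst p) (snd p))"
    by (intro borel_integrable_compact compact_Times C D F)
  also have "(\<lambda>p. indicator (C \<times> D) p *\<^sub>R F (fst p) (snd p)) = (\<lambda>p. G (fst p) (snd p))"
    by (auto simp: G_def indicator_def fun_eq_iff)
  finally show int: "integrable lborel (\<lambda>p. G (fst p) (snd p))" .
  then have int': "integrable (lborel \<Otimes>\<^sub>M lborel) (\<lambda>p. G (fst p) (snd p))"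
    by (simp add: lborel_prod)
  then have int2: "integrable (lborel \<Otimes>\<^sub>M lborel) (case_prod G)"
    by (simp add: case_prod_unfold)
  show "(LINT x|lborel. LINT y|lborel. G x y) = (LINT p|lborel. G (fst p) (snd p))"
    using lborel_pair.integral_fst'[OF int'] by (simp add: lborel_prod)
  show "(LINT x|lborel. LINT y|lborel. G x y) = (LINT y|lborel. LINT x|lborel. G x y)"
    using lborel_pair.Fubini_integral[OF int2] by simp
  show "integrable lborel (\<lambda>x. LINT y|lborel. G x y)"
    using lborel_pair.integrable_fst'[OF int'] by simp
  show "integrable lborel (\<lambda>y. LINT x|lborel. G x y)"
    using lborel_pair.integrable_snd[OF int2] by simp
qed

lemma convolve_flip:
  fixes \<phi> :: "real^'n::finite \<Rightarrow> real"
  assumes [measurable]: "w \<in> borel_measurable borel" "\<phi> \<in> borel_measurable borel"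
  shows "convolve w \<phi> x = (LINT y|lborel. \<phi> y * w (x - y))"
  unfolding convolve_def
  by (subst lborel_integral_affine[of "\<lambda>z. w z * \<phi> (x - z)" "-1" x]) (auto simp: mult.commute)

lemma norm_sq_cart: "(norm (y :: real^'n::finite))\<^sup>2 = (\<Sum>j\<in>UNIV. (y $ j)\<^sup>2)"
  by (simp add: norm_vec_def L2_set_def sum_nonneg)

text \<open>Along the segment from \<open>x - y\<close> to \<open>x\<close>,
  \<open>u x - u (x - y)\<close> is the integral over \<open>t\<close> of \<open>D x (y, t)\<close>,
  which is at most \<open>e\<close> times the gradient. Jensen's inequality for the weight
  \<open>\<eta>\<close> on pairs \<open>(y, t)\<close>, followed by Fubini and a translation in
  \<open>x\<close>, gives the bound. The factor \<open>\<zeta>\<close> stands for a derivative of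
  the cutoff and keeps every segment inside the unit cube.\<close>

lemma mollification_error:
  fixes u :: "real^'n::finite \<Rightarrow> real"
  assumes u: "smooth u" and \<eta>: "test_function UNIV \<eta>" "\<And>x. 0 \<le> \<eta> x" "(LINT x|lborel. \<eta> x) = 1"
    and supp: "\<And>x. \<eta> x \<noteq> 0 \<Longrightarrow> norm x \<le> e" and e: "e \<le> r"
    and \<zeta>: "continuous_on UNIV \<zeta>" "\<And>x. \<bar>\<zeta> x\<bar> \<le> M" "\<And>x. \<zeta> x \<noteq> 0 \<Longrightarrow> cball x r \<subseteq> unit_cube"
  shows "uavg (\<lambda>x. (\<zeta> x)\<^sup>2 * (u x - convolve (\<lambda>z. indicator unit_cube z * u z) \<eta> x)\<^sup>2)
    \<le> M\<^sup>2 * e\<^sup>2 * (\<Sum>j\<in>UNIV. uavg (\<lambda>x. (partial_deriv j u x)\<^sup>2))"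
proof -
  define C where "C = (unit_cube :: (real^'n) set)"
  define S where "S = cball (0::real^'n) e \<times> {0..1::real}"
  have S: "compact S" unfolding S_def by (intro compact_Times) auto
  have C: "compact C" by (simp add: C_def)
  have [measurable]: "S \<in> sets borel" using S by (rule borel_compact)
  define H where "H z = (\<Sum>j\<in>UNIV. (partial_deriv j u z)\<^sup>2)" for z
  define D where "D x p = (\<Sum>j\<in>UNIV. fst p $ j * partial_deriv j u (x - snd p *\<^sub>R fst p))" for x and p :: "(real^'n) \<times> real"
  \<comment> \<open>A probability density in \<open>y\<close> and \<open>t\<close> jointly, so that
    a single application of Jensen's inequality covers both averages.\<close>
  define w where "w p = indicator S p * \<eta> (fst p)" for p :: "(real^'n) \<times> real"
  note \<eta>s = test_function_smooth[OF \<eta>(1)]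
  note pc = smooth_continuous[OF smooth_partial[OF u], of UNIV]
  have ce: "continuous_on T (\<lambda>p. \<eta> (f p))" if "continuous_on T f" for T :: "'c::topological_space set" and f
    by (rule continuous_on_compose2[OF smooth_continuous[OF \<eta>s, of UNIV] that]) auto
  have cp: "continuous_on T (\<lambda>p. partial_deriv j u (f p))" if "continuous_on T f" for T :: "'c::topological_space set" and f j
    by (rule continuous_on_compose2[OF pc that]) auto
  have cz: "continuous_on T (\<lambda>p. \<zeta> (f p))" if "continuous_on T f" for T :: "'c::topological_space set" and f
    by (rule continuous_on_compose2[OF \<zeta>(1) that]) auto
  have cD: "continuous_on T (\<lambda>p. D x p)" for T x
    unfolding D_def by (intro continuous_intros cp)
  have cH: "continuous_on T (\<lambda>p. H (f p))" if "continuous_on T f" for T :: "'c::topological_space set" and f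
    unfolding H_def by (intro continuous_intros cp that)
  have [measurable]: "H \<in> borel_measurable borel" "u \<in> borel_measurable borel" "\<eta> \<in> borel_measurable borel" "\<zeta> \<in> borel_measurable borel"
    using cH[of UNIV "\<lambda>x. x"] smooth_continuous[OF u] smooth_continuous[OF \<eta>s] \<zeta>(1)
    by (auto intro!: borel_measurable_continuous_onI)
  have w0: "0 \<le> w p" for p using \<eta>(2) by (simp add: w_def)
  have intS: "integrable lborel (\<lambda>p. indicator S p * f p)" if "continuous_on S f" for f :: "(real^'n) \<times> real \<Rightarrow> real"
    using borel_integrable_compact[OF S that] by simp
  have wint: "integrable lborel (\<lambda>p. w p * f p)" if "continuous_on S f" for f
    using intS[of "\<lambda>p. \<eta> (fst p) * f p"] that unfolding w_def
    by (simp add: mult.assoc ce continuous_intros)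
  \<comment> \<open>The ball in \<open>S\<close> only provides compactness; \<open>\<eta>\<close>
    already vanishes outside it.\<close>
  have w_eq: "w (y, t) = \<eta> y * indicator {0..1} t" for y t
    using supp[of y] by (cases "\<eta> y = 0") (auto simp: w_def S_def indicator_def)
  have split: "(LINT p|lborel. w p * f p) = (LINT y|lborel. \<eta> y * (LINT t|lborel. indicator {0..1} t * f (y, t)))"
    if f: "continuous_on S f" for f
  proof -
    have "(LINT p|lborel. w p * f p) = (LINT y|lborel. LINT t|lborel. w (y, t) * f (y, t))"
      using lborel_pair.integral_fst'[of "\<lambda>p. w p * f p"] wint[OF f] unfolding lborel_prod by simp
    then show ?thesis by (simp add: w_eq mult.assoc)
  qed
  have w1: "(LINT p|lborel. w p) = 1"
    using split[of "\<lambda>_. 1"] \<eta>(3) by simp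
  \<comment> \<open>Where \<open>\<zeta>\<close> does not vanish, the kernel stays inside the unit
    cube and the truncation of \<open>u\<close> is invisible.\<close>
  have err: "u x - convolve (\<lambda>z. indicator unit_cube z * u z) \<eta> x = (LINT p|lborel. w p * D x p)"
    if x: "\<zeta> x \<noteq> 0" for x
  proof -
    have "convolve (\<lambda>z. indicator unit_cube z * u z) \<eta> x = (LINT y|lborel. \<eta> y * u (x - y))"
    proof (subst convolve_flip)
      have "\<eta> y * (indicator unit_cube (x - y) * u (x - y)) = \<eta> y * u (x - y)" for y
      proof (cases "\<eta> y = 0")
        case False
        then have "x - y \<in> cball x r" using supp[of y] e by (simp add: dist_norm)
        then have "x - y \<in> unit_cube" using \<zeta>(3)[OF x] by blast
        then show ?thesis by simp
      qed simp
      then show "(LINT y|lborel. \<eta> y * (indicator unit_cube (x - y) * u (x - y))) = (LINT y|lborel. \<eta> y * u (x - y))"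
        by (intro Bochner_Integration.integral_cong refl)
    qed measurable
    moreover have "integrable lborel (\<lambda>y. \<eta> y * u (x - y))"
      by (rule integrable_test_function[OF test_function_mult[OF \<eta>(1) smooth_reflect[OF u]]])
    ultimately have "u x - convolve (\<lambda>z. indicator unit_cube z * u z) \<eta> x = (LINT y|lborel. \<eta> y * (u x - u (x - y)))"
      using \<eta>(3) integrable_test_function[OF \<eta>(1)] by (simp add: right_diff_distrib)
    also have "\<dots> = (LINT y|lborel. \<eta> y * (LINT t|lborel. indicator {0..1} t * D x (y, t)))"
    proof (intro Bochner_Integration.integral_cong refl arg_cong2[of _ _ _ _ "(*)"])
      fix y
      have "(LINT t|lborel. D x (y, t) * indicator {0..1} t) = - u (x + 1 *\<^sub>R (- y)) - - u (x + 0 *\<^sub>R (- y))"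
      proof (rule integral_FTC_Icc_real)
        fix t :: real
        show "((\<lambda>t. - u (x + t *\<^sub>R (- y))) has_real_derivative D x (y, t)) (at t)"
          using DERIV_minus[OF smooth_has_line_derivative[OF u, of x "- y" t UNIV]]
          by (simp add: D_def sum_negf)
        show "isCont (\<lambda>t. D x (y, t)) t"
          unfolding D_def by (rule continuous_on_interior[of UNIV]) (auto intro!: continuous_intros cp)
      qed simp
      then show "u x - u (x - y) = (LINT t|lborel. indicator {0..1} t * D x (y, t))"
        by (simp add: mult.commute)
    qed
    also have "\<dots> = (LINT p|lborel. w p * D x p)" by (rule split[symmetric, OF cD])
    finally show ?thesis .
  qed
  have pw: "(\<zeta> x)\<^sup>2 * (u x - convolve (\<lambda>z. indicator unit_cube z * u z) \<eta> x)\<^sup>2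
    \<le> e\<^sup>2 * (LINT p|lborel. w p * ((\<zeta> x)\<^sup>2 * H (x - snd p *\<^sub>R fst p)))" for x
  proof (cases "\<zeta> x = 0")
    case False
    have iH: "integrable lborel (\<lambda>p. w p * H (x - snd p *\<^sub>R fst p))"
      by (intro wint cH continuous_intros)
    have "(LINT p|lborel. w p * D x p)\<^sup>2 \<le> (LINT p|lborel. w p * (D x p)\<^sup>2)"
      using wint[of "\<lambda>_. 1"] w1 w0 by (intro weighted_jensen wint cD continuous_intros) auto
    also have "\<dots> \<le> (LINT p|lborel. e\<^sup>2 * (w p * H (x - snd p *\<^sub>R fst p)))"
    proof (rule integral_mono)
      show "integrable lborel (\<lambda>p. w p * (D x p)\<^sup>2)" by (intro wint cD continuous_intros)
      show "integrable lborel (\<lambda>p. e\<^sup>2 * (w p * H (x - snd p *\<^sub>R fst p)))" using iH by simp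
      fix p :: "(real^'n) \<times> real"
      show "w p * (D x p)\<^sup>2 \<le> e\<^sup>2 * (w p * H (x - snd p *\<^sub>R fst p))"
      proof (cases "p \<in> S")
        case True
        have "(D x p)\<^sup>2 \<le> (norm (fst p))\<^sup>2 * H (x - snd p *\<^sub>R fst p)"
          unfolding D_def H_def norm_sq_cart by (rule Cauchy_Schwarz_ineq_sum)
        also have "\<dots> \<le> e\<^sup>2 * H (x - snd p *\<^sub>R fst p)"
          using True by (intro mult_right_mono power_mono) (auto simp: S_def H_def intro: sum_nonneg)
        finally show ?thesis using w0[of p] by (metis mult.left_commute mult_left_mono)
      qed (simp add: w_def)
    qed
    finally have *: "(u x - convolve (\<lambda>z. indicator unit_cube z * u z) \<eta> x)\<^sup>2 \<le> e\<^sup>2 * (LINT p|lborel. w p * H (x - snd p *\<^sub>R fst p))"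
      unfolding err[OF False] by simp
    have "(\<zeta> x)\<^sup>2 * (u x - convolve (\<lambda>z. indicator unit_cube z * u z) \<eta> x)\<^sup>2 \<le> (\<zeta> x)\<^sup>2 * (e\<^sup>2 * (LINT p|lborel. w p * H (x - snd p *\<^sub>R fst p)))"
      by (rule mult_left_mono[OF *]) simp
    also have "\<dots> = e\<^sup>2 * (LINT p|lborel. (\<zeta> x)\<^sup>2 * (w p * H (x - snd p *\<^sub>R fst p)))"
      by simp
    finally show ?thesis by (simp add: mult.left_commute[of "(\<zeta> x)\<^sup>2"])
  qed simp
  define F where "F x p = \<eta> (fst p) * ((\<zeta> x)\<^sup>2 * H (x - snd p *\<^sub>R fst p))" for x and p :: "(real^'n) \<times> real"
  have cF: "continuous_on (C \<times> S) (\<lambda>q. F (fst q) (snd q))"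
    unfolding F_def by (intro continuous_intros ce cz cH)
  note fub = fubini_compact[OF C S cF]
  have FG: "indicator C x * indicator S p * F x p = indicator C x * (w p * ((\<zeta> x)\<^sup>2 * H (x - snd p *\<^sub>R fst p)))" for x p
    by (simp add: F_def w_def mult_ac)
  have "uavg (\<lambda>x. (\<zeta> x)\<^sup>2 * (u x - convolve (\<lambda>z. indicator unit_cube z * u z) \<eta> x)\<^sup>2)
    \<le> (LINT x|lborel. e\<^sup>2 * (LINT p|lborel. indicator C x * indicator S p * F x p))"
    unfolding uavg_def
  proof (rule integral_mono)
    have iu: "integrable lborel (\<lambda>z. indicator unit_cube z * u z)"
      using uavg_integrable[OF smooth_continuous[OF u]] .
    show "integrable lborel (\<lambda>x. indicator unit_cube x * ((\<zeta> x)\<^sup>2 * (u x - convolve (\<lambda>z. indicator unit_cube z * u z) \<eta> x)\<^sup>2))"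
      using cz[of unit_cube "\<lambda>x. x"] smooth_continuous[OF smooth_convolve[OF iu \<eta>(1)]] smooth_continuous[OF u]
      by (intro uavg_integrable continuous_intros) auto
    show "integrable lborel (\<lambda>x. e\<^sup>2 * (LINT p|lborel. indicator C x * indicator S p * F x p))"
      using fub(4) by simp
    show "indicator unit_cube x * ((\<zeta> x)\<^sup>2 * (u x - convolve (\<lambda>z. indicator unit_cube z * u z) \<eta> x)\<^sup>2)
      \<le> e\<^sup>2 * (LINT p|lborel. indicator C x * indicator S p * F x p)" for x
      using pw[of x] unfolding FG by (simp add: C_def indicator_def)
  qed
  also have "\<dots> = e\<^sup>2 * (LINT p|lborel. LINT x|lborel. indicator C x * indicator S p * F x p)"
    using fub(3) by simp
  also have "\<dots> \<le> e\<^sup>2 * (LINT p|lborel. w p * (M\<^sup>2 * uavg H))"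
  proof (intro mult_left_mono integral_mono)
    show "integrable lborel (\<lambda>p. LINT x|lborel. indicator C x * indicator S p * F x p)"
      by (rule fub(5))
    show "integrable lborel (\<lambda>p. w p * (M\<^sup>2 * uavg H))" by (intro wint continuous_intros)
    fix p :: "(real^'n) \<times> real"
    show "(LINT x|lborel. indicator C x * indicator S p * F x p) \<le> w p * (M\<^sup>2 * uavg H)"
    proof (cases "p \<in> S")
      case True
      have sh: "norm (snd p *\<^sub>R fst p) \<le> r"
      proof -
        have "norm (snd p *\<^sub>R fst p) \<le> 1 * e"
          unfolding norm_scaleR using True by (intro mult_mono) (auto simp: S_def)
        then show ?thesis using e by simp
      qed
      have intH: "integrable lborel (\<lambda>x. indicator C x * H x)"
        unfolding C_def by (intro uavg_integrable cH continuous_intros)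
      have "(LINT x|lborel. indicator C x * indicator S p * F x p) = w p * (LINT x|lborel. indicator C x * ((\<zeta> x)\<^sup>2 * H (x - snd p *\<^sub>R fst p)))"
        unfolding FG by (simp add: mult.left_commute[of "indicator _ _" "w p"])
      \<comment> \<open>The shift is at most \<open>r\<close>, so points with
        \<open>\<zeta> x \<noteq> 0\<close> stay in the cube. The shifted integral is therefore
        dominated by that of \<open>H\<close> over the whole cube, whatever the pair
        \<open>p\<close> in \<open>S\<close>.\<close>
      also have "(LINT x|lborel. indicator C x * ((\<zeta> x)\<^sup>2 * H (x - snd p *\<^sub>R fst p))) \<le>
        (LINT x|lborel. M\<^sup>2 * (indicator C (- (snd p *\<^sub>R fst p) + 1 *\<^sub>R x) * H (- (snd p *\<^sub>R fst p) + 1 *\<^sub>R x)))"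
      proof (rule integral_mono)
        show "integrable lborel (\<lambda>x. indicator C x * ((\<zeta> x)\<^sup>2 * H (x - snd p *\<^sub>R fst p)))"
          unfolding C_def by (intro uavg_integrable cH cz continuous_intros)
        show "integrable lborel (\<lambda>x. M\<^sup>2 * (indicator C (- (snd p *\<^sub>R fst p) + 1 *\<^sub>R x) * H (- (snd p *\<^sub>R fst p) + 1 *\<^sub>R x)))"
          using lborel_integrable_affine[OF intH, of 1 "- (snd p *\<^sub>R fst p)"] by (intro integrable_mult_right) simp
        fix x
        let ?z = "x - snd p *\<^sub>R fst p"
        have H0: "0 \<le> H z" for z unfolding H_def by (simp add: sum_nonneg)
        have "indicator C x * ((\<zeta> x)\<^sup>2 * H ?z) \<le> M\<^sup>2 * (indicator C ?z * H ?z)"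
        proof (cases "\<zeta> x = 0")
          case False
          have "?z \<in> cball x r" using sh by (simp add: dist_norm)
          then have "?z \<in> C" using \<zeta>(3)[OF False] by (auto simp: C_def)
          moreover have "(\<zeta> x)\<^sup>2 \<le> M\<^sup>2" using \<zeta>(2)[of x] abs_le_square_iff[of "\<zeta> x" M] by simp
          ultimately show ?thesis using H0[of ?z] by (auto simp: indicator_def intro: mult_right_mono)
        qed (use H0 in simp)
        then show "indicator C x * ((\<zeta> x)\<^sup>2 * H ?z) \<le> M\<^sup>2 * (indicator C (- (snd p *\<^sub>R fst p) + 1 *\<^sub>R x) * H (- (snd p *\<^sub>R fst p) + 1 *\<^sub>R x))"
          by simp
      qed
      also have "\<dots> = M\<^sup>2 * uavg H"
        using lborel_integral_affine[of "\<lambda>x. indicator C x * H x" 1 "- (snd p *\<^sub>R fst p)"] C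
        unfolding uavg_def C_def by simp
      finally show ?thesis using w0[of p] by (simp add: mult_left_mono)
    qed (simp add: w_def)
  qed simp
  also have "\<dots> = M\<^sup>2 * e\<^sup>2 * uavg H" using w1 by simp
  also have "uavg H = (\<Sum>j\<in>UNIV. uavg (\<lambda>x. (partial_deriv j u x)\<^sup>2))"
    unfolding H_def by (intro uavg_sum continuous_intros cp)
  finally show ?thesis .
qed

subsection \<open>Mollified gradients and cutoff functions\<close>

text \<open>The points at which a kernel of support radius at most \<open>r\<close> does not notice
  that functions are cut off outside the unit cube.\<close>

definition core :: "real \<Rightarrow> (real^'n::finite) set" where
  "core r = {x. cball x r \<subseteq> unit_cube}"

text \<open>Written as an intersection of translates of the cube, the core inherits closedness and
  convexity.\<close>

lemma core_eq_Inter: "core r = (\<Inter>d\<in>cball 0 r. (\<lambda>x. - d + x) ` unit_cube)"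
proof (intro set_eqI iffI INT_I)
  fix x d :: "real^'n" assume "x \<in> core r" "d \<in> cball 0 r"
  then have "d + x \<in> unit_cube" by (auto simp: core_def dist_norm)
  then show "x \<in> (\<lambda>x. - d + x) ` unit_cube" by (rule rev_image_eqI) simp
next
  fix x :: "real^'n" assume *: "x \<in> (\<Inter>d\<in>cball 0 r. (\<lambda>x. - d + x) ` unit_cube)"
  have "y \<in> unit_cube" if "y \<in> cball x r" for y
  proof -
    have "y - x \<in> cball 0 r" using that by (simp add: dist_norm norm_minus_commute)
    with * have "x \<in> (\<lambda>z. - (y - x) + z) ` unit_cube" by blast
    then show ?thesis by auto
  qed
  then show "x \<in> core r" by (auto simp: core_def)
qed

lemma closed_core: "closed (core r)"
  unfolding core_eq_Inter
  by (intro closed_INT ballI closed_translation compact_imp_closed compact_unit_cube)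

lemma convex_core: "convex (core r)"
  unfolding core_eq_Inter by (intro convex_INT convex_translation convex_unit_cube)

lemma core_in_unit_cube: "x \<in> core r \<Longrightarrow> dist x z \<le> r \<Longrightarrow> z \<in> unit_cube"
  unfolding core_def by auto

section \<open>Convolutions of functions truncated to the unit cube\<close>

lemma partial_support:
  assumes "\<And>y. \<psi> y \<noteq> 0 \<Longrightarrow> y \<in> S" "closed S" "partial_deriv j \<psi> y \<noteq> 0"
  shows "y \<in> S"
proof (rule ccontr)
  assume "y \<notin> S"
  then have "partial_deriv j \<psi> y = 0"
    using assms by (intro partial_deriv_eq_0[of "- S" y \<psi> 0]) auto
  with assms(3) show False by simp
qed

text \<open>No boundary term arises although the truncation is discontinuous: for \<open>x\<close>
  in the core, the reflected kernel is supported inside the cube, so both truncations may be dropped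
  before integrating by parts.\<close>

lemma convolve_partial_unit_cube:
  fixes u :: "real^'n::finite \<Rightarrow> real"
  assumes u: "smooth u" and \<psi>: "test_function UNIV \<psi>" "\<And>y. \<psi> y \<noteq> 0 \<Longrightarrow> norm y \<le> r" and x: "x \<in> core r"
  shows "convolve (\<lambda>z. indicator unit_cube z * partial_deriv j u z) \<psi> x =
    convolve (\<lambda>z. indicator unit_cube z * u z) (partial_deriv j \<psi>) x"
proof -
  have in1: "indicator unit_cube z * a * \<psi> (x - z) = a * \<psi> (x - z)" for z and a :: real
    using core_in_unit_cube[OF x, of z] \<psi>(2)[of "x - z"] by (cases "\<psi> (x - z) = 0") (auto simp: dist_norm)
  have in2: "indicator unit_cube z * a * partial_deriv j \<psi> (x - z) = a * partial_deriv j \<psi> (x - z)" for z and a :: real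
    using core_in_unit_cube[OF x, of z] partial_support[of \<psi> "cball 0 r" j "x - z"] \<psi>(2)
    by (cases "partial_deriv j \<psi> (x - z) = 0") (auto simp: dist_norm norm_minus_commute[of z x])
  have "convolve (\<lambda>z. indicator unit_cube z * u z) (partial_deriv j \<psi>) x = (LINT z|lborel. u z * partial_deriv j \<psi> (x - z))"
    unfolding convolve_def in2 ..
  also have "\<dots> = - (LINT z|lborel. u z * partial_deriv j (\<lambda>z. \<psi> (x - z)) z)"
    by (simp add: partial_smooth_reflect[OF test_function_smooth[OF \<psi>(1)]])
  also have "\<dots> = (LINT z|lborel. partial_deriv j u z * \<psi> (x - z))"
    using integral_by_parts[OF test_function_reflect[OF \<psi>(1)] u] by simp
  also have "\<dots> = convolve (\<lambda>z. indicator unit_cube z * partial_deriv j u z) \<psi> x"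
    unfolding convolve_def in1 ..
  finally show ?thesis by simp
qed

lemma convolve_unit_cube_bound:
  fixes f :: "real^'n::finite \<Rightarrow> real"
  assumes f: "continuous_on unit_cube f" and \<psi>: "test_function UNIV \<psi>" "\<And>y. \<bar>\<psi> y\<bar> \<le> M"
  shows "\<bar>convolve (\<lambda>z. indicator unit_cube z * f z) \<psi> x\<bar> \<le> M * uavg (\<lambda>z. \<bar>f z\<bar>)"
proof -
  have "\<bar>convolve (\<lambda>z. indicator unit_cube z * f z) \<psi> x\<bar> \<le> (LINT z|lborel. M * (indicator unit_cube z * \<bar>f z\<bar>))"
    unfolding convolve_def
  proof (rule integral_abs_bound_integral)
    show "integrable lborel (\<lambda>z. indicator unit_cube z * f z * \<psi> (x - z))"
      by (rule integrable_convolve[OF uavg_integrable[OF f] \<psi>(1)])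
    show "integrable lborel (\<lambda>z. M * (indicator unit_cube z * \<bar>f z\<bar>))"
      using uavg_integrable[OF continuous_on_rabs[OF f]] by simp
    show "\<bar>indicator unit_cube z * f z * \<psi> (x - z)\<bar> \<le> M * (indicator unit_cube z * \<bar>f z\<bar>)" for z
      using mult_right_mono[OF \<psi>(2)[of "x - z"], of "\<bar>f z\<bar>"] by (simp add: indicator_def abs_mult mult.commute)
  qed
  then show ?thesis by (simp add: uavg_def)
qed

lemma convolve_half_sum:
  assumes "integrable lborel f" "integrable lborel g" "test_function UNIV \<psi>"
  shows "convolve (\<lambda>z. (f z + g z) / 2) \<psi> x = (convolve f \<psi> x + convolve g \<psi> x) / 2"
  using integrable_convolve[OF assms(1,3), of x] integrable_convolve[OF assms(2,3), of x]
  unfolding convolve_def by (simp add: add_divide_distrib distrib_right)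

text \<open>The classical identity \<open>\<partial>\<^sub>k\<partial>\<^sub>ju\<^sub>i = \<partial>\<^sub>kE\<^sub>i\<^sub>j + \<partial>\<^sub>jE\<^sub>i\<^sub>k - \<partial>\<^sub>iE\<^sub>j\<^sub>k\<close>: after mollification, the derivatives
  of the gradient are controlled by the symmetric part alone.\<close>

lemma mollified_gradient_variation:
  fixes u :: "'n::finite \<Rightarrow> real^'n \<Rightarrow> real" and i j :: 'n
  assumes u: "\<And>i. smooth (u i)" and \<eta>: "test_function UNIV \<eta>" "\<And>y. \<eta> y \<noteq> 0 \<Longrightarrow> norm y \<le> r"
    and M: "\<And>k y. \<bar>partial_deriv k \<eta> y\<bar> \<le> M"
    and r: "0 \<le> r" and x: "x \<in> core r" and y: "y \<in> core r"
  defines "S \<equiv> \<Sum>a\<in>UNIV. \<Sum>b\<in>UNIV. uavg (\<lambda>x. \<bar>sym_grad u a b x\<bar>)"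
  defines "G \<equiv> convolve (\<lambda>z. indicator unit_cube z * partial_deriv j (u i) z) \<eta>"
  shows "\<bar>G x - G y\<bar> \<le> real CARD('n) * (3 * M * S) * real CARD('n)"
proof -
  define W where "W a b z = indicator unit_cube z * partial_deriv b (u a) z" for a b z
  define E where "E a b z = sym_grad u a b z" for a b z
  define I where "I a b k z = convolve (W a b) (partial_deriv k \<eta>) z" for a b k z
  have cp: "continuous_on T (partial_deriv b (u a))" for T a b
    by (intro smooth_continuous smooth_partial u)
  have Wi: "integrable lborel (W a b)" for a b
    unfolding W_def by (intro uavg_integrable cp)
  have cE: "continuous_on T (E a b)" for T a b
    unfolding E_def by (intro continuous_intros cp) auto
  have M0: "0 \<le> M" using M[of undefined 0] by linarith
  have tk: "test_function UNIV (partial_deriv k \<eta>)" for k by (rule test_function_partial[OF \<eta>(1)])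
  have sk: "norm y \<le> r" if "partial_deriv k \<eta> y \<noteq> 0" for k y
    using partial_support[of \<eta> "cball 0 r" k y] \<eta>(2) that by auto
  \<comment> \<open>With both derivatives moved to \<open>\<eta>\<close>, their order is immaterial,
    so the last two indices can be exchanged.\<close>
  have I_sym: "I a b k z = I a k b z" if "z \<in> core r" for a b k z
  proof -
    have "I a b k z = convolve (\<lambda>z. indicator unit_cube z * u a z) (partial_deriv b (partial_deriv k \<eta>)) z"
      unfolding I_def W_def[abs_def] by (rule convolve_partial_unit_cube[OF u tk sk that])
    also have "partial_deriv b (partial_deriv k \<eta>) = partial_deriv k (partial_deriv b \<eta>)"
      using smooth_partial_commute[OF test_function_smooth[OF \<eta>(1)]] by blast
    also have "convolve (\<lambda>z. indicator unit_cube z * u a z) (partial_deriv k (partial_deriv b \<eta>)) z = I a k b z"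
      unfolding I_def W_def[abs_def] by (rule convolve_partial_unit_cube[OF u tk sk that, symmetric])
    finally show ?thesis .
  qed
  have e_bound: "\<bar>(I a b k z + I b a k z) / 2\<bar> \<le> M * S" for a b k z
  proof -
    have "(I a b k z + I b a k z) / 2 = convolve (\<lambda>z. indicator unit_cube z * E a b z) (partial_deriv k \<eta>) z"
      unfolding I_def convolve_half_sum[OF Wi Wi tk, symmetric] by (simp add: W_def E_def algebra_simps add_divide_distrib)
    also have "\<bar>\<dots>\<bar> \<le> M * uavg (\<lambda>z. \<bar>E a b z\<bar>)"
      by (rule convolve_unit_cube_bound[OF cE tk M])
    also have "uavg (\<lambda>z. \<bar>E a b z\<bar>) \<le> (\<Sum>b\<in>UNIV. uavg (\<lambda>z. \<bar>E a b z\<bar>))"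
      by (rule member_le_sum) (auto intro: uavg_nonneg)
    also have "\<dots> \<le> (\<Sum>a\<in>UNIV. \<Sum>b\<in>UNIV. uavg (\<lambda>z. \<bar>E a b z\<bar>))"
      by (rule member_le_sum) (auto intro!: uavg_nonneg sum_nonneg)
    finally show ?thesis using M0 unfolding S_def E_def by (simp add: mult_left_mono)
  qed
  have "\<bar>partial_deriv k G z\<bar> \<le> 3 * M * S" if z: "z \<in> core r" for k z
  proof -
    have "partial_deriv k G z = I i j k z"
      using partial_deriv_convolve[OF Wi \<eta>(1), of k i j z] unfolding G_def I_def W_def[abs_def] .
    also have "\<dots> = (I i j k z + I j i k z) / 2 + (I i k j z + I k i j z) / 2 - (I j k i z + I k j i z) / 2"
      using I_sym[OF z, of i k j] I_sym[OF z, of j k i] I_sym[OF z, of k j i] by (simp add: field_simps)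
    also have "\<bar>\<dots>\<bar> \<le> 3 * (M * S)"
      using e_bound[of i j k z] e_bound[of i k j z] e_bound[of j k i z] by linarith
    finally show ?thesis by simp
  qed
  moreover have "smooth G"
    unfolding G_def using smooth_convolve[OF Wi \<eta>(1), of i j] unfolding W_def[abs_def] .
  \<comment> \<open>The derivative bound holds only in the core; its convexity permits the mean
    value inequality there.\<close>
  ultimately have "\<bar>G x - G y\<bar> \<le> real CARD('n) * (3 * M * S) * norm (x - y)"
    by (intro smooth_bound_on_convex[OF _ convex_core[of r]] x y)
  also have "\<dots> \<le> real CARD('n) * (3 * M * S) * real CARD('n)"
  proof (rule mult_left_mono)
    show "norm (x - y) \<le> real CARD('n)"
      using x y r by (intro dist_unit_cube_le) (auto intro: core_in_unit_cube)
    have "0 \<le> S" unfolding S_def by (intro sum_nonneg uavg_nonneg) auto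
    then show "0 \<le> real CARD('n) * (3 * M * S)" using M0 by simp
  qed
  finally show ?thesis .
qed

text \<open>Mollify the indicator of the cube shrunk by \<open>s\<close> with a kernel of radius
  \<open>s/2\<close>: the result is 1 on the cube shrunk by \<open>2 * s\<close> and is supported in
  the core of radius \<open>s/2\<close>. The remaining layer has volume
  \<open>1 - (1 - 4 * s) ^ CARD('n)\<close>, which Bernoulli's inequality bounds by
  \<open>4 * s * CARD('n)\<close>.\<close>

lemma cutoff_exists:
  assumes "\<theta> > 0"
  shows "\<exists>(\<kappa> :: real^'n::finite \<Rightarrow> real) r. test_function UNIV \<kappa> \<and> (\<forall>x. 0 \<le> \<kappa> x \<and> \<kappa> x \<le> 1) \<and>
    0 < r \<and> (\<forall>x. \<kappa> x \<noteq> 0 \<longrightarrow> x \<in> core r) \<and> uavg (\<lambda>x. (1 - \<kappa> x)\<^sup>2) \<le> \<theta>"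
proof -
  let ?n = "real CARD('n)"
  \<comment> \<open>The bound 1/8 keeps the twice shrunk cube nondegenerate; the other one makes the
    layer smaller than \<open>\<theta>\<close>.\<close>
  define s where "s = min (1/8) (\<theta> / (4 * ?n))"
  have s: "0 < s" "s \<le> 1/8" "4 * s * ?n \<le> \<theta>"
    using assms by (auto simp: s_def min_def field_simps)
  obtain \<eta> :: "real^'n \<Rightarrow> real" where \<eta>: "test_function UNIV \<eta>" "\<And>x. 0 \<le> \<eta> x" "\<And>x. norm x \<ge> s/2 \<Longrightarrow> \<eta> x = 0" "(LINT x|lborel. \<eta> x) = 1"
    using mollifier_exists[of "s/2"] s(1) by auto
  define B :: "real \<Rightarrow> (real^'n) set" where "B t = cbox (\<chi> i. t) (\<chi> i. 1 - t)" for t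
  have memB: "x \<in> B t \<longleftrightarrow> (\<forall>i. t \<le> x $ i \<and> x $ i \<le> 1 - t)" for x t
    by (simp add: B_def mem_box_cart)
  have [measurable]: "B t \<in> sets borel" for t by (simp add: B_def)
  have intB: "integrable lborel (indicator (B t) :: real^'n \<Rightarrow> real)" for t
    unfolding B_def by (intro integrable_real_indicator) (use emeasure_lborel_cbox_finite in auto)
  define \<kappa> :: "real^'n \<Rightarrow> real" where "\<kappa> = convolve (indicator (B s)) \<eta>"
  have comp: "\<bar>x $ i - z $ i\<bar> \<le> norm (x - z)" for x z :: "real^'n" and i
    using component_le_norm_cart[of "x - z" i] by simp
  have one: "(LINT z|lborel. \<eta> (x - z)) = 1" for x
    using \<eta>(4) convolve_flip[of "\<lambda>_. 1" \<eta> x] smooth_continuous[OF test_function_smooth[OF \<eta>(1)], of UNIV]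
    by (simp add: convolve_def borel_measurable_continuous_onI)
  note int\<eta> = integrable_test_function[OF test_function_reflect[OF \<eta>(1)]]
  note intc = integrable_convolve[OF intB \<eta>(1)]
  have c0: "0 \<le> \<kappa> x" for x
    unfolding \<kappa>_def convolve_def using \<eta>(2) by (intro Bochner_Integration.integral_nonneg) auto
  have c1: "\<kappa> x \<le> 1" for x
  proof -
    have "\<kappa> x \<le> (LINT z|lborel. \<eta> (x - z))"
      unfolding \<kappa>_def convolve_def using \<eta>(2) by (intro integral_mono intc int\<eta>) (auto simp: indicator_def)
    then show ?thesis using one by simp
  qed
  have supp: "x \<in> core (s/2)" if "\<kappa> x \<noteq> 0" for x
  proof -
    have "\<exists>z. indicator (B s) z * \<eta> (x - z) \<noteq> 0"
    proof (rule ccontr)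
      assume "\<not> ?thesis"
      then have "(\<lambda>z. indicator (B s) z * \<eta> (x - z)) = (\<lambda>z. 0)" by blast
      then show False using that unfolding \<kappa>_def convolve_def by simp
    qed
    then obtain z where z: "z \<in> B s" "\<eta> (x - z) \<noteq> 0" by (auto simp: indicator_def split: if_splits)
    then have nz: "norm (x - z) < s/2" using \<eta>(3)[of "x - z"] by force
    show ?thesis unfolding core_def
    proof safe
      fix y assume "y \<in> cball x (s/2)"
      then have "norm (x - y) \<le> s/2" by (simp add: dist_norm)
      then have "\<bar>y $ i - z $ i\<bar> \<le> s" for i
        using comp[of x i y] comp[of x i z] nz by linarith
      then show "y \<in> unit_cube" using z(1) unfolding memB mem_unit_cube by (smt (verit))
    qed
  qed
  have c_eq: "\<kappa> x = 1" if x: "x \<in> B (2 * s)" for x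
  proof -
    have eq: "indicator (B s) z * \<eta> (x - z) = \<eta> (x - z)" for z
    proof (cases "\<eta> (x - z) = 0")
      case False
      then have "norm (x - z) < s/2" using \<eta>(3)[of "x - z"] by force
      then have "\<bar>x $ i - z $ i\<bar> \<le> s" for i using comp[of x i z] s(1) by linarith
      then have "z \<in> B s" using x unfolding memB by (smt (verit))
      then show ?thesis by simp
    qed simp
    show ?thesis using one[of x] unfolding \<kappa>_def convolve_def eq .
  qed
  have sm: "smooth \<kappa>" unfolding \<kappa>_def by (rule smooth_convolve[OF intB \<eta>(1)])
  have "core (s/2) \<subseteq> (unit_cube :: (real^'n) set)"
    using s(1) core_in_unit_cube[of _ "s/2"] by (metis dist_self half_gt_zero less_imp_le subsetI)
  then have "{x. \<kappa> x \<noteq> 0} \<subseteq> unit_cube" using supp by blast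
  then have test: "test_function UNIV \<kappa>"
    using sm compact_imp_bounded[OF compact_unit_cube] bounded_subset unfolding test_function_UNIV_iff by blast
  have "uavg (\<lambda>x. (1 - \<kappa> x)\<^sup>2) \<le> (LINT x|lborel. indicator unit_cube x - indicator (B (2 * s)) x)"
    unfolding uavg_def
  proof (rule integral_mono)
    show "integrable lborel (\<lambda>x. indicator unit_cube x * (1 - \<kappa> x)\<^sup>2)"
      by (intro uavg_integrable continuous_intros smooth_continuous sm)
    show "integrable lborel (\<lambda>x. indicator unit_cube x - indicator (B (2 * s)) x :: real)"
      using uavg_integrable[of "\<lambda>_::real^'n. 1"] intB by simp
    fix x
    have "B (2 * s) \<subseteq> unit_cube"
      using s by (auto simp: memB mem_unit_cube) (smt (verit))+
    moreover have "(1 - \<kappa> x)\<^sup>2 \<le> 1" using c0[of x] c1[of x] by (simp add: power_le_one)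
    ultimately show "indicator unit_cube x * (1 - \<kappa> x)\<^sup>2 \<le> indicator unit_cube x - indicator (B (2 * s)) x"
      using c_eq[of x] by (auto simp: indicator_def)
  qed
  also have "\<dots> = 1 - measure lborel (B (2 * s))"
    using uavg_integrable[of "\<lambda>_::real^'n. 1"] intB[of "2 * s"] uavg_const[of 1, where 'n='n] unfolding uavg_def by simp
  also have "measure lborel (B (2 * s)) = (1 - 4 * s) ^ CARD('n)"
    unfolding B_def using s by (subst content_cbox_cart) (auto simp: interval_ne_empty_cart)
  also have "1 - (1 - 4 * s) ^ CARD('n) \<le> \<theta>"
    using Bernoulli_inequality[of "- (4 * s)" "CARD('n)"] s by (simp add: mult.commute)
  finally have "uavg (\<lambda>x. (1 - \<kappa> x)\<^sup>2) \<le> \<theta>" .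
  then show ?thesis using test c0 c1 supp s(1) by (intro exI[of _ \<kappa>] exI[of _ "s/2"]) auto
qed

subsection \<open>An interior form of Korn's inequality\<close>

lemma integral_eq_uavg: "(\<And>x. x \<notin> unit_cube \<Longrightarrow> f x = 0) \<Longrightarrow> (LINT x|lborel. f x) = uavg f"
  unfolding uavg_def by (intro Bochner_Integration.integral_cong) (auto simp: indicator_def)

lemma sum_le_double_sum:
  fixes f :: "'a::finite \<Rightarrow> 'b::finite \<Rightarrow> real"
  assumes "\<And>a b. 0 \<le> f a b"
  shows "f i j \<le> (\<Sum>a\<in>UNIV. \<Sum>b\<in>UNIV. f a b)"
proof -
  have "f i j \<le> (\<Sum>b\<in>UNIV. f i b)" by (rule member_le_sum) (auto simp: assms)
  also have "\<dots> \<le> (\<Sum>a\<in>UNIV. \<Sum>b\<in>UNIV. f a b)"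
    by (rule member_le_sum) (auto simp: assms sum_nonneg)
  finally show ?thesis .
qed

lemma double_sum_square_le:
  fixes f :: "'n::finite \<Rightarrow> 'n \<Rightarrow> real"
  shows "(\<Sum>a\<in>UNIV. \<Sum>b\<in>UNIV. f a b)\<^sup>2 \<le> (real CARD('n))\<^sup>2 * (\<Sum>a\<in>UNIV. \<Sum>b\<in>UNIV. (f a b)\<^sup>2)"
  using sum_squared_le_sum_of_squares[of "\<lambda>(a, b). f a b" "UNIV :: ('n \<times> 'n) set"]
  unfolding UNIV_Times_UNIV[symmetric] sum.cartesian_product[symmetric]
  by (simp add: case_prod_unfold sum.cartesian_product card_cartesian_product power2_eq_square mult_ac)

abbreviation grad_energy :: "('n::finite \<Rightarrow> real^'n \<Rightarrow> real) \<Rightarrow> real" where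
  "grad_energy u \<equiv> \<Sum>a\<in>UNIV. \<Sum>b\<in>UNIV. uavg (\<lambda>x. (partial_deriv b (u a) x)\<^sup>2)"

abbreviation sym_energy :: "('n::finite \<Rightarrow> real^'n \<Rightarrow> real) \<Rightarrow> real" where
  "sym_energy u \<equiv> \<Sum>a\<in>UNIV. \<Sum>b\<in>UNIV. uavg (\<lambda>x. (sym_grad u a b x)\<^sup>2)"

text \<open>The order of the quantifiers is the point: \<open>C1\<close> is fixed before
  \<open>e\<close>, whereas \<open>C2\<close> may grow as \<open>e\<close> shrinks. The constants
  \<open>c i j\<close> are the values of the mollified gradient at one point of the core.\<close>

lemma korn_interior:
  fixes \<kappa> :: "real^'n::finite \<Rightarrow> real"
  assumes \<kappa>: "test_function UNIV \<kappa>" "\<And>x. 0 \<le> \<kappa> x" "\<And>x. \<kappa> x \<le> 1" "\<And>x. \<kappa> x \<noteq> 0 \<Longrightarrow> x \<in> core r"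
  shows "\<exists>C1>0. \<forall>e. 0 < e \<and> e < r \<longrightarrow> (\<exists>C2>0. \<forall>u :: 'n \<Rightarrow> real^'n \<Rightarrow> real. (\<forall>i. smooth (u i)) \<longrightarrow>
    (\<exists>c. \<forall>i j. uavg (\<lambda>x. (\<kappa> x * (partial_deriv j (u i) x - c i j))\<^sup>2) \<le>
      C2 * sym_energy u +
      C1 * e\<^sup>2 * grad_energy u))"
proof -
  let ?n = "real CARD('n)"
  obtain Mk where Mk: "Mk > 0" "\<And>j x. \<bar>partial_deriv j \<kappa> x\<bar> \<le> Mk"
    using test_functions_uniformly_bounded[of UNIV "\<lambda>j. partial_deriv j \<kappa>"] test_function_partial[OF \<kappa>(1)] by blast
  \<comment> \<open>Three times the \<open>4 * n\<close> of \<open>gradv\<close>, with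
    \<open>n\<close> the dimension, plus 3 for the term with the gradient of the cutoff; the factor
    3 comes from squaring a sum of three terms.\<close>
  define C1 where "C1 = 12 * ?n * Mk\<^sup>2 + 3 * Mk\<^sup>2"
  have "C1 > 0" using Mk(1) by (auto simp: C1_def intro!: add_nonneg_pos)
  moreover have "\<exists>C2>0. \<forall>u :: 'n \<Rightarrow> real^'n \<Rightarrow> real. (\<forall>i. smooth (u i)) \<longrightarrow>
    (\<exists>c. \<forall>i j. uavg (\<lambda>x. (\<kappa> x * (partial_deriv j (u i) x - c i j))\<^sup>2) \<le>
      C2 * sym_energy u +
      C1 * e\<^sup>2 * grad_energy u)"
    if e: "0 < e" "e < r" for e
  proof -
    obtain \<eta> :: "real^'n \<Rightarrow> real" where \<eta>: "test_function UNIV \<eta>" "\<And>x. 0 \<le> \<eta> x" "\<And>x. norm x \<ge> e \<Longrightarrow> \<eta> x = 0" "(LINT x|lborel. \<eta> x) = 1"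
      using mollifier_exists[OF e(1)] by auto
    have supp: "norm y \<le> e" if "\<eta> y \<noteq> 0" for y using \<eta>(3)[of y] that by force
    have suppr: "norm y \<le> r" if "\<eta> y \<noteq> 0" for y using supp[OF that] e by simp
    obtain M1 where M1: "M1 > 0" "\<And>x. \<bar>\<eta> x\<bar> \<le> M1" using test_function_bounded[OF \<eta>(1)] by blast
    obtain M2 where M2: "M2 > 0" "\<And>j x. \<bar>partial_deriv j \<eta> x\<bar> \<le> M2"
      using test_functions_uniformly_bounded[of UNIV "\<lambda>j. partial_deriv j \<eta>"] test_function_partial[OF \<eta>(1)] by blast
    \<comment> \<open>Three times the \<open>2 * (4 + 4 * M1\<^sup>2)\<close> of
      \<open>gradv\<close>, plus three times the \<open>9 * M2\<^sup>2 * n ^ 6\<close> of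
      \<open>var\<close>. Both \<open>M1\<close> and \<open>M2\<close> depend on \<open>e\<close>
      through the mollifier.\<close>
    define C2 where "C2 = 24 + 24 * M1\<^sup>2 + 27 * M2\<^sup>2 * ?n ^ 6"
    have "C2 > 0" by (auto simp: C2_def intro!: add_pos_nonneg)
    moreover have "\<exists>c. \<forall>i j. uavg (\<lambda>x. (\<kappa> x * (partial_deriv j (u i) x - c i j))\<^sup>2) \<le>
      C2 * sym_energy u +
      C1 * e\<^sup>2 * grad_energy u"
      if u: "\<And>i. smooth (u i)" for u :: "'n \<Rightarrow> real^'n \<Rightarrow> real"
    proof -
      define g where "g i j = partial_deriv j (u i)" for i j
      define E where "E i j x = (g i j x + g j i x) / 2" for i j x
      define S2 where "S2 = (\<Sum>a\<in>UNIV. \<Sum>b\<in>UNIV. uavg (\<lambda>x. (E a b x)\<^sup>2))"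
      define g2 where "g2 = (\<Sum>a\<in>UNIV. \<Sum>b\<in>UNIV. uavg (\<lambda>x. (g a b x)\<^sup>2))"
      define W where "W i = (\<lambda>z. indicator unit_cube z * u i z)" for i
      define m where "m i = convolve (W i) \<eta>" for i
      define mg where "mg i j = convolve (\<lambda>z. indicator unit_cube z * g i j z) \<eta>" for i j
      define d where "d i x = u i x - m i x" for i x
      define v where "v i x = \<kappa> x * d i x" for i x
      have sg: "smooth (g i j)" for i j unfolding g_def by (rule smooth_partial[OF u])
      have iW: "integrable lborel (W i)" for i
        unfolding W_def by (rule uavg_integrable[OF smooth_continuous[OF u]])
      have ig: "integrable lborel (\<lambda>z. indicator unit_cube z * g i j z)" for i j
        by (rule uavg_integrable[OF smooth_continuous[OF sg]])
      have sm: "smooth (m i)" for i unfolding m_def by (rule smooth_convolve[OF iW \<eta>(1)])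
      have smg: "smooth (mg i j)" for i j unfolding mg_def by (rule smooth_convolve[OF ig \<eta>(1)])
      have sd: "smooth (d i)" for i using smooth_diff[OF u sm, of i i] unfolding d_def[abs_def] .
      have tv: "test_function UNIV (v i)" for i
        using test_function_mult[OF \<kappa>(1) sd, of i] unfolding v_def[abs_def] .
      note s\<kappa> = test_function_smooth[OF \<kappa>(1)]
      note cont = smooth_continuous[OF sg] smooth_continuous[OF smg] smooth_continuous[OF sd]
        smooth_continuous[OF s\<kappa>] smooth_continuous[OF smooth_partial[OF s\<kappa>]]
        smooth_continuous[OF smooth_partial[OF test_function_smooth[OF tv]]]
      have cE: "continuous_on T (E i j)" for T i j
        unfolding E_def by (intro continuous_intros cont) auto
      have mgrad: "partial_deriv j (m i) x = mg i j x" if "x \<in> core r" for i j x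
        using convolve_partial_unit_cube[OF u \<eta>(1) suppr that, of j i]
          partial_deriv_convolve[OF iW \<eta>(1), of j i x] unfolding m_def mg_def W_def g_def by simp
      have k\<kappa>: "\<kappa> x * partial_deriv j (m i) x = \<kappa> x * mg i j x" for i j x
        using mgrad[of x j i] \<kappa>(4)[of x] by auto
      \<comment> \<open>On the support of the cutoff, the derivative of the mollified map is the
        mollified derivative, so \<open>mg\<close> may be written for it.\<close>
      have dv: "partial_deriv j (v i) x = \<kappa> x * (g i j x - mg i j x) + partial_deriv j \<kappa> x * d i x" for i j x
      proof -
        have "partial_deriv j (v i) x = \<kappa> x * partial_deriv j (d i) x + partial_deriv j \<kappa> x * d i x"
          using partial_smooth_mult[OF s\<kappa> sd, of j i x] unfolding v_def[abs_def] .
        also have "partial_deriv j (d i) x = g i j x - partial_deriv j (m i) x"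
          using partial_smooth_diff[OF u sm, of j i i x] unfolding d_def[abs_def] g_def .
        finally show ?thesis using k\<kappa>[of x j i] by (simp add: right_diff_distrib)
      qed
      have out: "partial_deriv j (v i) x = 0" if "x \<notin> unit_cube" for i j x
      proof -
        have "x \<notin> core r" using that core_in_unit_cube[of x r x] e by auto
        then show ?thesis using partial_support[of \<kappa> "core r" j x] \<kappa>(4) closed_core unfolding dv by fastforce
      qed
      define err where "err a = Mk\<^sup>2 * e\<^sup>2 * (\<Sum>j\<in>UNIV. uavg (\<lambda>x. (g a j x)\<^sup>2))" for a
      have err: "uavg (\<lambda>x. (partial_deriv b \<kappa> x * d a x)\<^sup>2) \<le> err a" for a b
        unfolding power_mult_distrib err_def g_def d_def m_def W_def
      proof (rule mollification_error[OF u \<eta>(1,2,4) supp])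
        show "e \<le> r" using e by simp
        show "continuous_on UNIV (partial_deriv b \<kappa>)" by (intro cont)
        show "\<bar>partial_deriv b \<kappa> x\<bar> \<le> Mk" for x by (rule Mk)
        show "cball x r \<subseteq> unit_cube" if "partial_deriv b \<kappa> x \<noteq> 0" for x
          using partial_support[of \<kappa> "core r" b x] \<kappa>(4) closed_core that unfolding core_def by blast
      qed
      have sum_err: "(\<Sum>a\<in>UNIV. err a) = Mk\<^sup>2 * e\<^sup>2 * g2"
        unfolding err_def g2_def by (simp add: sum_distrib_left)
      have err0: "0 \<le> err a" for a
        unfolding err_def by (intro mult_nonneg_nonneg sum_nonneg uavg_nonneg) auto
      \<comment> \<open>The mollified symmetric part is bounded pointwise by a mean of
        \<open>\<bar>E\<bar>\<close>; the kernel bound \<open>M1\<close> is the price.\<close>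
      have mE: "\<bar>(mg a b x + mg b a x) / 2\<bar> \<le> M1 * uavg (\<lambda>x. \<bar>E a b x\<bar>)" for a b x
      proof -
        have "(mg a b x + mg b a x) / 2 = convolve (\<lambda>z. indicator unit_cube z * E a b z) \<eta> x"
          unfolding mg_def convolve_half_sum[OF ig ig \<eta>(1), symmetric]
          by (simp add: E_def algebra_simps add_divide_distrib)
        then show ?thesis using convolve_unit_cube_bound[OF cE \<eta>(1) M1(2)] by simp
      qed
      have jE: "(uavg (\<lambda>x. \<bar>E a b x\<bar>))\<^sup>2 \<le> uavg (\<lambda>x. (E a b x)\<^sup>2)" for a b
        using uavg_jensen[of "\<lambda>x. \<bar>E a b x\<bar>"] cE by (simp add: continuous_on_rabs)
      \<comment> \<open>The symmetric gradient of \<open>v\<close> consists of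
        \<open>\<kappa>\<close> times \<open>E\<close> minus its mollification, and of the
        symmetrized product of the gradient of \<open>\<kappa>\<close> with \<open>d\<close>. The
        full gradient of \<open>u\<close> therefore enters only through \<open>err\<close>.\<close>
      have symv: "uavg (\<lambda>x. (sym_grad v a b x)\<^sup>2) \<le>
        (4 + 4 * M1\<^sup>2) * uavg (\<lambda>x. (E a b x)\<^sup>2) + err a + err b" for a b
      proof -
        have "(sym_grad v a b x)\<^sup>2 \<le>
          (4 * (E a b x)\<^sup>2 + 4 * M1\<^sup>2 * uavg (\<lambda>x. (E a b x)\<^sup>2)) + ((partial_deriv b \<kappa> x * d a x)\<^sup>2 + (partial_deriv a \<kappa> x * d b x)\<^sup>2)" for x
        proof -
          let ?a = "\<kappa> x * (E a b x - (mg a b x + mg b a x) / 2)"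
          let ?b = "partial_deriv b \<kappa> x * d a x" and ?c = "partial_deriv a \<kappa> x * d b x"
          have 1: "sym_grad v a b x = ?a + (?b + ?c) / 2"
            unfolding dv E_def by (simp add: field_simps)
          have 2: "(p + (q + s) / 2)\<^sup>2 \<le> 2 * p\<^sup>2 + (q\<^sup>2 + s\<^sup>2)" for p q s :: real
          proof -
            have "2 * p\<^sup>2 + (q\<^sup>2 + s\<^sup>2) - (p + (q + s) / 2)\<^sup>2 = (p - (q + s) / 2)\<^sup>2 + ((q - s)\<^sup>2) / 2"
              by (simp add: power2_eq_square field_simps)
            then show ?thesis by (smt (verit) zero_le_power2 divide_nonneg_pos)
          qed
          have "((mg a b x + mg b a x) / 2)\<^sup>2 \<le> (M1 * uavg (\<lambda>x. \<bar>E a b x\<bar>))\<^sup>2"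
            using mE[of a b x] by (metis abs_ge_zero power2_abs power_mono)
          also have "\<dots> \<le> M1\<^sup>2 * uavg (\<lambda>x. (E a b x)\<^sup>2)"
            unfolding power_mult_distrib by (intro mult_left_mono jE) simp
          finally have 3: "((mg a b x + mg b a x) / 2)\<^sup>2 \<le> M1\<^sup>2 * uavg (\<lambda>x. (E a b x)\<^sup>2)" .
          have 4: "(p - q)\<^sup>2 \<le> 2 * p\<^sup>2 + 2 * q\<^sup>2" for p q :: real
          proof -
            have "2 * p\<^sup>2 + 2 * q\<^sup>2 - (p - q)\<^sup>2 = (p + q)\<^sup>2" by (simp add: power2_eq_square algebra_simps)
            then show ?thesis by (smt (verit) zero_le_power2)
          qed
          have "?a\<^sup>2 \<le> 1 * (E a b x - (mg a b x + mg b a x) / 2)\<^sup>2"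
            unfolding power_mult_distrib using \<kappa>(2,3)[of x] by (intro mult_right_mono power_le_one) auto
          then have "?a\<^sup>2 \<le> 2 * (E a b x)\<^sup>2 + 2 * (M1\<^sup>2 * uavg (\<lambda>x. (E a b x)\<^sup>2))"
            using 3 4[of "E a b x" "(mg a b x + mg b a x) / 2"] by linarith
          then show ?thesis unfolding 1 using 2[of ?a ?b ?c] by linarith
        qed
        then have "uavg (\<lambda>x. (sym_grad v a b x)\<^sup>2) \<le>
          uavg (\<lambda>x. (4 * (E a b x)\<^sup>2 + 4 * M1\<^sup>2 * uavg (\<lambda>x. (E a b x)\<^sup>2)) + ((partial_deriv b \<kappa> x * d a x)\<^sup>2 + (partial_deriv a \<kappa> x * d b x)\<^sup>2))"
          by (intro uavg_mono continuous_intros cont cE) auto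
        also have "\<dots> = (4 * uavg (\<lambda>x. (E a b x)\<^sup>2) + 4 * M1\<^sup>2 * uavg (\<lambda>x. (E a b x)\<^sup>2)) + (uavg (\<lambda>x. (partial_deriv b \<kappa> x * d a x)\<^sup>2) + uavg (\<lambda>x. (partial_deriv a \<kappa> x * d b x)\<^sup>2))"
          by (subst uavg_add | intro continuous_intros cont cE | simp add: uavg_cmult)+
        also have "\<dots> \<le> (4 * uavg (\<lambda>x. (E a b x)\<^sup>2) + 4 * M1\<^sup>2 * uavg (\<lambda>x. (E a b x)\<^sup>2)) + (err a + err b)"
          by (intro add_left_mono add_mono err)
        finally show ?thesis by (simp add: algebra_simps)
      qed
      have gradv: "uavg (\<lambda>x. (partial_deriv j (v i) x)\<^sup>2) \<le> 2 * (4 + 4 * M1\<^sup>2) * S2 + 4 * ?n * (Mk\<^sup>2 * e\<^sup>2 * g2)" for i j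
      proof -
        have "uavg (\<lambda>x. (partial_deriv j (v i) x)\<^sup>2) \<le> (\<Sum>a\<in>UNIV. \<Sum>b\<in>UNIV. uavg (\<lambda>x. (partial_deriv b (v a) x)\<^sup>2))"
          by (rule sum_le_double_sum[of "\<lambda>a b. uavg (\<lambda>x. (partial_deriv b (v a) x)\<^sup>2)"]) (auto intro: uavg_nonneg)
        also have "\<dots> = uavg (\<lambda>x. \<Sum>a\<in>UNIV. \<Sum>b\<in>UNIV. (partial_deriv b (v a) x)\<^sup>2)"
          by (subst uavg_sum, intro continuous_intros cont, subst uavg_sum, intro continuous_intros cont, rule refl)
        also have "\<dots> = (LINT x|lborel. (\<Sum>a\<in>UNIV. \<Sum>b\<in>UNIV. (partial_deriv b (v a) x)\<^sup>2))"
          by (rule integral_eq_uavg[symmetric]) (simp add: out)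
        also have "\<dots> \<le> 2 * (LINT x|lborel. (\<Sum>a\<in>UNIV. \<Sum>b\<in>UNIV. (sym_grad v a b x)\<^sup>2))"
          by (rule korn_first_inequality[OF tv])
        also have "(LINT x|lborel. (\<Sum>a\<in>UNIV. \<Sum>b\<in>UNIV. (sym_grad v a b x)\<^sup>2)) =
          uavg (\<lambda>x. \<Sum>a\<in>UNIV. \<Sum>b\<in>UNIV. (sym_grad v a b x)\<^sup>2)"
          by (rule integral_eq_uavg) (simp add: out)
        also have "\<dots> = (\<Sum>a\<in>UNIV. \<Sum>b\<in>UNIV. uavg (\<lambda>x. (sym_grad v a b x)\<^sup>2))"
          by (subst uavg_sum, intro continuous_intros cont, simp, subst uavg_sum, intro continuous_intros cont, simp, rule refl)
        also have "\<dots> \<le> (\<Sum>a\<in>UNIV. \<Sum>b\<in>UNIV. (4 + 4 * M1\<^sup>2) * uavg (\<lambda>x. (E a b x)\<^sup>2) + err a + err b)"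
          by (intro sum_mono symv)
        also have "\<dots> = (4 + 4 * M1\<^sup>2) * S2 + 2 * ?n * (Mk\<^sup>2 * e\<^sup>2 * g2)"
          unfolding sum.distrib sum_distrib_left[symmetric] S2_def[symmetric] sum_err[symmetric]
          by (simp add: sum_distrib_left[symmetric])
        finally show ?thesis by (simp add: algebra_simps)
      qed
      \<comment> \<open>If the core is empty, then \<open>\<kappa>\<close> vanishes identically and
        the choice is immaterial.\<close>
      define x0 where "x0 = (SOME x :: real^'n. x \<in> core r)"
      define S where "S = (\<Sum>a\<in>UNIV. \<Sum>b\<in>UNIV. uavg (\<lambda>x. \<bar>E a b x\<bar>))"
      have S: "S\<^sup>2 \<le> ?n\<^sup>2 * S2"
      proof -
        have "S\<^sup>2 \<le> ?n\<^sup>2 * (\<Sum>a\<in>UNIV. \<Sum>b\<in>UNIV. (uavg (\<lambda>x. \<bar>E a b x\<bar>))\<^sup>2)"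
          unfolding S_def by (rule double_sum_square_le)
        also have "\<dots> \<le> ?n\<^sup>2 * S2" unfolding S2_def by (intro mult_left_mono sum_mono jE) auto
        finally show ?thesis .
      qed
      have var: "(\<kappa> x * (mg i j x - mg i j x0))\<^sup>2 \<le> 9 * M2\<^sup>2 * ?n ^ 6 * S2" for i j x
      proof -
        have "\<bar>\<kappa> x * (mg i j x - mg i j x0)\<bar> \<le> ?n * (3 * M2 * S) * ?n"
        proof (cases "\<kappa> x = 0")
          case False
          then have x: "x \<in> core r" by (rule \<kappa>(4))
          then have x0: "x0 \<in> core r" unfolding x0_def by (rule someI)
          have var: "\<bar>mg i j x - mg i j x0\<bar> \<le> ?n * (3 * M2 * S) * ?n"
            unfolding mg_def g_def S_def E_def
            by (rule mollified_gradient_variation[OF u \<eta>(1) suppr M2(2) _ x x0]) (use e in auto)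
          have "\<bar>\<kappa> x * (mg i j x - mg i j x0)\<bar> \<le> 1 * \<bar>mg i j x - mg i j x0\<bar>"
            unfolding abs_mult using \<kappa>(2,3)[of x] by (intro mult_right_mono) auto
          also have "\<dots> \<le> ?n * (3 * M2 * S) * ?n" using var by simp
          finally show ?thesis .
        qed (use M2(1) in \<open>auto simp: S_def intro!: mult_nonneg_nonneg sum_nonneg uavg_nonneg\<close>)
        then have "(\<kappa> x * (mg i j x - mg i j x0))\<^sup>2 \<le> (?n * (3 * M2 * S) * ?n)\<^sup>2"
          by (metis abs_ge_zero power2_abs power_mono)
        also have "\<dots> = 9 * M2\<^sup>2 * ?n ^ 4 * S\<^sup>2" by (simp add: power_mult_distrib power2_eq_square power4_eq_xxxx)
        also have "\<dots> \<le> 9 * M2\<^sup>2 * ?n ^ 4 * (?n\<^sup>2 * S2)" by (intro mult_left_mono S) auto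
        also have "\<dots> = 9 * M2\<^sup>2 * ?n ^ 6 * S2" by (simp add: power_add[symmetric, of _ 4 2, simplified] mult.assoc)
        finally show ?thesis .
      qed
      have "uavg (\<lambda>x. (\<kappa> x * (g i j x - mg i j x0))\<^sup>2) \<le> C2 * S2 + C1 * e\<^sup>2 * g2" for i j
      proof -
        have pw: "(\<kappa> x * (g i j x - mg i j x0))\<^sup>2 \<le> (3 * (partial_deriv j (v i) x)\<^sup>2 + 3 * (partial_deriv j \<kappa> x * d i x)\<^sup>2) + 3 * (9 * M2\<^sup>2 * ?n ^ 6 * S2)" for x
        proof -
          have 3: "(p - q + s)\<^sup>2 \<le> 3 * p\<^sup>2 + 3 * q\<^sup>2 + 3 * s\<^sup>2" for p q s :: real
          proof -
            have "3 * p\<^sup>2 + 3 * q\<^sup>2 + 3 * s\<^sup>2 - (p - q + s)\<^sup>2 = (p + q)\<^sup>2 + (p - s)\<^sup>2 + (q + s)\<^sup>2"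
              by (simp add: power2_eq_square algebra_simps)
            then show ?thesis by (smt (verit) zero_le_power2)
          qed
          \<comment> \<open>The three terms are controlled by Korn's inequality for
            \<open>v\<close>, by the mollification error, and by the near constancy of the mollified
            gradient.\<close>
          have eq: "\<kappa> x * (g i j x - mg i j x0) = partial_deriv j (v i) x - partial_deriv j \<kappa> x * d i x + \<kappa> x * (mg i j x - mg i j x0)"
            unfolding dv by (simp add: algebra_simps)
          show ?thesis
            unfolding eq using 3[of "partial_deriv j (v i) x" "partial_deriv j \<kappa> x * d i x" "\<kappa> x * (mg i j x - mg i j x0)"]
              mult_left_mono[OF var[of x i j], of 3] by (intro order.trans[OF 3]) simp
        qed
        have "uavg (\<lambda>x. (\<kappa> x * (g i j x - mg i j x0))\<^sup>2) \<le> uavg (\<lambda>x. (3 * (partial_deriv j (v i) x)\<^sup>2 + 3 * (partial_deriv j \<kappa> x * d i x)\<^sup>2) + 3 * (9 * M2\<^sup>2 * ?n ^ 6 * S2))"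
          using pw by (intro uavg_mono continuous_intros cont) auto
        also have "\<dots> = (3 * uavg (\<lambda>x. (partial_deriv j (v i) x)\<^sup>2) + 3 * uavg (\<lambda>x. (partial_deriv j \<kappa> x * d i x)\<^sup>2)) + 3 * (9 * M2\<^sup>2 * ?n ^ 6 * S2)"
          by (subst uavg_add | intro continuous_intros cont | simp add: uavg_cmult)+
        also have "\<dots> \<le> (3 * (2 * (4 + 4 * M1\<^sup>2) * S2 + 4 * ?n * (Mk\<^sup>2 * e\<^sup>2 * g2)) + 3 * (Mk\<^sup>2 * e\<^sup>2 * g2)) + 3 * (9 * M2\<^sup>2 * ?n ^ 6 * S2)"
        proof (intro add_right_mono add_mono mult_left_mono gradv)
          have "err i \<le> (\<Sum>a\<in>UNIV. err a)" by (rule member_le_sum) (auto simp: err0)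
          then show "uavg (\<lambda>x. (partial_deriv j \<kappa> x * d i x)\<^sup>2) \<le> Mk\<^sup>2 * e\<^sup>2 * g2"
            using err[of j i] unfolding sum_err by linarith
        qed auto
        also have "\<dots> = C2 * S2 + C1 * e\<^sup>2 * g2"
          unfolding C1_def C2_def by (simp add: algebra_simps)
        finally show ?thesis .
      qed
      then show ?thesis unfolding g_def S2_def E_def g2_def by (intro exI[of _ "\<lambda>i j. mg i j x0"]) (auto simp: g_def)
    qed
    ultimately show ?thesis by blast
  qed
  ultimately show ?thesis by blast
qed

subsection \<open>The a priori estimate for smooth maps\<close>

text \<open>Young's inequality; the weight \<open>t\<close> is left free so that both resulting
  terms can be balanced without square roots.\<close>

lemma uavg_mult_le:
  fixes p q :: "real^'n::finite \<Rightarrow> real"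
  assumes "continuous_on unit_cube p" "continuous_on unit_cube q" "t > 0"
  shows "uavg (\<lambda>x. p x * q x) \<le> (t * uavg (\<lambda>x. (p x)\<^sup>2) + uavg (\<lambda>x. (q x)\<^sup>2) / t) / 2"
proof -
  have "uavg (\<lambda>x. p x * q x) \<le> uavg (\<lambda>x. (t/2) * (p x)\<^sup>2 + (1/(2*t)) * (q x)\<^sup>2)"
  proof (intro uavg_mono continuous_intros assms)
    fix x
    have "0 \<le> (t * p x - q x)\<^sup>2" by simp
    then show "p x * q x \<le> (t/2) * (p x)\<^sup>2 + (1/(2*t)) * (q x)\<^sup>2"
      using assms(3) by (simp add: field_simps power2_eq_square)
  qed
  also have "\<dots> = (t/2) * uavg (\<lambda>x. (p x)\<^sup>2) + (1/(2*t)) * uavg (\<lambda>x. (q x)\<^sup>2)"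
    by (subst uavg_add, (intro continuous_intros assms)+) (simp only: uavg_cmult)
  finally show ?thesis by (simp add: field_simps)
qed

text \<open>If \<open>f\<close> has mean zero, the constant \<open>c\<close> is controlled by \<open>\<integral>\<kappa>c = \<integral>\<kappa>(c - f) - \<integral>(1 - \<kappa>)f\<close>.\<close>

lemma uavg_abs_split:
  fixes f \<kappa> :: "real^'n::finite \<Rightarrow> real"
  assumes f: "continuous_on unit_cube f" and \<kappa>: "continuous_on unit_cube \<kappa>" "\<And>x. 0 \<le> \<kappa> x" "\<And>x. \<kappa> x \<le> 1"
    and "uavg f = 0"
  shows "uavg (\<lambda>x. \<bar>f x\<bar>) \<le> 2 * uavg (\<lambda>x. \<bar>\<kappa> x * (f x - c)\<bar>) + 2 * uavg (\<lambda>x. (1 - \<kappa> x) * \<bar>f x\<bar>)"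
proof -
  note ci = continuous_intros f \<kappa>(1)
  let ?I = "uavg (\<lambda>x. \<bar>\<kappa> x * (f x - c)\<bar>)" and ?J = "uavg (\<lambda>x. (1 - \<kappa> x) * \<bar>f x\<bar>)"
  have "uavg (\<lambda>x. \<bar>f x\<bar>) \<le> uavg (\<lambda>x. \<bar>\<kappa> x * (f x - c)\<bar> + \<bar>c\<bar> * \<kappa> x + (1 - \<kappa> x) * \<bar>f x\<bar>)"
  proof (intro uavg_mono ci)
    fix x
    have "\<kappa> x * \<bar>f x\<bar> \<le> \<kappa> x * (\<bar>f x - c\<bar> + \<bar>c\<bar>)" using \<kappa>(2)[of x] by (intro mult_left_mono) auto
    moreover have "\<bar>\<kappa> x * (f x - c)\<bar> = \<kappa> x * \<bar>f x - c\<bar>"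
      using \<kappa>(2)[of x] by (simp add: abs_mult)
    ultimately show "\<bar>f x\<bar> \<le> \<bar>\<kappa> x * (f x - c)\<bar> + \<bar>c\<bar> * \<kappa> x + (1 - \<kappa> x) * \<bar>f x\<bar>"
      by (simp only: distrib_left left_diff_distrib mult_1 mult.commute[of "\<bar>c\<bar>"])
  qed
  also have "\<dots> = ?I + \<bar>c\<bar> * uavg \<kappa> + ?J"
    by (subst uavg_add, (intro ci)+, subst uavg_add, (intro ci)+) (simp add: uavg_cmult)
  finally have 1: "uavg (\<lambda>x. \<bar>f x\<bar>) \<le> ?I + \<bar>c\<bar> * uavg \<kappa> + ?J" .
  have "c * uavg \<kappa> = uavg (\<lambda>x. (f x - \<kappa> x * (f x - c)) - (1 - \<kappa> x) * f x)"
    unfolding uavg_cmult[symmetric] by (rule uavg_cong) (simp add: algebra_simps)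
  also have "\<dots> = (uavg f - uavg (\<lambda>x. \<kappa> x * (f x - c))) - uavg (\<lambda>x. (1 - \<kappa> x) * f x)"
    by (subst uavg_diff, (intro ci)+, subst uavg_diff, (intro ci)+) simp
  finally have "\<bar>c * uavg \<kappa>\<bar> \<le> \<bar>uavg (\<lambda>x. \<kappa> x * (f x - c))\<bar> + \<bar>uavg (\<lambda>x. (1 - \<kappa> x) * f x)\<bar>"
    using assms(5) by linarith
  also have "\<dots> \<le> ?I + uavg (\<lambda>x. \<bar>(1 - \<kappa> x) * f x\<bar>)" by (intro add_mono uavg_abs)
  also have "uavg (\<lambda>x. \<bar>(1 - \<kappa> x) * f x\<bar>) = ?J" by (rule uavg_cong) (use \<kappa>(3) in \<open>simp add: abs_mult\<close>)
  also have "\<bar>c * uavg \<kappa>\<bar> = \<bar>c\<bar> * uavg \<kappa>" using uavg_nonneg[of \<kappa>] \<kappa>(2) by (simp add: abs_mult)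
  finally show ?thesis using 1 by linarith
qed

lemma subcube_refl: "0 < k \<Longrightarrow> subcube b k b k"
  by (simp add: subcube_def)

text \<open>The supremum runs over subcubes and index pairs together, because Korn's inequality
  couples all components. Smoothness makes it finite but enters no constant, so \<open>K\<close>
  depends on the dimension alone and survives the passage to nonsmooth maps.\<close>

lemma smooth_korn_bmo:
  obtains K :: real where "K > 0"
    and "\<And>(u :: 'n \<Rightarrow> real^'n::finite \<Rightarrow> real) b k A i j. (\<And>i. smooth (u i)) \<Longrightarrow> 0 < k \<Longrightarrow> 0 < A \<Longrightarrow>
      (\<And>a h i j. subcube a h b k \<Longrightarrow> cube_osc (\<lambda>x. sym_grad u i j x) a h \<le> A) \<Longrightarrow>
      cube_osc (partial_deriv j (u i)) b k \<le> K * A"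
proof -
  let ?n = "real CARD('n)"
  define CJ where "CJ = 2 * (3 + 2 ^ CARD('n) :: real)\<^sup>2"
  have CJ: "CJ > 0" unfolding CJ_def by (intro mult_pos_pos zero_less_power add_pos_pos) auto
  \<comment> \<open>Chosen so that \<open>\<tau> * (1 + CJ) = 1/4\<close>, which makes the boundary
    layer contribute \<open>B / 8\<close> before the factor 2 of
    \<open>uavg_abs_split\<close>.\<close>
  define \<tau> where "\<tau> = 1 / (4 * (1 + CJ))"
  have \<tau>: "\<tau> > 0" using CJ by (simp add: \<tau>_def)
  obtain \<kappa> :: "real^'n \<Rightarrow> real" and r where \<kappa>: "test_function UNIV \<kappa>" "\<And>x. 0 \<le> \<kappa> x" "\<And>x. \<kappa> x \<le> 1"
    and r: "0 < r" "\<And>x. \<kappa> x \<noteq> 0 \<Longrightarrow> x \<in> core r" and \<kappa>\<tau>: "uavg (\<lambda>x. (1 - \<kappa> x)\<^sup>2) \<le> \<tau>\<^sup>2"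
    using cutoff_exists[of "\<tau>\<^sup>2"] \<tau> by auto
  have c\<kappa>: "continuous_on T \<kappa>" for T by (rule smooth_continuous[OF test_function_smooth[OF \<kappa>(1)]])
  obtain C1 where C1: "C1 > 0" and key1: "\<And>e. 0 < e \<Longrightarrow> e < r \<Longrightarrow> (\<exists>C2>0. \<forall>u :: 'n \<Rightarrow> real^'n \<Rightarrow> real. (\<forall>i. smooth (u i)) \<longrightarrow>
    (\<exists>c. \<forall>i j. uavg (\<lambda>x. (\<kappa> x * (partial_deriv j (u i) x - c i j))\<^sup>2) \<le>
      C2 * sym_energy u +
      C1 * e\<^sup>2 * grad_energy u))"
    using korn_interior[OF \<kappa> r(2)] by blast
  define R where "R = sqrt (C1 * ?n\<^sup>2 * CJ)"
  have R: "0 \<le> R" "R\<^sup>2 = C1 * ?n\<^sup>2 * CJ" using C1 CJ by (auto simp: R_def)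
  \<comment> \<open>Below \<open>r\<close> as \<open>korn_interior\<close> demands, and so small
    that the error \<open>2 * (R * e) * B\<close> is at most \<open>B / 4\<close>.\<close>
  define e where "e = min (r / 2) (1 / (8 * (R + 1)))"
  have e: "0 < e" "e < r" "2 * (R * e) \<le> 1/4"
  proof -
    show "0 < e" "e < r" using r(1) R(1) by (auto simp: e_def)
    have "R * e \<le> R * (1 / (8 * (R + 1)))" using R(1) unfolding e_def by (intro mult_left_mono) auto
    also have "\<dots> \<le> 1/8" using R(1) by (simp add: field_simps)
    finally show "2 * (R * e) \<le> 1/4" by simp
  qed
  obtain C2 where C2: "C2 > 0" and key: "\<And>u :: 'n \<Rightarrow> real^'n \<Rightarrow> real. (\<And>i. smooth (u i)) \<Longrightarrow>
    (\<exists>c. \<forall>i j. uavg (\<lambda>x. (\<kappa> x * (partial_deriv j (u i) x - c i j))\<^sup>2) \<le>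
      C2 * sym_energy u +
      C1 * e\<^sup>2 * grad_energy u)"
    using key1[OF e(1,2)] by blast
  define P where "P = sqrt (C2 * ?n\<^sup>2 * CJ)"
  have P: "0 \<le> P" "P\<^sup>2 = C2 * ?n\<^sup>2 * CJ" using C2 CJ by (auto simp: P_def)
  have main: "cube_osc (partial_deriv j (u i)) b k \<le> (4 * P + 1) * A"
    if u: "\<And>i. smooth (u i)" and k: "0 < k" and A: "0 < A"
      and osc: "\<And>a h i j. subcube a h b k \<Longrightarrow> cube_osc (\<lambda>x. sym_grad u i j x) a h \<le> A"
    for u :: "'n \<Rightarrow> real^'n \<Rightarrow> real" and b k A i j
  proof -
    define g where "g i j = partial_deriv j (u i)" for i j
    define E where "E i j x = (g i j x + g j i x) / 2" for i j x
    have cg: "continuous_on T (g i j)" for T i j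
      unfolding g_def by (intro smooth_continuous smooth_partial u)
    have cE: "continuous_on T (E i j)" for T i j
      unfolding E_def by (intro continuous_intros cg) auto
    have cga: "continuous_on T (\<lambda>x. g i j (a + h *\<^sub>R x))" for T i j a h
      by (rule continuous_on_affine_arg[OF cg])
    define D where "D = {(a, h, i :: 'n, j :: 'n). subcube a h b k}"
    define V where "V = (SUP (a, h, i, j)\<in>D. cube_osc (g i j) a h)"
    have "\<exists>M>0. \<forall>a h x. subcube a h b k \<and> x \<in> unit_cube \<longrightarrow> \<bar>g i j (a + h *\<^sub>R x)\<bar> \<le> M" for i j
      by (rule bounded_on_cube[OF cg])
    then obtain M where M: "\<And>i j. M i j > 0" "\<And>i j a h x. subcube a h b k \<Longrightarrow> x \<in> unit_cube \<Longrightarrow> \<bar>g i j (a + h *\<^sub>R x)\<bar> \<le> M i j"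
      by metis
    have "cube_osc (g i j) a h \<le> (\<Sum>i\<in>UNIV. \<Sum>j\<in>UNIV. 2 * M i j)" if s: "subcube a h b k" for a h i j
    proof -
      have "cube_avg (\<lambda>x. \<bar>g i j x\<bar>) a h \<le> uavg (\<lambda>x::real^'n. M i j)"
        unfolding cube_avg_def using M(2)[OF s] by (intro uavg_mono continuous_intros cga)
      then have m: "\<bar>cube_avg (g i j) a h\<bar> \<le> M i j" using cube_avg_dist[OF cg, of i j a h 0] by simp
      have "cube_osc (g i j) a h \<le> uavg (\<lambda>x::real^'n. 2 * M i j)"
        unfolding cube_osc_def cube_avg_def[of "\<lambda>x. \<bar>g i j x - cube_avg (g i j) a h\<bar>"]
      proof (intro uavg_mono continuous_intros cga)
        fix x :: "real^'n" assume "x \<in> unit_cube"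
        then show "\<bar>g i j (a + h *\<^sub>R x) - cube_avg (g i j) a h\<bar> \<le> 2 * M i j"
          using M(2)[OF s, of x i j] m by linarith
      qed
      also have "\<dots> = 2 * M i j" by simp
      also have "\<dots> \<le> (\<Sum>i\<in>UNIV. \<Sum>j\<in>UNIV. 2 * M i j)"
        by (rule sum_le_double_sum) (simp add: less_imp_le M)
      finally show ?thesis .
    qed
    then have bdd: "bdd_above ((\<lambda>(a, h, i, j). cube_osc (g i j) a h) ` D)"
      by (intro bdd_aboveI[of _ "\<Sum>i\<in>UNIV. \<Sum>j\<in>UNIV. 2 * M i j"]) (auto simp: D_def)
    have V: "cube_osc (g i j) a h \<le> V" if "subcube a h b k" for a h i j
      unfolding V_def using that by (intro cSUP_upper2[OF bdd, of "(a, h, i, j)"]) (auto simp: D_def)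
    have osc0: "0 \<le> cube_osc (g i j) a h" for i j a h
      unfolding cube_osc_def cube_avg_def[of "\<lambda>x. \<bar>g i j x - cube_avg (g i j) a h\<bar>"] by (rule uavg_nonneg) simp
    have V0: "0 \<le> V" using V[OF subcube_refl[OF k], of i j] osc0[of i j b k] by linarith
    \<comment> \<open>Adding \<open>A\<close> makes \<open>B\<close> strictly positive, as required
      by the mean square estimate and by the division by \<open>B / \<tau>\<close>. It costs only
      the \<open>+ 1\<close> in \<open>4 * P + 1\<close>.\<close>
    define B where "B = V + A"
    have B: "B > 0" "V \<le> B" using V0 A by (auto simp: B_def)
    have step: "cube_osc (g i j) a h \<le> 2 * P * A + B / 2" if s: "subcube a h b k" for a h i j
    proof -
      have h: "h > 0" using s by (simp add: subcube_def)
      have s_in: "subcube a' h' b k" if "subcube a' h' a h" for a' h'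
        using that s by (rule subcube_trans)
      define m where "m i j = cube_avg (g i j) a h" for i j
      \<comment> \<open>Rescaled to the unit cube. The factor \<open>1 / h\<close> leaves
        derivatives unscaled, and the linear term subtracts the mean from each of them.\<close>
      define U where "U i x = (1 / h) * u i (a + h *\<^sub>R x) - (\<Sum>j\<in>UNIV. m i j * x $ j)" for i x
      have sU: "smooth (U i)" for i
        unfolding U_def by (intro smooth_diff smooth_cmult smooth_affine u smooth_sum smooth_coord)
      have dU: "partial_deriv j (U i) x = g i j (a + h *\<^sub>R x) - m i j" for i j x
      proof -
        have "partial_deriv j (U i) x = partial_deriv j (\<lambda>x. (1 / h) * u i (a + h *\<^sub>R x)) x - partial_deriv j (\<lambda>x. \<Sum>j\<in>UNIV. m i j * x $ j) x"
          unfolding U_def[abs_def] by (intro partial_smooth_diff smooth_cmult smooth_affine u smooth_sum smooth_coord)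
        also have "partial_deriv j (\<lambda>x. (1 / h) * u i (a + h *\<^sub>R x)) x = g i j (a + h *\<^sub>R x)"
          using h u by (subst partial_smooth_cmult) (auto simp: smooth_affine partial_smooth_affine g_def)
        also have "partial_deriv j (\<lambda>x. \<Sum>j\<in>UNIV. m i j * x $ j) x = (\<Sum>l\<in>UNIV. m i l * (if l = j then 1 else 0))"
          by (subst partial_smooth_sum) (auto intro!: smooth_cmult sum.cong simp: partial_smooth_cmult partial_deriv_coord)
        also have "\<dots> = m i j" by (simp add: if_distrib[of "\<lambda>c. _ * c"] cong: if_cong)
        finally show ?thesis .
      qed
      \<comment> \<open>The unknown \<open>B\<close> enters here: mean squares of the full gradient
        are only controlled by the quantity to be estimated.\<close>
      have varg: "uavg (\<lambda>x. (partial_deriv j (U i) x)\<^sup>2) \<le> CJ * B\<^sup>2" for i j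
      proof -
        have "uavg (\<lambda>x. (partial_deriv j (U i) x)\<^sup>2) = cube_var (g i j) a h"
          unfolding dU m_def cube_var_def cube_avg_def[of "\<lambda>x. (g i j x - cube_avg (g i j) a h)\<^sup>2"] ..
        also have "\<dots> \<le> 2 * (3 + 2 ^ CARD('n))\<^sup>2 * B\<^sup>2"
          using V B(2) by (intro cube_var_le_osc[OF cg B(1) _ s]) (meson order.trans)
        finally show ?thesis unfolding CJ_def .
      qed
      have varE: "uavg (\<lambda>x. (sym_grad U i j x)\<^sup>2) \<le> CJ * A\<^sup>2" for i j
      proof -
        have "cube_avg (E i j) a h = (1/2) * (m i j + m j i)"
          unfolding m_def cube_avg_def E_def
          by (subst uavg_add[symmetric, OF cga cga]) (simp add: uavg_cmult[symmetric])
        then have "uavg (\<lambda>x. (sym_grad U i j x)\<^sup>2) = cube_var (E i j) a h"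
          unfolding dU cube_var_def cube_avg_def[of "\<lambda>x. (E i j x - cube_avg (E i j) a h)\<^sup>2"]
          by (simp add: E_def diff_divide_distrib add_divide_distrib algebra_simps)
        also have "\<dots> \<le> 2 * (3 + 2 ^ CARD('n))\<^sup>2 * A\<^sup>2"
          using osc unfolding g_def[symmetric] E_def[symmetric] by (intro cube_var_le_osc[OF cE A _ s]) simp
        finally show ?thesis unfolding CJ_def .
      qed
      obtain c where c: "\<And>i j. uavg (\<lambda>x. (\<kappa> x * (partial_deriv j (U i) x - c i j))\<^sup>2) \<le>
        C2 * sym_energy U +
        C1 * e\<^sup>2 * grad_energy U"
        using key[of U, OF sU] by blast
      define f where "f = partial_deriv j (U i)"
      have cf: "continuous_on T f" for T
        unfolding f_def by (intro smooth_continuous smooth_partial sU)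
      have f0: "uavg f = 0"
        using uavg_diff[OF cga continuous_on_const, of i j a h "m i j"]
        by (simp add: f_def dU[abs_def] m_def cube_avg_def)
      have oscf: "cube_osc (g i j) a h = uavg (\<lambda>x. \<bar>f x\<bar>)"
        unfolding f_def dU m_def cube_osc_def cube_avg_def[of "\<lambda>x. \<bar>g i j x - cube_avg (g i j) a h\<bar>"] ..
      have "(uavg (\<lambda>x. \<bar>\<kappa> x * (f x - c i j)\<bar>))\<^sup>2 \<le> (P * A + R * e * B)\<^sup>2"
      proof -
        have "(uavg (\<lambda>x. \<bar>\<kappa> x * (f x - c i j)\<bar>))\<^sup>2 \<le> uavg (\<lambda>x. \<bar>\<kappa> x * (f x - c i j)\<bar>\<^sup>2)"
          by (intro uavg_jensen continuous_intros c\<kappa> cf)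
        also have "\<dots> = uavg (\<lambda>x. (\<kappa> x * (f x - c i j))\<^sup>2)" by simp
        also have "\<dots> \<le> C2 * (\<Sum>a\<in>(UNIV::'n set). \<Sum>b\<in>(UNIV::'n set). CJ * A\<^sup>2) + C1 * e\<^sup>2 * (\<Sum>a\<in>(UNIV::'n set). \<Sum>b\<in>(UNIV::'n set). CJ * B\<^sup>2)"
          unfolding f_def using C1 C2
          by (intro order.trans[OF c] add_mono mult_left_mono sum_mono varE varg) auto
        also have "\<dots> = (P * A)\<^sup>2 + (R * e * B)\<^sup>2"
          unfolding power_mult_distrib P(2) R(2) by (simp add: power2_eq_square mult_ac)
        also have "\<dots> \<le> (P * A + R * e * B)\<^sup>2"
          using P(1) R(1) e(1) A B(1) unfolding power2_sum by simp
        finally show ?thesis .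
      qed
      then have 1: "uavg (\<lambda>x. \<bar>\<kappa> x * (f x - c i j)\<bar>) \<le> P * A + R * e * B"
        by (rule power2_le_imp_le) (use P(1) R(1) e(1) A B(1) in auto)
      \<comment> \<open>The weight \<open>B / \<tau>\<close> turns the two terms into
        \<open>B * \<tau>\<close> and \<open>CJ * B * \<tau>\<close>.\<close>
      have "uavg (\<lambda>x. (1 - \<kappa> x) * \<bar>f x\<bar>) \<le> (B / \<tau> * uavg (\<lambda>x. (1 - \<kappa> x)\<^sup>2) + uavg (\<lambda>x. \<bar>f x\<bar>\<^sup>2) / (B / \<tau>)) / 2"
        using B(1) \<tau> by (intro uavg_mult_le continuous_intros c\<kappa> cf) auto
      also have "\<dots> \<le> (B / \<tau> * \<tau>\<^sup>2 + (CJ * B\<^sup>2) / (B / \<tau>)) / 2"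
        using B(1) \<tau> \<kappa>\<tau> varg[of j i] unfolding f_def[symmetric]
        by (intro divide_right_mono add_mono mult_left_mono) auto
      also have "\<dots> = B * (\<tau> * (1 + CJ)) / 2"
        using B(1) \<tau> by (simp add: field_simps power2_eq_square)
      also have "\<tau> * (1 + CJ) = 1/4" using CJ by (simp add: \<tau>_def field_simps)
      finally have 2: "uavg (\<lambda>x. (1 - \<kappa> x) * \<bar>f x\<bar>) \<le> B / 8" by simp
      have "cube_osc (g i j) a h \<le> 2 * (P * A + R * e * B) + 2 * (B / 8)"
        unfolding oscf by (intro order.trans[OF uavg_abs_split[OF cf c\<kappa> \<kappa>(2,3) f0, of "c i j"]] add_mono mult_left_mono 1 2) auto
      moreover have "(2 * (R * e)) * B \<le> 1/4 * B" using e(3) B(1) by (intro mult_right_mono) auto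
      ultimately show ?thesis by (simp add: algebra_simps)
    qed
    \<comment> \<open>With \<open>B = V + A\<close> this becomes
      \<open>V / 2 \<le> (2 * P + 1/2) * A\<close>; moving \<open>V / 2\<close> across is legitimate
      because \<open>V\<close> is a finite real.\<close>
    have "V \<le> 2 * P * A + B / 2"
      unfolding V_def
    proof (rule cSUP_least)
      show "D \<noteq> {}" using subcube_refl[OF k] by (auto simp: D_def)
      show "(case p of (a, h, i, j) \<Rightarrow> cube_osc (g i j) a h) \<le> 2 * P * A + B / 2" if "p \<in> D" for p
        using that step by (auto simp: D_def)
    qed
    then have "V \<le> (4 * P + 1) * A" by (simp add: B_def field_simps)
    then show ?thesis using V[OF subcube_refl[OF k], of i j] unfolding g_def by linarith
  qed
  have "4 * P + 1 > 0" using P(1) by simp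
  then show thesis by (rule that) (rule main)
qed

subsection \<open>Approximation by smooth maps\<close>

text \<open>The uniform L1 bound \<open>N\<close> on the slices dominates the outer integrand by a
  multiple of \<open>\<bar>w\<bar>\<close>, so Tonelli's criterion applies.\<close>

lemma integrable_pair_bounded_kernel:
  fixes F :: "'b::euclidean_space \<Rightarrow> 'a::euclidean_space \<Rightarrow> real" and w :: "'b \<Rightarrow> real"
  assumes [measurable]: "case_prod F \<in> borel_measurable (borel \<Otimes>\<^sub>M borel)" and w: "integrable lborel w"
    and int: "\<And>y. integrable lborel (F y)" and N: "\<And>y. (LINT x|lborel. \<bar>F y x\<bar>) \<le> N"
  shows "integrable (lborel \<Otimes>\<^sub>M lborel) (\<lambda>(y, x). w y * F y x)"
proof (rule lborel_pair.Fubini_integrable)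
  have [measurable]: "w \<in> borel_measurable borel" using w by auto
  show "(\<lambda>(y, x). w y * F y x) \<in> borel_measurable (lborel \<Otimes>\<^sub>M lborel)" by measurable
  show "AE y in lborel. integrable lborel (\<lambda>x. case (y, x) of (y, x) \<Rightarrow> w y * F y x)"
    using int by simp
  have "integrable lborel (\<lambda>y. N * w y)" using w by simp
  then have "integrable lborel (\<lambda>y. \<bar>w y\<bar> * (LINT x|lborel. \<bar>F y x\<bar>))"
  proof (rule Bochner_Integration.integrable_bound)
    show "AE y in lborel. norm (\<bar>w y\<bar> * (LINT x|lborel. \<bar>F y x\<bar>)) \<le> norm (N * w y)"
    proof (intro AE_I2)
      fix y
      have "0 \<le> (LINT x|lborel. \<bar>F y x\<bar>)" by simp
      then have "\<bar>w y\<bar> * \<bar>LINT x|lborel. \<bar>F y x\<bar>\<bar> \<le> \<bar>w y\<bar> * \<bar>N\<bar>"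
        using N[of y] by (intro mult_left_mono) auto
      then show "norm (\<bar>w y\<bar> * (LINT x|lborel. \<bar>F y x\<bar>)) \<le> norm (N * w y)"
        by (simp add: abs_mult mult.commute)
    qed
  qed measurable
  then show "integrable lborel (\<lambda>y. LINT x|lborel. norm (case (y, x) of (y, x) \<Rightarrow> w y * F y x))"
    by (simp add: abs_mult)
qed

lemma integral_abs_affine_le:
  fixes e :: "'a::euclidean_space \<Rightarrow> real"
  assumes e: "integrable lborel e" and k: "k \<noteq> 0" and [measurable]: "Q \<in> sets borel"
  shows "integrable lborel (\<lambda>x. indicator Q x * e (b + k *\<^sub>R x))"
    and "(LINT x|lborel. \<bar>indicator Q x * e (b + k *\<^sub>R x)\<bar>) \<le> (LINT x|lborel. \<bar>e x\<bar>) / \<bar>k\<bar> ^ DIM('a)"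
proof -
  have [measurable]: "e \<in> borel_measurable borel" using e by auto
  have i: "integrable lborel (\<lambda>x. e (b + k *\<^sub>R x))" by (rule lborel_integrable_affine[OF e k])
  show i2: "integrable lborel (\<lambda>x. indicator Q x * e (b + k *\<^sub>R x))"
    by (rule Bochner_Integration.integrable_bound[OF i]) (auto simp: indicator_def)
  have "(LINT x|lborel. \<bar>indicator Q x * e (b + k *\<^sub>R x)\<bar>) \<le> (LINT x|lborel. \<bar>e (b + k *\<^sub>R x)\<bar>)"
    using i i2 by (intro integral_mono) (auto simp: indicator_def)
  also have "\<dots> = (LINT x|lborel. \<bar>e x\<bar>) / \<bar>k\<bar> ^ DIM('a)"
    using lborel_integral_affine[of "\<lambda>x. \<bar>e x\<bar>" k b] k by simp
  finally show "(LINT x|lborel. \<bar>indicator Q x * e (b + k *\<^sub>R x)\<bar>) \<le> (LINT x|lborel. \<bar>e x\<bar>) / \<bar>k\<bar> ^ DIM('a)" .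
qed

text \<open>Convolution with \<open>\<eta>\<close> is an average of translates, and mean oscillation
  is convex: Fubini turns the oscillation into an average of oscillations over translated cubes.
  Only shifts in the support of \<open>\<eta>\<close> occur.\<close>

lemma cube_osc_convolve_le:
  fixes e \<eta> :: "real^'n::finite \<Rightarrow> real"
  assumes e: "integrable lborel e" and \<eta>: "test_function UNIV \<eta>" "\<And>y. 0 \<le> \<eta> y" "(LINT y|lborel. \<eta> y) = 1"
    and k: "0 < k" and osc: "\<And>y. \<eta> y \<noteq> 0 \<Longrightarrow> cube_osc e (b - y) k \<le> A"
  shows "cube_osc (convolve e \<eta>) b k \<le> A"
proof -
  let ?Q = "indicator unit_cube :: real^'n \<Rightarrow> real"
  have [measurable]: "e \<in> borel_measurable borel" using e by auto
  have [measurable]: "\<eta> \<in> borel_measurable borel"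
    by (intro borel_measurable_continuous_onI smooth_continuous test_function_smooth[OF \<eta>(1)])
  note i\<eta> = integrable_test_function[OF \<eta>(1)]
  define N where "N = (LINT x|lborel. \<bar>e x\<bar>) / \<bar>k\<bar> ^ DIM(real^'n)"
  define F where "F y x = ?Q x * e (b - y + k *\<^sub>R x)" for y x
  define m where "m y = cube_avg e (b - y) k" for y
  have Fi: "integrable lborel (F y)" and FN: "(LINT x|lborel. \<bar>F y x\<bar>) \<le> N" for y
    unfolding F_def N_def using integral_abs_affine_le[OF e, of k unit_cube "b - y"] k by auto
  have mF: "m y = (LINT x|lborel. F y x)" for y by (simp add: m_def cube_avg_def uavg_def F_def)
  have [measurable]: "case_prod F \<in> borel_measurable (borel \<Otimes>\<^sub>M borel)" unfolding F_def by measurable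
  have P1: "integrable (lborel \<Otimes>\<^sub>M lborel) (\<lambda>(y, x). \<eta> y * F y x)"
    by (rule integrable_pair_bounded_kernel[OF _ i\<eta> Fi FN]) measurable
  have [measurable]: "m \<in> borel_measurable borel" unfolding mF[abs_def] by measurable
  have mN: "\<bar>m y\<bar> \<le> N" for y
    unfolding mF using integral_abs_bound[of lborel "F y"] FN[of y] by linarith
  have P2: "integrable (lborel \<Otimes>\<^sub>M lborel) (\<lambda>(y, x). \<eta> y * (?Q x * m y))"
  proof (rule integrable_pair_bounded_kernel[OF _ i\<eta>])
    show "(\<lambda>(y, x). ?Q x * m y) \<in> borel_measurable (borel \<Otimes>\<^sub>M borel)" by measurable
    show "integrable lborel (\<lambda>x. ?Q x * m y)" for y by (intro uavg_integrable continuous_intros)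
    show "(LINT x|lborel. \<bar>?Q x * m y\<bar>) \<le> N" for y
      using uavg_const[of "\<bar>m y\<bar>", where 'n='n] mN[of y] unfolding uavg_def abs_mult by (simp only: abs_indicator)
  qed
  have int_m: "integrable lborel (\<lambda>y. \<eta> y * m y)"
    using lborel_pair.integrable_fst'[OF P1] by (simp add: mF)
  have conv: "convolve e \<eta> (b + k *\<^sub>R x) = (LINT y|lborel. \<eta> y * e (b - y + k *\<^sub>R x))" for x
    by (subst convolve_flip) (auto simp: algebra_simps)
  have int_e: "integrable lborel (\<lambda>y. \<eta> y * e (b - y + k *\<^sub>R x))" for x
    using integrable_mult_test_function[OF lborel_integrable_affine[OF e, of "-1" "b + k *\<^sub>R x"] \<eta>(1)]
    by (simp add: algebra_simps)
  have avg: "cube_avg (convolve e \<eta>) b k = (LINT y|lborel. \<eta> y * m y)"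
  proof -
    have "cube_avg (convolve e \<eta>) b k = (LINT x|lborel. LINT y|lborel. \<eta> y * F y x)"
      unfolding cube_avg_def uavg_def conv F_def mult.left_commute[of "\<eta> _"] by simp
    also have "\<dots> = (LINT y|lborel. LINT x|lborel. \<eta> y * F y x)"
      using lborel_pair.Fubini_integral[OF P1] .
    finally show ?thesis by (simp add: mF)
  qed
  define D where "D y x = ?Q x * \<bar>e (b - y + k *\<^sub>R x) - m y\<bar>" for y x
  have P3: "integrable (lborel \<Otimes>\<^sub>M lborel) (\<lambda>(y, x). \<eta> y * D y x)"
  proof -
    have "integrable (lborel \<Otimes>\<^sub>M lborel) (\<lambda>p. \<bar>(\<lambda>(y, x). \<eta> y * F y x) p - (\<lambda>(y, x). \<eta> y * (?Q x * m y)) p\<bar>)"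
      by (intro integrable_abs Bochner_Integration.integrable_diff P1 P2)
    also have "(\<lambda>p. \<bar>(\<lambda>(y, x). \<eta> y * F y x) p - (\<lambda>(y, x). \<eta> y * (?Q x * m y)) p\<bar>) = (\<lambda>(y, x). \<eta> y * D y x)"
      unfolding F_def D_def using \<eta>(2) by (auto simp: fun_eq_iff indicator_def abs_mult right_diff_distrib[symmetric])
    finally show ?thesis .
  qed
  have P3': "integrable (lborel \<Otimes>\<^sub>M lborel) (\<lambda>(x, y). \<eta> y * D y x)"
    using lborel_pair.integrable_product_swap[OF P3] by (simp add: case_prod_unfold)
  have "cube_osc (convolve e \<eta>) b k \<le> (LINT x|lborel. LINT y|lborel. \<eta> y * D y x)"
    unfolding cube_osc_def cube_avg_def[of "\<lambda>x. \<bar>convolve e \<eta> x - cube_avg (convolve e \<eta>) b k\<bar>"] uavg_def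
  proof (rule integral_mono)
    have "continuous_on UNIV (\<lambda>x. convolve e \<eta> x)" by (intro smooth_continuous smooth_convolve[OF e \<eta>(1)])
    then show "integrable lborel (\<lambda>x. ?Q x * \<bar>convolve e \<eta> (b + k *\<^sub>R x) - cube_avg (convolve e \<eta>) b k\<bar>)"
      by (intro uavg_integrable continuous_intros continuous_on_affine_arg)
    show "integrable lborel (\<lambda>x. LINT y|lborel. \<eta> y * D y x)"
      using lborel_pair.integrable_fst'[OF P3'] by simp
    fix x
    show "?Q x * \<bar>convolve e \<eta> (b + k *\<^sub>R x) - cube_avg (convolve e \<eta>) b k\<bar> \<le> (LINT y|lborel. \<eta> y * D y x)"
    proof (cases "x \<in> unit_cube")
      case True
      have "convolve e \<eta> (b + k *\<^sub>R x) - cube_avg (convolve e \<eta>) b k = (LINT y|lborel. \<eta> y * e (b - y + k *\<^sub>R x) - \<eta> y * m y)"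
        unfolding conv avg using int_e int_m by simp
      also have "\<bar>\<dots>\<bar> \<le> (LINT y|lborel. \<bar>\<eta> y * e (b - y + k *\<^sub>R x) - \<eta> y * m y\<bar>)" by (rule integral_abs_bound)
      also have "\<dots> = (LINT y|lborel. \<eta> y * D y x)"
        using True \<eta>(2) by (simp add: D_def right_diff_distrib[symmetric] abs_mult)
      finally show ?thesis using True by simp
    qed (simp add: D_def)
  qed
  also have "\<dots> = (LINT y|lborel. LINT x|lborel. \<eta> y * D y x)"
    using lborel_pair.Fubini_integral[OF P3] .
  also have "\<dots> \<le> (LINT y|lborel. \<eta> y * A)"
  proof (rule integral_mono)
    show "integrable lborel (\<lambda>y. LINT x|lborel. \<eta> y * D y x)"
      using lborel_pair.integrable_fst'[OF P3] by simp
    show "integrable lborel (\<lambda>y. \<eta> y * A)" using i\<eta> by simp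
    fix y
    have "(LINT x|lborel. D y x) = cube_osc e (b - y) k"
      unfolding D_def m_def cube_osc_def cube_avg_def[of "\<lambda>x. \<bar>e x - cube_avg e (b - y) k\<bar>"] uavg_def ..
    then show "(LINT x|lborel. \<eta> y * D y x) \<le> \<eta> y * A"
      using osc[of y] \<eta>(2)[of y] by (cases "\<eta> y = 0") (auto intro: mult_left_mono)
  qed
  also have "\<dots> = A" using \<eta>(3) by simp
  finally show ?thesis .
qed

text \<open>Induction over indicators, sums and limits. The cutoff to \<open>K\<close> makes the
  sets of the base case bounded, so their closed inner approximations are compact and a small
  translation stays inside the open outer approximation.\<close>

lemma L1_translation_continuous:
  fixes f :: "'a::euclidean_space \<Rightarrow> real"
  assumes f: "integrable lborel f" and K: "compact K" and d: "d > 0"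
  shows "\<exists>r>0. \<forall>y. norm y \<le> r \<longrightarrow>
    (LINT x|lborel. \<bar>indicator K (x - y) * f (x - y) - indicator K x * f x\<bar>) \<le> d"
  using f d
proof (induction f arbitrary: d rule: integrable_induct)
  have [measurable]: "K \<in> sets borel" using K by (rule borel_compact)
  have shift: "integrable lborel (\<lambda>x. g (x - y))" "(LINT x|lborel. g (x - y)) = (LINT x|lborel. g x)"
    if g: "integrable lborel g" for g :: "'a \<Rightarrow> real" and y
    using lborel_integrable_affine[OF g, of 1 "-y"] lborel_integral_affine[of g 1 "-y"] g by auto
  have cutK: "integrable lborel (\<lambda>x. indicator K x * g x)" if g: "integrable lborel g" for g :: "'a \<Rightarrow> real"
  proof -
    have [measurable]: "g \<in> borel_measurable borel" using g by auto
    show ?thesis by (rule Bochner_Integration.integrable_bound[OF g]) (auto simp: indicator_def)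
  qed
  {
    case (base A c)
    then have A [measurable]: "A \<in> sets borel" by simp
    define B where "B = A \<inter> K"
    have B [measurable]: "B \<in> sets borel" by (simp add: B_def)
    then have Bl: "B \<in> sets lebesgue" by simp
    \<comment> \<open>\<open>D\<close> has measure at most \<open>2 * s\<close> and is counted
      twice, at \<open>x\<close> and at \<open>x - y\<close>, so the total error is at most
      \<open>\<bar>c\<bar> * (4 * s) \<le> d\<close>.\<close>
    define s where "s = d / (4 * (\<bar>c\<bar> + 1))"
    have s: "s > 0" using base by (simp add: s_def)
    obtain T where T: "open T" "B \<subseteq> T" "(T - B) \<in> lmeasurable" "emeasure lebesgue (T - B) < ennreal s"
      using sets_lebesgue_outer_open[OF Bl s] by blast
    obtain C where C: "closed C" "C \<subseteq> B" "B - C \<in> lmeasurable" "emeasure lebesgue (B - C) < ennreal s"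
      using sets_lebesgue_inner_closed[OF Bl s] by blast
    have [measurable]: "T \<in> sets borel" "C \<in> sets borel" using T C by auto
    have "compact C" using C K B_def by (metis Int_lower2 compact_Int_closed inf.absorb_iff2 order.trans)
    then obtain r where r: "r > 0" "(\<Union>x\<in>C. ball x r) \<subseteq> T"
      using compact_subset_open_imp_ball_epsilon_subset[of C T] T C by blast
    define D where "D = (T - B) \<union> (B - C)"
    have D [measurable]: "D \<in> sets borel" by (simp add: D_def)
    have "emeasure lborel D \<le> emeasure lborel (T - B) + emeasure lborel (B - C)"
      unfolding D_def by (rule emeasure_subadditive) auto
    also have "\<dots> \<le> ennreal s + ennreal s"
      using T C by (intro add_mono) (auto simp: less_imp_le)
    also have "\<dots> = ennreal (2 * s)" using s by (simp add: ennreal_plus[symmetric] del: ennreal_plus)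
    finally have eD: "emeasure lborel D \<le> ennreal (2 * s)" .
    then have fD: "emeasure lborel D < \<infinity>" by (simp add: le_less_trans)
    have mD: "measure lborel D \<le> 2 * s"
      using eD s unfolding measure_def by (simp add: enn2real_leI)
    have iD: "integrable lborel (indicator D :: 'a \<Rightarrow> real)"
      using fD by (intro integrable_real_indicator) auto
    have "(LINT x|lborel. \<bar>indicator K (x - y) * (indicator A (x - y) *\<^sub>R c) - indicator K x * (indicator A x *\<^sub>R c)\<bar>) \<le> d"
      if y: "norm y \<le> r / 2" for y
    proof -
      have iB: "integrable lborel (\<lambda>x. indicator K x * (indicator A x *\<^sub>R c))"
        using base by (intro cutK integrable_scaleR_left integrable_real_indicator) auto
      have "(LINT x|lborel. \<bar>indicator K (x - y) * (indicator A (x - y) *\<^sub>R c) - indicator K x * (indicator A x *\<^sub>R c)\<bar>) \<le>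
        (LINT x|lborel. \<bar>c\<bar> * (indicator D (x - y) + indicator D x))"
      proof (rule integral_mono)
        show "integrable lborel (\<lambda>x. \<bar>indicator K (x - y) * (indicator A (x - y) *\<^sub>R c) - indicator K x * (indicator A x *\<^sub>R c)\<bar>)"
          using shift(1)[OF iB, of y] iB by simp
        show "integrable lborel (\<lambda>x. \<bar>c\<bar> * (indicator D (x - y) + indicator D x))"
          using shift(1)[OF iD, of y] iD by simp
        fix x
        have 1: "x \<in> T" if "x - y \<in> C"
        proof -
          have "x \<in> ball (x - y) r" using y r(1) by (simp add: dist_norm)
          then show ?thesis using r(2) that by blast
        qed
        have 2: "x - y \<in> T" if "x \<in> C"
        proof -
          have "x - y \<in> ball x r" using y r(1) by (simp add: dist_norm)
          then show ?thesis using r(2) that by blast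
        qed
        \<comment> \<open>If exactly one of \<open>x\<close> and \<open>x - y\<close> lies in
          \<open>B\<close>, then either that point is outside \<open>C\<close>, or the other one is
          in \<open>T - B\<close>; both cases hit \<open>D\<close>.\<close>
        have "\<bar>indicator B (x - y) - indicator B x\<bar> \<le> (indicator D (x - y) + indicator D x :: real)"
          using 1 2 unfolding D_def by (auto simp: indicator_def)
        then have mono: "\<bar>c\<bar> * \<bar>indicator B (x - y) - indicator B x\<bar> \<le> \<bar>c\<bar> * (indicator D (x - y) + indicator D x)"
          by (rule mult_left_mono) simp
        have eqK: "indicator K z * (indicator A z *\<^sub>R c) = c * indicator B z" for z
          by (auto simp: B_def indicator_def)
        show "\<bar>indicator K (x - y) * (indicator A (x - y) *\<^sub>R c) - indicator K x * (indicator A x *\<^sub>R c)\<bar> \<le> \<bar>c\<bar> * (indicator D (x - y) + indicator D x)"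
          using mono unfolding eqK right_diff_distrib[symmetric] abs_mult .
      qed
      also have "\<dots> = \<bar>c\<bar> * (2 * measure lborel D)"
        using shift[OF iD, of y] iD by simp
      also have "\<dots> \<le> \<bar>c\<bar> * (4 * s)" using mD by (intro mult_left_mono) auto
      also have "\<dots> \<le> d" using base by (simp add: s_def field_simps)
      finally show ?thesis .
    qed
    then show ?case using r(1) by (intro exI[of _ "r / 2"]) auto
  next
    case (add f g)
    obtain r1 where r1: "r1 > 0" "\<And>y. norm y \<le> r1 \<Longrightarrow> (LINT x|lborel. \<bar>indicator K (x - y) * f (x - y) - indicator K x * f x\<bar>) \<le> d / 2"
      using add.IH(1)[of "d / 2"] add.prems by auto
    obtain r2 where r2: "r2 > 0" "\<And>y. norm y \<le> r2 \<Longrightarrow> (LINT x|lborel. \<bar>indicator K (x - y) * g (x - y) - indicator K x * g x\<bar>) \<le> d / 2"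
      using add.IH(2)[of "d / 2"] add.prems by auto
    have "(LINT x|lborel. \<bar>indicator K (x - y) * (f (x - y) + g (x - y)) - indicator K x * (f x + g x)\<bar>) \<le> d" if "norm y \<le> min r1 r2" for y
    proof -
      note i = shift(1)[OF cutK[OF add.hyps(1)], of y] shift(1)[OF cutK[OF add.hyps(2)], of y] cutK[OF add.hyps(1)] cutK[OF add.hyps(2)]
      have "(LINT x|lborel. \<bar>indicator K (x - y) * (f (x - y) + g (x - y)) - indicator K x * (f x + g x)\<bar>) \<le>
        (LINT x|lborel. \<bar>indicator K (x - y) * f (x - y) - indicator K x * f x\<bar> + \<bar>indicator K (x - y) * g (x - y) - indicator K x * g x\<bar>)"
        using i by (intro integral_mono) (auto simp: distrib_left)
      also have "\<dots> \<le> d / 2 + d / 2"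
        using i r1(2)[of y] r2(2)[of y] that by simp
      finally show ?thesis by simp
    qed
    then show ?case using r1(1) r2(1) by (intro exI[of _ "min r1 r2"]) auto
  next
    case (lim f s)
    have "(\<lambda>i. LINT x|lborel. \<bar>s i x - f x\<bar>) \<longlonglongrightarrow> (LINT x::'a|lborel. 0)"
    \<comment> \<open>The approximants satisfy
      \<open>\<bar>s i x\<bar> \<le> 2 * \<bar>f x\<bar>\<close>, whence the factor 3.\<close>
    proof (rule integral_dominated_convergence[where w = "\<lambda>x. 3 * \<bar>f x\<bar>"])
      show "AE x in lborel. (\<lambda>i. \<bar>s i x - f x\<bar>) \<longlonglongrightarrow> 0"
        by (intro AE_I2 tendsto_rabs_zero LIM_zero lim.hyps(2))
      show "AE x in lborel. norm \<bar>s i x - f x\<bar> \<le> 3 * \<bar>f x\<bar>" for i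
      proof (intro AE_I2)
        fix x show "norm \<bar>s i x - f x\<bar> \<le> 3 * \<bar>f x\<bar>" using lim.hyps(3)[of x i] by simp
      qed
    qed (use lim.hyps(1,4) in auto)
    then have "\<forall>\<^sub>F i in sequentially. (LINT x|lborel. \<bar>s i x - f x\<bar>) < d / 3"
      using lim.prems by (intro order_tendstoD(2)[of _ 0]) auto
    then obtain i where i: "(LINT x|lborel. \<bar>s i x - f x\<bar>) < d / 3"
      by (auto simp: eventually_sequentially)
    obtain r where r: "r > 0" "\<And>y. norm y \<le> r \<Longrightarrow> (LINT x|lborel. \<bar>indicator K (x - y) * s i (x - y) - indicator K x * s i x\<bar>) \<le> d / 3"
      using lim.IH[of "d / 3" i] lim.prems by auto
    have "(LINT x|lborel. \<bar>indicator K (x - y) * f (x - y) - indicator K x * f x\<bar>) \<le> d" if y: "norm y \<le> r" for y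
    proof -
      have e: "integrable lborel (\<lambda>x. \<bar>s i x - f x\<bar>)" using lim.hyps(1,4) by auto
      note ii = shift(1)[OF cutK[OF lim.hyps(1)[of i]], of y] cutK[OF lim.hyps(1)[of i]] shift(1)[OF cutK[OF lim.hyps(4)], of y] cutK[OF lim.hyps(4)] shift(1)[OF e, of y] e
      have "(LINT x|lborel. \<bar>indicator K (x - y) * f (x - y) - indicator K x * f x\<bar>) \<le>
        (LINT x|lborel. \<bar>indicator K (x - y) * s i (x - y) - indicator K x * s i x\<bar> + \<bar>s i (x - y) - f (x - y)\<bar> + \<bar>s i x - f x\<bar>)"
        using ii by (intro integral_mono) (auto simp: indicator_def)
      also have "\<dots> \<le> d / 3 + d / 3 + d / 3"
        using ii r(2)[OF y] i shift(2)[OF e, of y] by simp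
      finally show ?thesis by simp
    qed
    then show ?case using r(1) by blast
  }
qed

text \<open>The error is an average of differences \<open>g (x - y) - g x\<close> with
  \<open>y\<close> in the support of \<open>\<eta>\<close>. By Fubini its L1 norm is at most the
  largest L1 modulus of translation there, so one radius serves all mollifiers.\<close>

lemma mollification_L1_convergence:
  fixes g :: "real^'n::finite \<Rightarrow> real"
  assumes g: "integrable lborel g" and K: "compact K" "\<And>x. x \<notin> K \<Longrightarrow> g x = 0" and d: "d > 0"
  shows "\<exists>r>0. \<forall>\<eta>. test_function UNIV \<eta> \<and> (\<forall>y. 0 \<le> \<eta> y) \<and> (LINT y|lborel. \<eta> y) = 1 \<and> (\<forall>y. \<eta> y \<noteq> 0 \<longrightarrow> norm y \<le> r) \<longrightarrow>
    integrable lborel (\<lambda>x. convolve g \<eta> x - g x) \<and> (LINT x|lborel. \<bar>convolve g \<eta> x - g x\<bar>) \<le> d"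
proof -
  have [measurable]: "g \<in> borel_measurable borel" using g by auto
  have eq: "indicator K x * g x = g x" for x using K(2)[of x] by (auto simp: indicator_def)
  obtain r where r: "r > 0" "\<And>y. norm y \<le> r \<Longrightarrow> (LINT x|lborel. \<bar>g (x - y) - g x\<bar>) \<le> d"
    using L1_translation_continuous[OF g K(1) d] unfolding eq by blast
  have "integrable lborel (\<lambda>x. convolve g \<eta> x - g x) \<and> (LINT x|lborel. \<bar>convolve g \<eta> x - g x\<bar>) \<le> d"
    if \<eta>: "test_function UNIV \<eta>" "\<And>y. 0 \<le> \<eta> y" "(LINT y|lborel. \<eta> y) = 1" "\<And>y. \<eta> y \<noteq> 0 \<Longrightarrow> norm y \<le> r" for \<eta>
  proof -
    have [measurable]: "\<eta> \<in> borel_measurable borel"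
      by (intro borel_measurable_continuous_onI smooth_continuous test_function_smooth[OF \<eta>(1)])
    note i\<eta> = integrable_test_function[OF \<eta>(1)]
    have shift: "integrable lborel (\<lambda>x. g (x - y))" "(LINT x|lborel. \<bar>g (x - y)\<bar>) = (LINT x|lborel. \<bar>g x\<bar>)" for y
      using lborel_integrable_affine[OF g, of 1 "-y"] lborel_integral_affine[of "\<lambda>x. \<bar>g x\<bar>" 1 "-y"] by auto
    have iF: "integrable lborel (\<lambda>x. g (x - y) - g x)" for y using shift(1) g by simp
    have P: "integrable (lborel \<Otimes>\<^sub>M lborel) (\<lambda>(y, x). \<eta> y * (g (x - y) - g x))"
    proof (rule integrable_pair_bounded_kernel[OF _ i\<eta> iF])
      show "(LINT x|lborel. \<bar>g (x - y) - g x\<bar>) \<le> 2 * (LINT x|lborel. \<bar>g x\<bar>)" for y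
      proof -
        have "(LINT x|lborel. \<bar>g (x - y) - g x\<bar>) \<le> (LINT x|lborel. \<bar>g (x - y)\<bar> + \<bar>g x\<bar>)"
          using iF[of y] shift(1)[of y] g by (intro integral_mono) auto
        then show ?thesis using shift[of y] g by simp
      qed
    qed measurable
    have P': "integrable (lborel \<Otimes>\<^sub>M lborel) (\<lambda>(x, y). \<eta> y * (g (x - y) - g x))"
      using lborel_pair.integrable_product_swap[OF P] by (simp add: case_prod_unfold)
    have diff: "convolve g \<eta> x - g x = (LINT y|lborel. \<eta> y * (g (x - y) - g x))" for x
    proof -
      have "integrable lborel (\<lambda>y. \<eta> y * g (x - y))"
        using integrable_mult_test_function[OF lborel_integrable_affine[OF g, of "-1" x] \<eta>(1)] by (simp add: mult.commute)
      then show ?thesis using \<eta>(3) i\<eta> by (subst convolve_flip) (auto simp: right_diff_distrib)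
    qed
    have "(LINT x|lborel. \<bar>convolve g \<eta> x - g x\<bar>) \<le> (LINT x|lborel. LINT y|lborel. \<bar>\<eta> y * (g (x - y) - g x)\<bar>)"
    proof (rule integral_mono)
      show "integrable lborel (\<lambda>x. \<bar>convolve g \<eta> x - g x\<bar>)"
        using lborel_pair.integrable_fst'[OF P'] unfolding diff by simp
      show "integrable lborel (\<lambda>x. LINT y|lborel. \<bar>\<eta> y * (g (x - y) - g x)\<bar>)"
        using lborel_pair.integrable_fst'[OF integrable_abs[OF P']] by simp
    qed (unfold diff, rule integral_abs_bound)
    also have "\<dots> = (LINT y|lborel. LINT x|lborel. \<bar>\<eta> y * (g (x - y) - g x)\<bar>)"
      using lborel_pair.Fubini_integral[of "\<lambda>y x. \<bar>\<eta> y * (g (x - y) - g x)\<bar>"] integrable_abs[OF P] by (simp add: case_prod_unfold)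
    also have "\<dots> \<le> (LINT y|lborel. \<eta> y * d)"
    proof (rule integral_mono)
      show "integrable lborel (\<lambda>y. LINT x|lborel. \<bar>\<eta> y * (g (x - y) - g x)\<bar>)"
        using lborel_pair.integrable_fst'[OF integrable_abs[OF P]] by simp
      show "integrable lborel (\<lambda>y. \<eta> y * d)" using i\<eta> by simp
      show "(LINT x|lborel. \<bar>\<eta> y * (g (x - y) - g x)\<bar>) \<le> \<eta> y * d" for y
        using r(2)[OF \<eta>(4)[of y]] \<eta>(2)[of y] by (cases "\<eta> y = 0") (auto simp: abs_mult intro: mult_left_mono)
    qed
    finally have "(LINT x|lborel. \<bar>convolve g \<eta> x - g x\<bar>) \<le> d" using \<eta>(3) by simp
    moreover have "integrable lborel (\<lambda>x. convolve g \<eta> x - g x)"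
      using lborel_pair.integrable_fst'[OF P'] unfolding diff by simp
    ultimately show ?thesis by blast
  qed
  then show ?thesis using r(1) by blast
qed

text \<open>Passing from \<open>f\<close> to \<open>g\<close> changes both the function and its
  mean, whence the factor 2; the power of \<open>h\<close> comes from rescaling the cube.\<close>

lemma cube_osc_perturb:
  fixes f g :: "real^'n::finite \<Rightarrow> real"
  assumes f: "integrable lborel f" and g: "integrable lborel g" and h: "h > 0"
  shows "cube_osc g a h \<le> cube_osc f a h + 2 * ((LINT x|lborel. \<bar>f x - g x\<bar>) / h ^ CARD('n))"
proof -
  let ?Q = "indicator unit_cube :: real^'n \<Rightarrow> real"
  define F where "F x = f (a + h *\<^sub>R x)" for x
  define G where "G x = g (a + h *\<^sub>R x)" for x
  have iF: "integrable lborel (\<lambda>x. ?Q x * F x)" and iG: "integrable lborel (\<lambda>x. ?Q x * G x)"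
    unfolding F_def G_def using h
    by (auto intro!: integral_abs_affine_le(1)[OF f] integral_abs_affine_le(1)[OF g])
  have iQ: "integrable lborel (\<lambda>x. ?Q x * c)" for c by (intro uavg_integrable continuous_intros)
  have iabs: "integrable lborel (\<lambda>x. ?Q x * \<bar>H x - c\<bar>)" if "integrable lborel (\<lambda>x. ?Q x * H x)" for H and c :: real
    using integrable_abs[OF Bochner_Integration.integrable_diff[OF that iQ[of c]]]
    by (simp add: right_diff_distrib[symmetric] abs_mult)
  have iFG: "integrable lborel (\<lambda>x. ?Q x * \<bar>F x - G x\<bar>)"
    using integrable_abs[OF Bochner_Integration.integrable_diff[OF iF iG]]
    by (simp add: right_diff_distrib[symmetric] abs_mult)
  define N where "N = uavg (\<lambda>x. \<bar>F x - G x\<bar>)"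
  have "uavg F - uavg G = (LINT x|lborel. ?Q x * (F x - G x))"
    unfolding uavg_def using iF iG by (simp add: right_diff_distrib)
  then have avg: "\<bar>uavg F - uavg G\<bar> \<le> N"
    using uavg_abs[of "\<lambda>x. F x - G x"] by (simp add: uavg_def N_def)
  have "uavg (\<lambda>x. \<bar>G x - uavg G\<bar>) \<le> (LINT x|lborel. (?Q x * \<bar>F x - uavg F\<bar> + ?Q x * \<bar>F x - G x\<bar>) + ?Q x * N)"
    unfolding uavg_def[of "\<lambda>x. \<bar>G x - uavg G\<bar>"]
  proof (rule integral_mono)
    show "integrable lborel (\<lambda>x. (?Q x * \<bar>F x - uavg F\<bar> + ?Q x * \<bar>F x - G x\<bar>) + ?Q x * N)"
      by (intro Bochner_Integration.integrable_add iabs iF iFG iQ)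
    fix x
    show "?Q x * \<bar>G x - uavg G\<bar> \<le> (?Q x * \<bar>F x - uavg F\<bar> + ?Q x * \<bar>F x - G x\<bar>) + ?Q x * N"
    proof -
      have "\<bar>G x - uavg G\<bar> \<le> \<bar>F x - uavg F\<bar> + \<bar>F x - G x\<bar> + N" using avg by linarith
      then show ?thesis by (simp add: indicator_def)
    qed
  qed (rule iabs[OF iG])
  also have "\<dots> = (uavg (\<lambda>x. \<bar>F x - uavg F\<bar>) + N) + N"
    using iabs[OF iF] iFG iQ[of N] uavg_const[of N, where 'n='n] unfolding uavg_def N_def
    by (subst Bochner_Integration.integral_add, (intro Bochner_Integration.integrable_add; assumption?), simp_all)
  finally have "cube_osc g a h \<le> cube_osc f a h + 2 * N"
    unfolding F_def G_def cube_osc_def cube_avg_def by simp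
  moreover have "N \<le> (LINT x|lborel. \<bar>f x - g x\<bar>) / h ^ CARD('n)"
    using integral_abs_affine_le(2)[OF Bochner_Integration.integrable_diff[OF f g], of h unit_cube a] h
    unfolding N_def uavg_def F_def G_def by (simp add: abs_mult)
  ultimately show ?thesis by linarith
qed

lemma cube_osc_cong:
  assumes "\<And>x. x \<in> unit_cube \<Longrightarrow> f (a + h *\<^sub>R x) = g (a + h *\<^sub>R x)"
  shows "cube_osc f a h = cube_osc g a h"
proof -
  have "cube_avg f a h = cube_avg g a h" unfolding cube_avg_def by (rule uavg_cong) (rule assms)
  then show ?thesis
    unfolding cube_osc_def cube_avg_def[of "\<lambda>x. \<bar>_ x - _\<bar>"] by (intro uavg_cong) (simp add: assms)
qed

text \<open>Mollify at a radius below \<open>r\<close>. On the original cube the weak identity turns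
  derivatives of the mollified map into mollified \<open>g\<close>, and oscillations there are
  averages over subcubes of the enlarged cube. The smooth estimate, with a constant independent of
  the radius, then passes to the limit in L1.\<close>

lemma korn_bmo_lborel:
  obtains K :: real where "K > 0"
    and "\<And>(w :: 'n::finite \<Rightarrow> real^'n \<Rightarrow> real) (g :: 'n \<Rightarrow> 'n \<Rightarrow> real^'n \<Rightarrow> real) C a h r A i j.
      (\<And>i. integrable lborel (w i)) \<Longrightarrow> (\<And>i j. integrable lborel (g i j)) \<Longrightarrow>
      compact C \<Longrightarrow> (\<And>i j x. x \<notin> C \<Longrightarrow> g i j x = 0) \<Longrightarrow> 0 < h \<Longrightarrow> 0 < r \<Longrightarrow> 0 < A \<Longrightarrow>
      (\<And>\<phi> i j. test_function UNIV \<phi> \<Longrightarrow> (\<And>x. \<phi> x \<noteq> 0 \<Longrightarrow> x \<in> cbox (\<chi> i. a $ i - r) (\<chi> i. a $ i + h + r)) \<Longrightarrow>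
        (LINT x|lborel. w i x * partial_deriv j \<phi> x) = - (LINT x|lborel. g i j x * \<phi> x)) \<Longrightarrow>
      (\<And>b k i j. subcube b k (\<chi> i. a $ i - r) (h + 2 * r) \<Longrightarrow> cube_osc (\<lambda>x. (g i j x + g j i x) / 2) b k \<le> A) \<Longrightarrow>
      cube_osc (g i j) a h \<le> K * A"
proof -
  obtain K where K: "K > 0" and key: "\<And>(u :: 'n \<Rightarrow> real^'n \<Rightarrow> real) b k A i j. (\<And>i. smooth (u i)) \<Longrightarrow> 0 < k \<Longrightarrow> 0 < A \<Longrightarrow>
      (\<And>a h i j. subcube a h b k \<Longrightarrow> cube_osc (\<lambda>x. sym_grad u i j x) a h \<le> A) \<Longrightarrow>
      cube_osc (partial_deriv j (u i)) b k \<le> K * A"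
    by (fact smooth_korn_bmo)
  have main: "cube_osc (g i j) a h \<le> K * A"
    if w: "\<And>i. integrable lborel (w i)" and g: "\<And>i j. integrable lborel (g i j)" and C: "compact C" "\<And>i j x. x \<notin> C \<Longrightarrow> g i j x = 0"
      and h: "0 < h" and r: "0 < r" and A: "0 < A"
      and weak: "\<And>\<phi> i j. test_function UNIV \<phi> \<Longrightarrow> (\<And>x. \<phi> x \<noteq> 0 \<Longrightarrow> x \<in> cbox (\<chi> i. a $ i - r) (\<chi> i. a $ i + h + r)) \<Longrightarrow>
        (LINT x|lborel. w i x * partial_deriv j \<phi> x) = - (LINT x|lborel. g i j x * \<phi> x)"
      and osc: "\<And>b k i j. subcube b k (\<chi> i. a $ i - r) (h + 2 * r) \<Longrightarrow> cube_osc (\<lambda>x. (g i j x + g j i x) / 2) b k \<le> A"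
    for w :: "'n \<Rightarrow> real^'n \<Rightarrow> real" and g :: "'n \<Rightarrow> 'n \<Rightarrow> real^'n \<Rightarrow> real" and C a h r A i j
  proof (rule field_le_epsilon)
    fix d :: real assume d: "d > 0"
    \<comment> \<open>Makes the perturbation error \<open>2 * (d1 / h ^ CARD('n))\<close> equal to
      \<open>d\<close>.\<close>
    define d1 where "d1 = d / 2 * h ^ CARD('n)"
    have d1: "d1 > 0" using d h by (simp add: d1_def)
    obtain r1 where r1: "r1 > 0" and conv: "\<And>\<eta>. test_function UNIV \<eta> \<Longrightarrow> (\<And>y. 0 \<le> \<eta> y) \<Longrightarrow> (LINT y|lborel. \<eta> y) = 1 \<Longrightarrow> (\<And>y. \<eta> y \<noteq> 0 \<Longrightarrow> norm y \<le> r1) \<Longrightarrow>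
      integrable lborel (\<lambda>x. convolve (g i j) \<eta> x - g i j x) \<and> (LINT x|lborel. \<bar>convolve (g i j) \<eta> x - g i j x\<bar>) \<le> d1"
      using mollification_L1_convergence[OF g C d1, of i j] by blast
    \<comment> \<open>Radius \<open>r\<close> keeps kernels and shifted cubes inside the
      enlargement; \<open>r1\<close> ensures closeness in L1.\<close>
    obtain \<eta> :: "real^'n \<Rightarrow> real" where \<eta>: "test_function UNIV \<eta>" "\<And>x. 0 \<le> \<eta> x" "\<And>x. norm x \<ge> min r r1 \<Longrightarrow> \<eta> x = 0" "(LINT x|lborel. \<eta> x) = 1"
      using mollifier_exists[of "min r r1"] r r1 by auto
    have supp: "norm y \<le> r" "norm y \<le> r1" if "\<eta> y \<noteq> 0" for y using \<eta>(3)[of y] that by force+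
    define U where "U i = convolve (w i) \<eta>" for i
    have sU: "smooth (U i)" for i unfolding U_def by (rule smooth_convolve[OF w \<eta>(1)])
    have dU: "partial_deriv l (U m) x = convolve (g m l) \<eta> x" if x: "x \<in> cbox a (\<chi> i. a $ i + h)" for m l x
    proof -
      have "partial_deriv l (U m) x = (LINT z|lborel. w m z * partial_deriv l \<eta> (x - z))"
        unfolding U_def partial_deriv_convolve[OF w \<eta>(1)] convolve_def ..
      also have "\<dots> = - (LINT z|lborel. w m z * partial_deriv l (\<lambda>z. \<eta> (x - z)) z)"
        by (simp add: partial_smooth_reflect[OF test_function_smooth[OF \<eta>(1)]])
      also have "\<dots> = (LINT z|lborel. g m l z * \<eta> (x - z))"
      proof (subst weak[OF test_function_reflect[OF \<eta>(1)]])
        fix z assume "\<eta> (x - z) \<noteq> 0"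
        then have n: "norm (x - z) \<le> r" by (rule supp)
        have "\<bar>x $ i - z $ i\<bar> \<le> r" for i using component_le_norm_cart[of "x - z" i] n by simp
        then show "z \<in> cbox (\<chi> i. a $ i - r) (\<chi> i. a $ i + h + r)"
          using x unfolding mem_box_cart by (simp add: abs_le_iff) (smt (verit))
      qed simp
      finally show ?thesis unfolding convolve_def .
    qed
    have oscU: "cube_osc (\<lambda>x. sym_grad U m l x) b k \<le> A" if s: "subcube b k a h" for b k m l
    proof -
      have "cube_osc (\<lambda>x. sym_grad U m l x) b k = cube_osc (convolve (\<lambda>z. (g m l z + g l m z) / 2) \<eta>) b k"
        by (rule cube_osc_cong) (simp add: dU[OF subcube_point[OF s]] convolve_half_sum[OF g g \<eta>(1)])
      also have "\<dots> \<le> A"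
      proof (rule cube_osc_convolve_le[OF _ \<eta>(1,2,4)])
        show "integrable lborel (\<lambda>z. (g m l z + g l m z) / 2)" using g by simp
        show "0 < k" using s by (simp add: subcube_def)
        fix y assume "\<eta> y \<noteq> 0"
        then have "norm y \<le> r" by (rule supp)
        then have "\<bar>y $ i\<bar> \<le> r" for i using component_le_norm_cart[of y i] by linarith
        \<comment> \<open>A shift by at most \<open>r\<close> keeps a subcube inside the enlarged
          cube; hence the oscillation hypothesis is imposed there.\<close>
        then have "subcube (b - y) k (\<chi> i. a $ i - r) (h + 2 * r)"
          using s unfolding subcube_def by (simp add: abs_le_iff) (smt (verit))
        then show "cube_osc (\<lambda>z. (g m l z + g l m z) / 2) (b - y) k \<le> A" by (rule osc)
      qed
      finally show ?thesis .
    qed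
    have "cube_osc (convolve (g i j) \<eta>) a h = cube_osc (partial_deriv j (U i)) a h"
      by (rule cube_osc_cong) (simp add: dU[OF subcube_point[OF subcube_refl[OF h]]])
    also have "\<dots> \<le> K * A" by (rule key[OF sU h A oscU])
    finally have 1: "cube_osc (convolve (g i j) \<eta>) a h \<le> K * A" .
    have c: "integrable lborel (\<lambda>x. convolve (g i j) \<eta> x - g i j x)" "(LINT x|lborel. \<bar>convolve (g i j) \<eta> x - g i j x\<bar>) \<le> d1"
      using conv[OF \<eta>(1,2,4) supp(2)] by auto
    have "integrable lborel (\<lambda>x. (convolve (g i j) \<eta> x - g i j x) + g i j x)"
      using c(1) g by (rule Bochner_Integration.integrable_add)
    then have "integrable lborel (convolve (g i j) \<eta>)" by simp
    then have "cube_osc (g i j) a h \<le> cube_osc (convolve (g i j) \<eta>) a h + 2 * ((LINT x|lborel. \<bar>convolve (g i j) \<eta> x - g i j x\<bar>) / h ^ CARD('n))"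
      by (rule cube_osc_perturb[OF _ g h])
    also have "\<dots> \<le> K * A + 2 * (d1 / h ^ CARD('n))"
      using 1 c(2) h by (intro add_mono mult_left_mono divide_right_mono) auto
    also have "\<dots> = K * A + d" using h by (simp add: d1_def)
    finally show "cube_osc (g i j) a h \<le> K * A + d" .
  qed
  show thesis by (rule that[OF K]) (fact main)
qed

subsection \<open>From averages over cubes to the theorem\<close>

abbreviation cube :: "real^'n::finite \<Rightarrow> real \<Rightarrow> (real^'n) set" where
  "cube a h \<equiv> box a (\<chi> i. a $ i + h)"

lemma measure_cube:
  fixes a :: "real^'n::finite"
  assumes "h > 0"
  shows "measure lebesgue (cube a h) = h ^ CARD('n)"
proof -
  have "measure lebesgue (cube a h) = measure lborel (cbox a (\<chi> i. a $ i + h))"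
    by (simp add: measure_completion measure_lborel_box_eq measure_lborel_cbox_eq)
  also have "\<dots> = h ^ CARD('n)"
    using assms by (subst content_cbox_cart) (auto simp: interval_ne_empty_cart less_imp_le)
  finally show ?thesis .
qed

text \<open>Bridges three differences: the open cube against the closed one (a null set), the given
  function against its Borel version \<open>f'\<close>, and the cube against the unit cube. Borel
  measurability is what the affine change of variables asks for.\<close>

lemma average_eq_cube_avg:
  fixes f f' :: "real^'n::finite \<Rightarrow> real"
  assumes h: "h > 0" and [measurable]: "f' \<in> borel_measurable borel"
    and f [measurable]: "(\<lambda>x. indicator (cube a h) x * f x) \<in> borel_measurable lebesgue"
    and ae: "AE x in lebesgue. x \<in> cube a h \<longrightarrow> f x = f' x"
  shows "average (cube a h) f = cube_avg f' a h"
proof -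
  let ?C = "cbox a (\<chi> i. a $ i + h)"
  have "?C - cube a h \<in> null_sets lebesgue"
    using negligible_frontier_interval[of a "\<chi> i. a $ i + h"] by (simp add: negligible_iff_null_sets)
  then have "AE x in lebesgue. x \<notin> ?C - cube a h" by (rule AE_not_in)
  with ae have "AE x in lebesgue. indicator (cube a h) x * f x = indicator ?C x * f' x"
  proof eventually_elim
    case (elim x)
    then show ?case using box_subset_cbox[of a "\<chi> i. a $ i + h"] by (auto simp: indicator_def)
  qed
  then have "set_lebesgue_integral lebesgue (cube a h) f = (LINT x|lebesgue. indicator ?C x * f' x)"
    unfolding set_lebesgue_integral_def real_scaleR_def
    by (intro integral_cong_AE f measurable_completion) auto
  also have "\<dots> = (LINT x|lborel. indicator ?C x * f' x)"
    by (rule integral_completion) measurable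
  also have "\<dots> = \<bar>h\<bar> ^ DIM(real^'n) * (LINT x|lborel. indicator ?C (a + h *\<^sub>R x) * f' (a + h *\<^sub>R x))"
    using h by (intro lborel_integral_affine) auto
  also have "(\<lambda>x. indicator ?C (a + h *\<^sub>R x) :: real) = indicator unit_cube"
  proof
    fix x :: "real^'n"
    have "a + h *\<^sub>R x \<in> ?C \<longleftrightarrow> x \<in> unit_cube"
      using h by (simp add: mem_box_cart mem_unit_cube zero_le_mult_iff)
    then show "indicator ?C (a + h *\<^sub>R x) = (indicator unit_cube x :: real)" by (simp add: indicator_def)
  qed
  finally show ?thesis
    using h unfolding average_def measure_cube[OF h] cube_avg_def uavg_def by simp
qed

lemma average_osc_eq_cube_osc:
  fixes f f' :: "real^'n::finite \<Rightarrow> real"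
  assumes h: "h > 0" and f' [measurable]: "f' \<in> borel_measurable borel"
    and f [measurable]: "(\<lambda>x. indicator (cube a h) x * f x) \<in> borel_measurable lebesgue"
    and ae: "AE x in lebesgue. x \<in> cube a h \<longrightarrow> f x = f' x"
  shows "average (cube a h) (\<lambda>x. \<bar>f x - average (cube a h) f\<bar>) = cube_osc f' a h"
proof -
  have avg: "average (cube a h) f = cube_avg f' a h" by (rule average_eq_cube_avg[OF assms])
  have [measurable]: "cube a h \<in> sets lebesgue" by simp
  show ?thesis unfolding cube_osc_def avg
  proof (rule average_eq_cube_avg[OF h])
    show "(\<lambda>x. \<bar>f' x - cube_avg f' a h\<bar>) \<in> borel_measurable borel" by measurable
    have "(\<lambda>x. \<bar>indicator (cube a h) x * f x - indicator (cube a h) x * cube_avg f' a h\<bar>) \<in> borel_measurable lebesgue"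
      by measurable
    also have "(\<lambda>x. \<bar>indicator (cube a h) x * f x - indicator (cube a h) x * cube_avg f' a h\<bar>) = (\<lambda>x. indicator (cube a h) x * \<bar>f x - cube_avg f' a h\<bar>)"
      by (auto simp: indicator_def fun_eq_iff)
    finally show "(\<lambda>x. indicator (cube a h) x * \<bar>f x - cube_avg f' a h\<bar>) \<in> borel_measurable lebesgue" .
    show "AE x in lebesgue. x \<in> cube a h \<longrightarrow> \<bar>f x - cube_avg f' a h\<bar> = \<bar>f' x - cube_avg f' a h\<bar>"
      using ae by eventually_elim simp
  qed
qed

text \<open>Multiplication by the indicator of \<open>K\<close> makes the Borel version vanish
  outside \<open>K\<close> everywhere, not merely almost everywhere.\<close>

lemma integrable_lebesgue_borel_version:
  fixes f :: "'a::euclidean_space \<Rightarrow> real"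
  assumes f: "integrable lebesgue f" and K: "K \<in> sets borel" "\<And>x. x \<notin> K \<Longrightarrow> f x = 0"
  shows "\<exists>f'. integrable lborel f' \<and> (AE x in lebesgue. f x = f' x) \<and> (\<forall>x. x \<notin> K \<longrightarrow> f' x = 0)"
proof -
  obtain g where g: "g \<in> borel_measurable lborel" "AE x in lborel. f x = g x"
    using completion_ex_borel_measurable_real[of f lborel] f by auto
  define f' where "f' x = indicator K x * g x" for x
  have [measurable]: "g \<in> borel_measurable borel" "K \<in> sets borel" using g K by auto
  have m: "f' \<in> borel_measurable lborel" unfolding f'_def by measurable
  have ae: "AE x in lebesgue. f x = f' x"
    using AE_completion[OF g(2)] by eventually_elim (use K(2) in \<open>auto simp: f'_def indicator_def\<close>)
  have "integrable lebesgue f'"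
    using f ae m by (subst integrable_cong_AE[where g = f]) (auto intro: measurable_completion)
  then have "integrable lborel f'" using integrable_completion[OF m] by simp
  then show ?thesis using ae by (intro exI[of _ f']) (auto simp: f'_def)
qed

section \<open>Passing between matrices and their entries\<close>

lemma norm_matrix_le_sum:
  fixes M :: "real^'n::finite^'m::finite"
  shows "norm M \<le> (\<Sum>i\<in>UNIV. \<Sum>j\<in>UNIV. \<bar>M $ i $ j\<bar>)"
proof -
  have "norm M \<le> (\<Sum>i\<in>UNIV. norm (M $ i))"
    unfolding norm_vec_def[of M] by (rule L2_set_le_sum) simp
  also have "\<dots> \<le> (\<Sum>i\<in>UNIV. \<Sum>j\<in>UNIV. \<bar>M $ i $ j\<bar>)"
    by (intro sum_mono norm_le_l1_cart)
  finally show ?thesis .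
qed

lemma abs_entry_le_norm: "\<bar>M $ i $ j\<bar> \<le> norm (M :: real^'n::finite^'m::finite)"
  using component_le_norm_cart[of "M $ i" j] Finite_Cartesian_Product.norm_nth_le[of M i] by linarith

lemma bounded_linear_entry: "bounded_linear (\<lambda>M :: real^'n::finite^'m::finite. M $ i $ j)"
  using bounded_linear_compose[OF bounded_linear_vec_nth bounded_linear_vec_nth] .

lemma set_integrable_entry:
  fixes F :: "'a \<Rightarrow> real^'n::finite^'m::finite"
  assumes "set_integrable M Q F"
  shows "set_integrable M Q (\<lambda>x. F x $ i $ j)"
  using integrable_bounded_linear[OF bounded_linear_entry assms[unfolded set_integrable_def], of i j]
  unfolding set_integrable_def by simp

lemma average_entry:
  fixes F :: "real^'k::finite \<Rightarrow> real^'n::finite^'m::finite"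
  assumes "set_integrable lebesgue Q F"
  shows "average Q F $ i $ j = average Q (\<lambda>x. F x $ i $ j)"
  using integral_bounded_linear[OF bounded_linear_entry assms[unfolded set_integrable_def], of i j]
  unfolding average_def set_lebesgue_integral_def by simp

lemma average_mono:
  fixes f g :: "real^'n::finite \<Rightarrow> real"
  assumes "set_integrable lebesgue Q f" "set_integrable lebesgue Q g" "\<And>x. f x \<le> g x"
  shows "average Q f \<le> average Q g"
  unfolding average_def real_scaleR_def
  by (intro mult_left_mono set_integral_mono assms) auto

lemma set_integrable_sum_UNIV:
  fixes f :: "'i::finite \<Rightarrow> 'a \<Rightarrow> real"
  assumes "\<And>i. set_integrable M Q (f i)"
  shows "set_integrable M Q (\<lambda>x. \<Sum>i\<in>UNIV. f i x)"
  using assms unfolding set_integrable_def scaleR_sum_right by (rule Bochner_Integration.integrable_sum)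

lemma average_sum:
  fixes f :: "'i::finite \<Rightarrow> real^'n::finite \<Rightarrow> real"
  assumes "\<And>i. set_integrable lebesgue Q (f i)"
  shows "average Q (\<lambda>x. \<Sum>i\<in>UNIV. f i x) = (\<Sum>i\<in>UNIV. average Q (f i))"
  using assms unfolding average_def set_lebesgue_integral_def set_integrable_def scaleR_sum_right
  by (subst Bochner_Integration.integral_sum) (auto simp: scaleR_sum_right sum_distrib_left)

lemma set_integrable_dist_const:
  fixes F :: "real^'k::finite \<Rightarrow> 'b::euclidean_space"
  assumes "set_integrable lebesgue (cube a h) F"
  shows "set_integrable lebesgue (cube a h) (\<lambda>x. norm (F x - c))"
proof -
  have "set_integrable lebesgue (cube a h) (\<lambda>x. c)"
    unfolding set_integrable_def by (intro integrable_scaleR_left integrable_real_indicator)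
      (use emeasure_lborel_box_finite[of a "\<chi> i. a $ i + h"] in auto)
  then show ?thesis using assms by (intro set_integrable_norm set_integral_diff)
qed

text \<open>Used for the symmetric part, whose matrix oscillation bounds each entry;
  \<open>average_osc_le_sum\<close> goes back from the entries of the full gradient to the
  matrix.\<close>

lemma average_osc_entry_le:
  fixes F :: "real^'k::finite \<Rightarrow> real^'n::finite^'m::finite"
  assumes F: "set_integrable lebesgue (cube a h) F"
  shows "average (cube a h) (\<lambda>x. \<bar>F x $ i $ j - average (cube a h) (\<lambda>x. F x $ i $ j)\<bar>) \<le>
    average (cube a h) (\<lambda>x. norm (F x - average (cube a h) F))"
  unfolding average_entry[OF F, symmetric]
  using set_integrable_dist_const[OF set_integrable_entry[OF F]] set_integrable_dist_const[OF F]
    abs_entry_le_norm[of "F _ - average (cube a h) F" i j]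
  by (intro average_mono) auto

lemma average_osc_le_sum:
  fixes F :: "real^'k::finite \<Rightarrow> real^'n::finite^'m::finite"
  assumes F: "set_integrable lebesgue (cube a h) F"
  shows "average (cube a h) (\<lambda>x. norm (F x - average (cube a h) F)) \<le>
    (\<Sum>i\<in>UNIV. \<Sum>j\<in>UNIV. average (cube a h) (\<lambda>x. \<bar>F x $ i $ j - average (cube a h) (\<lambda>x. F x $ i $ j)\<bar>))"
proof -
  let ?c = "average (cube a h) F"
  have i: "set_integrable lebesgue (cube a h) (\<lambda>x. \<bar>F x $ i $ j - ?c $ i $ j\<bar>)" for i j
    using set_integrable_dist_const[OF set_integrable_entry[OF F]] by simp
  have "average (cube a h) (\<lambda>x. norm (F x - ?c)) \<le> average (cube a h) (\<lambda>x. \<Sum>i\<in>UNIV. \<Sum>j\<in>UNIV. \<bar>F x $ i $ j - ?c $ i $ j\<bar>)"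
  proof (rule average_mono)
    show "set_integrable lebesgue (cube a h) (\<lambda>x. norm (F x - ?c))" by (rule set_integrable_dist_const[OF F])
    show "set_integrable lebesgue (cube a h) (\<lambda>x. \<Sum>i\<in>UNIV. \<Sum>j\<in>UNIV. \<bar>F x $ i $ j - ?c $ i $ j\<bar>)"
      by (intro set_integrable_sum_UNIV i)
    show "norm (F x - ?c) \<le> (\<Sum>i\<in>UNIV. \<Sum>j\<in>UNIV. \<bar>F x $ i $ j - ?c $ i $ j\<bar>)" for x
      using norm_matrix_le_sum[of "F x - ?c"] by simp
  qed
  also have "\<dots> = (\<Sum>i\<in>UNIV. \<Sum>j\<in>UNIV. average (cube a h) (\<lambda>x. \<bar>F x $ i $ j - ?c $ i $ j\<bar>))"
    by (simp only: average_sum set_integrable_sum_UNIV i)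
  finally show ?thesis unfolding average_entry[OF F] .
qed

text \<open>The closed cube is the closure of the open one and so lies in the same compact set; it
  therefore has a neighbourhood of some radius \<open>e\<close> inside \<open>U\<close>.\<close>

lemma cube_enlargement:
  fixes a :: "real^'n::finite"
  assumes "open U" "h > 0" "compactly_inside (cube a h) U"
  obtains r where "r > 0" "cbox (\<chi> i. a $ i - r) (\<chi> i. a $ i + h + r) \<subseteq> U"
proof -
  let ?C = "cbox a (\<chi> i. a $ i + h)"
  obtain D where D: "compact D" "cube a h \<subseteq> D" "D \<subseteq> U"
    using assms(3) unfolding compactly_inside_def by blast
  have "cube a h \<noteq> {}" using assms(2) by (simp add: interval_ne_empty_cart)
  then have "?C = closure (cube a h)" by (simp add: closure_box)
  also have "\<dots> \<subseteq> D" using D by (intro closure_minimal compact_imp_closed) auto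
  finally have sub: "?C \<subseteq> U" using D by blast
  obtain e where e: "e > 0" "(\<Union>x\<in>?C. ball x e) \<subseteq> U"
    by (rule compact_subset_open_imp_ball_epsilon_subset[OF compact_cbox assms(1) sub])
  define r where "r = e / (real CARD('n) + 1)"
  have r: "r > 0" using e by (simp add: r_def)
  have "z \<in> U" if z: "z \<in> cbox (\<chi> i. a $ i - r) (\<chi> i. a $ i + h + r)" for z
  proof -
    \<comment> \<open>The coordinatewise projection of \<open>z\<close> to the closed cube: each
      coordinate moves by at most \<open>r\<close>, so the sum over coordinates stays below
      \<open>e\<close>.\<close>
    define p where "p = (\<chi> i. max (a $ i) (min (z $ i) (a $ i + h)))"
    have "p \<in> ?C" using assms(2) by (simp add: p_def mem_box_cart)
    moreover
    have "norm (p - z) < e"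
    proof -
      have "norm (p - z) \<le> (\<Sum>i\<in>UNIV. \<bar>(p - z) $ i\<bar>)" by (rule norm_le_l1_cart)
      also have "\<dots> \<le> (\<Sum>i\<in>(UNIV::'n set). r)"
        using z r assms(2) unfolding mem_box_cart by (intro sum_mono) (simp add: p_def; smt (verit))
      also have "\<dots> < e" using e by (simp add: r_def field_simps)
      finally show ?thesis .
    qed
    then have "z \<in> ball p e" by (simp add: dist_norm)
    ultimately show ?thesis using e(2) by blast
  qed
  then show thesis using r that by blast
qed

lemma bounded_linear_sym_part: "bounded_linear (sym_part :: real^'n::finite^'n \<Rightarrow> _)"
  unfolding linear_conv_bounded_linear[symmetric]
  by (rule linearI) (simp_all add: sym_part_def transpose_def vec_eq_iff algebra_simps)

lemma sym_part_entry: "sym_part H $ i $ j = (H $ i $ j + H $ j $ i) / 2"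
  by (simp add: sym_part_def transpose_def)

theorem theorem3p3:
  assumes "CARD('n::finite) \<ge> 2"
  shows "\<exists>K::real. K > 0 \<and>
    (\<forall>(U :: (real^'n) set) (u :: real^'n \<Rightarrow> real^'n) (G :: real^'n \<Rightarrow> real^'n^'n).
       is_domain U \<and> bounded U \<and> u \<in> W11_loc U \<and> weak_gradient U u G \<and> G \<in> BMO U \<longrightarrow>
       BMO_seminorm U G \<le> ennreal K * BMO_seminorm U (\<lambda>x. sym_part (G x)))"
proof -
  obtain K0 where K0: "K0 > 0" and korn: "\<And>(w :: 'n \<Rightarrow> real^'n \<Rightarrow> real) (g :: 'n \<Rightarrow> 'n \<Rightarrow> real^'n \<Rightarrow> real) C a h r A i j.
      (\<And>i. integrable lborel (w i)) \<Longrightarrow> (\<And>i j. integrable lborel (g i j)) \<Longrightarrow>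
      compact C \<Longrightarrow> (\<And>i j x. x \<notin> C \<Longrightarrow> g i j x = 0) \<Longrightarrow> 0 < h \<Longrightarrow> 0 < r \<Longrightarrow> 0 < A \<Longrightarrow>
      (\<And>\<phi> i j. test_function UNIV \<phi> \<Longrightarrow> (\<And>x. \<phi> x \<noteq> 0 \<Longrightarrow> x \<in> cbox (\<chi> i. a $ i - r) (\<chi> i. a $ i + h + r)) \<Longrightarrow>
        (LINT x|lborel. w i x * partial_deriv j \<phi> x) = - (LINT x|lborel. g i j x * \<phi> x)) \<Longrightarrow>
      (\<And>b k i j. subcube b k (\<chi> i. a $ i - r) (h + 2 * r) \<Longrightarrow> cube_osc (\<lambda>x. (g i j x + g j i x) / 2) b k \<le> A) \<Longrightarrow>
      cube_osc (g i j) a h \<le> K0 * A"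
    by (fact korn_bmo_lborel)
  \<comment> \<open>The factor is the number of matrix entries over which the oscillation is
    summed.\<close>
  define K where "K = (real CARD('n))\<^sup>2 * K0"
  have K: "K > 0" using K0 by (simp add: K_def)
  have "BMO_seminorm U G \<le> ennreal K * BMO_seminorm U (\<lambda>x. sym_part (G x))"
    if U: "open U" and W: "weak_gradient U u G"
    for U :: "(real^'n) set" and u :: "real^'n \<Rightarrow> real^'n" and G :: "real^'n \<Rightarrow> real^'n^'n"
  \<comment> \<open>An infinite right-hand side leaves nothing to prove because
    \<open>K > 0\<close>; otherwise \<open>A0\<close> is its real value.\<close>
  proof (cases "BMO_seminorm U (\<lambda>x. sym_part (G x)) = \<infinity>")
    case True
    then show ?thesis using K by (simp add: ennreal_mult_top)
  next
    case False
    define A0 where "A0 = enn2real (BMO_seminorm U (\<lambda>x. sym_part (G x)))"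
    have A0: "0 \<le> A0" "BMO_seminorm U (\<lambda>x. sym_part (G x)) = ennreal A0"
      using False by (auto simp: A0_def less_top[symmetric])
    have symA: "average (cube b k) (\<lambda>x. norm (sym_part (G x) - average (cube b k) (\<lambda>x. sym_part (G x)))) \<le> A0"
      if "k > 0" "compactly_inside (cube b k) U" for b k
    proof -
      have "is_cube (cube b k)" unfolding is_cube_def using that by blast
      then have "ennreal (average (cube b k) (\<lambda>x. norm (sym_part (G x) - average (cube b k) (\<lambda>x. sym_part (G x))))) \<le> ennreal A0"
        unfolding A0(2)[symmetric] BMO_seminorm_def using that by (intro SUP_upper) auto
      then show ?thesis using A0(1) by (simp add: ennreal_le_iff)
    qed
    have "average (cube a h) (\<lambda>x. norm (G x - average (cube a h) G)) \<le> K * A0"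
      if h: "h > 0" and inside: "compactly_inside (cube a h) U" for a h
    proof -
      obtain r where r: "r > 0" "cbox (\<chi> i. a $ i - r) (\<chi> i. a $ i + h + r) \<subseteq> U"
        using cube_enlargement[OF U h inside] .
      \<comment> \<open>All functions are cut off to this closed enlarged cube, which makes them
        integrable on the whole space without affecting any cube that occurs.\<close>
      define C where "C = cbox (\<chi> i. a $ i - r) (\<chi> i. a $ i + h + r)"
      have C: "compact C" "C \<subseteq> U" "C \<in> sets borel" using r by (auto simp: C_def)
      have intG: "set_integrable lebesgue C G" and intu: "set_integrable lebesgue C u"
        using W C unfolding weak_gradient_def L1_loc_def by auto
      have sub: "set_integrable lebesgue (cube b k) G" "cube b k \<subseteq> C" "compactly_inside (cube b k) U" "k > 0"
        if "subcube b k (\<chi> i. a $ i - r) (h + 2 * r)" for b k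
      proof -
        show k: "k > 0" using that by (simp add: subcube_def)
        have s: "cbox b (\<chi> i. b $ i + k) \<subseteq> C"
        proof
          fix x assume "x \<in> cbox b (\<chi> i. b $ i + k)"
          then show "x \<in> C" using that unfolding subcube_def C_def mem_box_cart by (simp; smt (verit))
        qed
        then show c: "cube b k \<subseteq> C" using box_subset_cbox[of b "\<chi> i. b $ i + k"] by blast
        show "compactly_inside (cube b k) U"
          unfolding compactly_inside_def using c C by blast
        show "set_integrable lebesgue (cube b k) G" by (rule set_integrable_subset[OF intG _ c]) simp
      qed
      have ex_g: "\<exists>g. integrable lborel g \<and> (AE x in lebesgue. indicator C x * G x $ i $ j = g x) \<and> (\<forall>x. x \<notin> C \<longrightarrow> g x = 0)" for i j
        by (rule integrable_lebesgue_borel_version[OF _ C(3)])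
           (use set_integrable_entry[OF intG, of i j] in \<open>auto simp: set_integrable_def\<close>)
      have "\<forall>i. \<exists>gi. \<forall>j. integrable lborel (gi j) \<and> (AE x in lebesgue. indicator C x * G x $ i $ j = gi j x) \<and> (\<forall>x. x \<notin> C \<longrightarrow> gi j x = 0)"
        by (rule allI, rule choice, rule allI, rule ex_g)
      from choice[OF this] obtain g where g: "\<And>i j. integrable lborel (g i j)" "\<And>i j. AE x in lebesgue. indicator C x * G x $ i $ j = g i j x"
        "\<And>i j x. x \<notin> C \<Longrightarrow> g i j x = 0"
        by blast
      have iu: "integrable lebesgue (\<lambda>x. indicator C x * u x $ i)" for i
        using integrable_bounded_linear[OF bounded_linear_vec_nth intu[unfolded set_integrable_def], of i] by simp
      have ex_w: "\<exists>w. integrable lborel w \<and> (AE x in lebesgue. indicator C x * u x $ i = w x) \<and> (\<forall>x. x \<notin> C \<longrightarrow> w x = 0)" for i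
        by (rule integrable_lebesgue_borel_version[OF iu C(3)]) simp
      have "\<exists>w. \<forall>i. integrable lborel (w i) \<and> (AE x in lebesgue. indicator C x * u x $ i = w i x) \<and> (\<forall>x. x \<notin> C \<longrightarrow> w i x = 0)"
        by (rule choice, rule allI, rule ex_w)
      then obtain w where w: "\<And>i. integrable lborel (w i)" "\<And>i. AE x in lebesgue. indicator C x * u x $ i = w i x"
        by blast
      have iG: "integrable lebesgue (\<lambda>x. indicator C x * G x $ i $ j)" for i j
        using set_integrable_entry[OF intG, of i j] by (simp add: set_integrable_def)
      have [measurable]: "g i j \<in> borel_measurable borel" "w i \<in> borel_measurable borel" for i j
        using g(1)[of i j] w(1)[of i] by auto
      \<comment> \<open>For \<open>\<psi>\<close> supported in \<open>C\<close>, truncation and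
        change of representative are invisible, so the weak identity carries over to the Borel
        functions \<open>w\<close> and \<open>g\<close>.\<close>
      have transfer: "set_lebesgue_integral lebesgue U (\<lambda>x. f x * \<psi> x) = (LINT x|lborel. f' x * \<psi> x)"
        if f: "integrable lebesgue (\<lambda>x. indicator C x * f x)" "AE x in lebesgue. indicator C x * f x = f' x"
          and f': "f' \<in> borel_measurable borel" and \<psi>: "smooth \<psi>" "\<And>x. \<psi> x \<noteq> 0 \<Longrightarrow> x \<in> C"
        for f f' \<psi> :: "real^'n \<Rightarrow> real"
      proof -
        have [measurable]: "f' \<in> borel_measurable borel" "\<psi> \<in> borel_measurable borel"
          using f' smooth_continuous[OF \<psi>(1)] by (auto intro: borel_measurable_continuous_onI)
        have [measurable]: "\<psi> \<in> borel_measurable lebesgue" "f' \<in> borel_measurable lebesgue"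
          by (auto intro: measurable_completion)
        have [measurable]: "(\<lambda>x. indicator C x * f x) \<in> borel_measurable lebesgue" using f(1) by auto
        have "indicator U x *\<^sub>R (f x * \<psi> x) = (indicator C x * f x) * \<psi> x" for x
          using \<psi>(2)[of x] C(2) by (cases "\<psi> x = 0") (auto simp: indicator_def)
        then have "set_lebesgue_integral lebesgue U (\<lambda>x. f x * \<psi> x) = (LINT x|lebesgue. (indicator C x * f x) * \<psi> x)"
          unfolding set_lebesgue_integral_def by (intro Bochner_Integration.integral_cong refl)
        also have "\<dots> = (LINT x|lebesgue. f' x * \<psi> x)"
        proof (rule integral_cong_AE)
          show "AE x in lebesgue. (indicator C x * f x) * \<psi> x = f' x * \<psi> x"
            using f(2) by eventually_elim simp
        qed measurable
        also have "\<dots> = (LINT x|lborel. f' x * \<psi> x)"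
          by (rule integral_completion) measurable
        finally show ?thesis .
      qed
      have osc: "cube_osc (\<lambda>x. (g i j x + g j i x) / 2) b k \<le> A0"
        if s: "subcube b k (\<chi> i. a $ i - r) (h + 2 * r)" for b k i j
      proof -
        note s = sub[OF s]
        define E where "E x = sym_part (G x)" for x
        have E: "set_integrable lebesgue (cube b k) E"
          using integrable_bounded_linear[OF bounded_linear_sym_part s(1)[unfolded set_integrable_def]]
          by (simp add: set_integrable_def E_def linear_scale[OF bounded_linear.linear[OF bounded_linear_sym_part]])
        have "cube_osc (\<lambda>x. (g i j x + g j i x) / 2) b k = average (cube b k) (\<lambda>x. \<bar>E x $ i $ j - average (cube b k) (\<lambda>x. E x $ i $ j)\<bar>)"
        proof (rule average_osc_eq_cube_osc[OF s(4), symmetric])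
          show "(\<lambda>x. (g i j x + g j i x) / 2) \<in> borel_measurable borel" by measurable
          show "(\<lambda>x. indicator (cube b k) x * E x $ i $ j) \<in> borel_measurable lebesgue"
            using set_integrable_entry[OF E, of i j] by (auto simp: set_integrable_def)
          show "AE x in lebesgue. x \<in> cube b k \<longrightarrow> E x $ i $ j = (g i j x + g j i x) / 2"
            using g(2)[of i j] g(2)[of j i]
            by eventually_elim (use s(2) in \<open>auto simp: E_def sym_part_entry\<close>)
        qed
        also have "\<dots> \<le> average (cube b k) (\<lambda>x. norm (E x - average (cube b k) E))"
          by (rule average_osc_entry_le[OF E])
        also have "\<dots> \<le> A0" using symA[OF s(4,3)] unfolding E_def .
        finally show ?thesis .
      qed
      have self: "subcube a h (\<chi> i. a $ i - r) (h + 2 * r)" using h r by (simp add: subcube_def)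
      have entry: "average (cube a h) (\<lambda>x. \<bar>G x $ i $ j - average (cube a h) (\<lambda>x. G x $ i $ j)\<bar>) \<le> K0 * A0" for i j
      proof (rule field_le_epsilon)
        fix d :: real assume d: "d > 0"
        have "average (cube a h) (\<lambda>x. \<bar>G x $ i $ j - average (cube a h) (\<lambda>x. G x $ i $ j)\<bar>) = cube_osc (g i j) a h"
        proof (rule average_osc_eq_cube_osc[OF h])
          show "(\<lambda>x. indicator (cube a h) x * G x $ i $ j) \<in> borel_measurable lebesgue"
            using set_integrable_entry[OF sub(1)[OF self], of i j] by (auto simp: set_integrable_def)
          show "AE x in lebesgue. x \<in> cube a h \<longrightarrow> G x $ i $ j = g i j x"
            using g(2)[of i j] by eventually_elim (use sub(2)[OF self] in auto)
        qed measurable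
        \<comment> \<open>\<open>A0\<close> may be 0 whereas \<open>korn\<close> needs a positive
          bound; the extra \<open>d / K0\<close> costs exactly \<open>d\<close>.\<close>
        also have "\<dots> \<le> K0 * (A0 + d / K0)"
        proof (rule korn[OF w(1) g(1) C(1) g(3) h r(1)])
          show "0 < A0 + d / K0" using A0 K0 d by (simp add: add_nonneg_pos)
          show "cube_osc (\<lambda>x. (g i j x + g j i x) / 2) b k \<le> A0 + d / K0"
            if "subcube b k (\<chi> i. a $ i - r) (h + 2 * r)" for b k i j
            using osc[OF that, of i j] d K0 by (smt (verit) divide_pos_pos)
          fix \<phi> i j assume \<phi>: "test_function UNIV \<phi>" "\<And>x. \<phi> x \<noteq> 0 \<Longrightarrow> x \<in> cbox (\<chi> i. a $ i - r) (\<chi> i. a $ i + h + r)"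
          have s\<phi>: "\<And>x. \<phi> x \<noteq> 0 \<Longrightarrow> x \<in> C" using \<phi>(2) unfolding C_def .
          have "test_function U \<phi>"
            by (rule test_functionI[OF test_function_smooth[OF \<phi>(1)] C(1,2)]) (use s\<phi> in blast)
          then have "set_lebesgue_integral lebesgue U (\<lambda>x. u x $ i * partial_deriv j \<phi> x) =
            - set_lebesgue_integral lebesgue U (\<lambda>x. G x $ i $ j * \<phi> x)"
            using W unfolding weak_gradient_def by blast
          moreover have "set_lebesgue_integral lebesgue U (\<lambda>x. u x $ i * partial_deriv j \<phi> x) = (LINT x|lborel. w i x * partial_deriv j \<phi> x)"
            using partial_support[of \<phi> C j, OF s\<phi> compact_imp_closed[OF C(1)]]
            by (intro transfer iu w(2) smooth_partial test_function_smooth[OF \<phi>(1)]) auto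
          moreover have "set_lebesgue_integral lebesgue U (\<lambda>x. G x $ i $ j * \<phi> x) = (LINT x|lborel. g i j x * \<phi> x)"
            using s\<phi> by (intro transfer iG g(2) test_function_smooth[OF \<phi>(1)]) auto
          ultimately show "(LINT x|lborel. w i x * partial_deriv j \<phi> x) = - (LINT x|lborel. g i j x * \<phi> x)" by simp
        qed
        also have "\<dots> = K0 * A0 + d" using K0 by (simp add: distrib_left)
        finally show "average (cube a h) (\<lambda>x. \<bar>G x $ i $ j - average (cube a h) (\<lambda>x. G x $ i $ j)\<bar>) \<le> K0 * A0 + d" .
      qed
      have "average (cube a h) (\<lambda>x. norm (G x - average (cube a h) G)) \<le> (\<Sum>i\<in>(UNIV::'n set). \<Sum>j\<in>(UNIV::'n set). K0 * A0)"
        by (rule order.trans[OF average_osc_le_sum[OF sub(1)[OF self]]]) (intro sum_mono entry)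
      also have "\<dots> = K * A0" by (simp add: K_def power2_eq_square)
      finally show ?thesis .
    qed
    then have "ennreal (average Q (\<lambda>x. norm (G x - average Q G))) \<le> ennreal (K * A0)"
      if "is_cube Q" "compactly_inside Q U" for Q
      using that unfolding is_cube_def by (auto intro!: ennreal_leI)
    then show ?thesis
      unfolding A0(2) using K A0(1) by (subst (1) BMO_seminorm_def) (auto simp: ennreal_mult[symmetric] intro!: SUP_least)
  qed
  then show ?thesis using K unfolding is_domain_def by blast
qed

end
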